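(* For every set $S$ of $N$ points in the plane in general position, \[ \mathrm{pm}(S) \le 8\cdot (3/2)^{N/4}\cdot \mathrm{tr}(S), \] so in particular $\mathrm{pm}(S) = O(1.1067^N)\cdot \mathrm{tr}(S)$.
   Context: General position means no three points collinear. A crossing-free straight-edge graph on $S$ has vertex set $S$ and edges drawn as straight segments meeting only at common endpoints. A triangulation of $S$ is a maximal crossing-free straight-edge graph on $S$; $\mathrm{tr}(S)$ is the number of triangulations of $S$. $\mathrm{pm}(S)$ is the number of crossing-free straight-edge perfect matchings on $S$ (sets of pairwise non-crossing straight segments with endpoints in $S$ covering every point of $S$ exactly once). *)

theory Defs
  imports "HOL-Analysis.Analysis" "HOL-Library.Landau_Symbols"
begin

type_synonym point = "real ^ 2"

definition general_position :: "point set \<Rightarrow> bool" where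
  "general_position S \<longleftrightarrow>
     (\<forall>p\<in>S. \<forall>q\<in>S. \<forall>r\<in>S. p \<noteq> q \<and> q \<noteq> r \<and> p \<noteq> r \<longrightarrow> \<not> collinear {p, q, r})"

text \<open>A straight-edge graph with vertex set \<open>S\<close> is given by its set \<open>E\<close> of edges.  An edge is the
  two-element set of its endpoints, and its convex hull is the segment drawn for it.\<close>

definition crossing_free_graph :: "point set \<Rightarrow> point set set \<Rightarrow> bool" where
  "crossing_free_graph S E \<longleftrightarrow>
     (\<forall>e\<in>E. e \<subseteq> S \<and> card e = 2) \<and>
     (\<forall>e\<in>E. \<forall>f\<in>E. e \<noteq> f \<longrightarrow> convex hull e \<inter> convex hull f = e \<inter> f)"

definition triangulation_on :: "point set \<Rightarrow> point set set \<Rightarrow> bool" where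
  "triangulation_on S T \<longleftrightarrow>
     crossing_free_graph S T \<and>
     (\<forall>E. crossing_free_graph S E \<and> T \<subseteq> E \<longrightarrow> E = T)"

definition crossing_free_perfect_matching :: "point set \<Rightarrow> point set set \<Rightarrow> bool" where
  "crossing_free_perfect_matching S M \<longleftrightarrow>
     crossing_free_graph S M \<and> (\<forall>p\<in>S. \<exists>!e. e \<in> M \<and> p \<in> e)"

definition tr :: "point set \<Rightarrow> nat" where
  "tr S = card {T. triangulation_on S T}"

definition pm :: "point set \<Rightarrow> nat" where
  "pm S = card {M. crossing_free_perfect_matching S M}"

end

theory Submission
  imports "Jordan_Normal_Form.Schur_Decomposition" Defs
begin

text \<open>
  Count the pairs of a matching \<open>M\<close> and a triangulation \<open>T \<supseteq> M\<close> in two ways; let \<open>N = 2 * n\<close>.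

  Lower bound: every \<open>M\<close> lies in at least \<open>2 ^ (n - 3)\<close> triangulations.  Extend the edges of \<open>M\<close> in both
  directions until they are blocked.  This cuts the plane into at most \<open>n + 1\<close> convex cells, and every
  point lies on the boundary of exactly two of them.  The points on the boundary of a cell are in convex
  position; if there are \<open>k\<close> of them, there are \<open>2 ^ (k - 3)\<close> pairwise incompatible sets of
  diagonals inside the cell.  The values \<open>k - 3\<close> add up to at least \<open>2 * N - 3 * (n + 1) = n - 3\<close>.

  Upper bound: every crossing-free graph contains at most \<open>6 ^ (n / 2)\<close> perfect matchings.  Order the points by
  their first coordinates and orient an edge according to the parity of the number of points
  below it.  For disjoint segments these parities compensate the sign of the permutation, so the
  Pfaffian of the signed adjacency matrix counts the perfect matchings.  Its square is
  the determinant, which is bounded by means of the inequality between the arithmetic and geometric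
  means applied to the squared singular values, whose sum is twice the number of edges, that is at most \<open>6 * N\<close>.
\<close>

section \<open>Signs of permutations\<close>

text \<open>The quotient of the two bounds is \<open>6 ^ (n / 2) / 2 ^ n = (3 / 2) ^ (n / 2)\<close>
  with \<open>n / 2 = N / 4\<close>, and the 8 pays for the 3 in the exponent \<open>n - 3\<close>.
  On the lower side nothing is known about the distribution of the points among the cells, so the
  exponents have to be additive. This is why a convex \<open>k\<close>-gon contributes
  \<open>2 ^ (k - 3)\<close> and not the Catalan number of its triangulations. Little is lost:
  \<open>n + 1\<close> cells correspond to about four points per cell, and the two numbers agree for
  \<open>k = 3\<close> and \<open>k = 4\<close>. Incompatible sets contain crossing diagonals, so
  they stay different when completed to triangulations. Cells are convex because a reflex angle
  could only arise at the end of a segment, and every such end inside the slab lies in the interior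
  of another segment. On the upper side all Pfaffian terms equal 1, so nothing cancels; the relation
  to the determinant is obtained by linear algebra in a symplectic basis, not by superposing
  matchings. Segments are treated as graphs of affine functions of the first coordinate, which needs
  distinct first coordinates; a shear provides them at the very end.\<close>

definition inversion_sign :: "nat \<Rightarrow> (nat \<Rightarrow> nat) \<Rightarrow> real" where
  "inversion_sign N p = (\<Prod>(i, j) | i < j \<and> j < N. sgn (real (p j) - real (p i)))"

lemma finite_index_pairs: "finite {(i, j). i < j \<and> j < (N::nat)}"
  by (rule finite_subset[of _ "{..<N} \<times> {..<N}"]) auto

text \<open>Multiplying each factor by \<open>sgn (j - i)\<close> makes it symmetric
  (\<open>h\<close>), so that the product runs over unordered pairs and may be renamed along
  \<open>q\<close>. The factors left over are those of \<open>q\<close>.\<close>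

lemma inversion_sign_compose:
  assumes p: "p permutes {..<N}" and q: "q permutes {..<N}"
  shows "inversion_sign N (p \<circ> q) = inversion_sign N p * inversion_sign N q"
proof -
  let ?P = "{(i, j). i < j \<and> j < N}"
  define h where "h = (\<lambda>i j. sgn ((real (p j) - real (p i)) * (real j - real i)))"
  \<comment> \<open>\<open>q\<close> acting on unordered pairs, each represented with its smaller
    index first.\<close>
  define m where "m = (\<lambda>(i, j). (min (q i) (q j), max (q i) (q j)))"
  define m' where "m' = (\<lambda>(i, j). (min (Hilbert_Choice.inv q i) (Hilbert_Choice.inv q j), max (Hilbert_Choice.inv q i) (Hilbert_Choice.inv q j)))"
  have qi: "Hilbert_Choice.inv q permutes {..<N}" using q by (rule permutes_inv)
  have inq: "q i < N" if "i < N" for i using q that by (metis lessThan_iff permutes_in_image)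
  have inqi: "Hilbert_Choice.inv q i < N" if "i < N" for i using qi that by (metis lessThan_iff permutes_in_image)
  have injq: "q i = q j \<longleftrightarrow> i = j" for i j using permutes_inj[OF q] by (auto dest: injD)
  have injqi: "Hilbert_Choice.inv q i = Hilbert_Choice.inv q j \<longleftrightarrow> i = j" for i j using permutes_inj[OF qi] by (auto dest: injD)
  have sym: "h i j = h j i" for i j unfolding h_def by (simp add: algebra_simps)
  have pp: "inversion_sign N p = (\<Prod>(i, j)\<in>?P. h i j)"
    unfolding inversion_sign_def h_def
    by (intro prod.cong) (auto simp: sgn_mult)
  have "inversion_sign N (p \<circ> q) = (\<Prod>(i, j)\<in>?P. h (q i) (q j) * sgn (real (q j) - real (q i)))"
    unfolding inversion_sign_def h_def
  proof (intro prod.cong refl, clarsimp)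
    fix i j assume "i < j" "j < N"
    then have "q i \<noteq> q j" using injq by simp
    then have "sgn ((real (q j) - real (q i)) * (real (q j) - real (q i))) = 1"
      by (auto simp: sgn_if zero_less_mult_iff)
    then show "sgn (real (p (q j)) - real (p (q i))) =
      sgn ((real (p (q j)) - real (p (q i))) * (real (q j) - real (q i))) * sgn (real (q j) - real (q i))"
      by (simp add: sgn_mult mult.assoc)
  qed
  also have "\<dots> = (\<Prod>(i, j)\<in>?P. h (q i) (q j)) * inversion_sign N q"
    unfolding inversion_sign_def by (simp add: case_prod_unfold prod.distrib)
  also have "(\<Prod>(i, j)\<in>?P. h (q i) (q j)) = (\<Prod>(i, j)\<in>?P. h i j)"
  proof (rule prod.reindex_bij_witness[of _ m' m])
    fix x assume "x \<in> ?P"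
    then show "m' (m x) = x" "m x \<in> ?P"
      using inq injq permutes_inverses[OF q]
      by (auto simp: m_def m'_def min_def max_def linorder_neq_iff not_le split: if_splits)
         (metis nat_less_le nle_le)+
  next
    fix x assume "x \<in> ?P"
    then show "m (m' x) = x" "m' x \<in> ?P"
      using inqi injqi permutes_inverses[OF q]
      by (auto simp: m_def m'_def min_def max_def linorder_neq_iff not_le split: if_splits)
         (metis nat_less_le nle_le)+
  next
    fix x assume "x \<in> ?P"
    then show "(case m x of (i, j) \<Rightarrow> h i j) = (case x of (i, j) \<Rightarrow> h (q i) (q j))"
      using sym by (auto simp: m_def min_def max_def)
  qed
  finally show ?thesis unfolding pp .
qed

lemma inversion_sign_id: "inversion_sign N id = 1"
  unfolding inversion_sign_def by (intro prod.neutral) auto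

lemma inversion_sign_transpose_0_1:
  assumes "2 \<le> N"
  shows "inversion_sign N (Transposition.transpose 0 1) = -1"
proof -
  let ?f = "\<lambda>(i, j). sgn (real (Transposition.transpose 0 1 j) - real (Transposition.transpose 0 (1::nat) i))"
  have "inversion_sign N (Transposition.transpose 0 1) = ?f (0, 1) * prod ?f ({(i, j). i < j \<and> j < N} - {(0, 1)})"
    unfolding inversion_sign_def using assms
    by (subst prod.remove[of _ "(0,1)"]) (auto simp: finite_index_pairs)
  also have "prod ?f ({(i, j). i < j \<and> j < N} - {(0, 1)}) = 1"
    by (intro prod.neutral) (auto simp: Transposition.transpose_def sgn_if split: if_splits)
  finally show ?thesis by simp
qed

text \<open>Every transposition is conjugate to that of 0 and 1, and the nonzero sign of the
  conjugating \<open>q\<close> cancels. For 0 and 1 the only inversion is evident.\<close>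

lemma inversion_sign_transpose:
  assumes "a < N" "b < N" "a \<noteq> b"
  shows "inversion_sign N (Transposition.transpose a b) = -1"
proof -
  have N: "2 \<le> N" using assms by simp
  \<comment> \<open>\<open>c\<close> is the place of \<open>b\<close> after \<open>a\<close> has
    been swapped with 0; hence \<open>q\<close> maps 0 to \<open>a\<close> and 1 to
    \<open>b\<close>.\<close>
  define c where "c = Transposition.transpose 0 a b"
  define q where "q = Transposition.transpose 0 a \<circ> Transposition.transpose 1 c"
  have cN: "c < N" using assms by (auto simp: c_def Transposition.transpose_def)
  have q: "q permutes {..<N}" unfolding q_def
    by (intro permutes_compose permutes_swap_id) (use assms cN N in auto)
  have c0: "c \<noteq> 0" using assms by (auto simp: c_def Transposition.transpose_def split: if_splits)
  have q0: "q 0 = a" using c0 by (auto simp: q_def Transposition.transpose_def)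
  have q1: "q 1 = b" by (simp add: q_def c_def)
  have t: "Transposition.transpose a b permutes {..<N}" by (intro permutes_swap_id) (use assms in auto)
  have t01: "Transposition.transpose 0 (1::nat) permutes {..<N}" by (intro permutes_swap_id) (use N in auto)
  have "Transposition.transpose a b \<circ> q = q \<circ> Transposition.transpose 0 1"
    using q0 q1 bij_is_inj[OF permutes_bij[OF q]]
    by (auto simp: fun_eq_iff Transposition.transpose_def inj_def)
  then have "inversion_sign N (Transposition.transpose a b) * inversion_sign N q
      = inversion_sign N q * inversion_sign N (Transposition.transpose 0 1)"
    by (metis inversion_sign_compose q t t01)
  moreover have "inversion_sign N q \<noteq> 0"
    using inversion_sign_compose[OF q permutes_inv[OF q]] permutes_inv_o(1)[OF q]
    by (auto simp: inversion_sign_id)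
  ultimately show ?thesis using inversion_sign_transpose_0_1[OF N] by simp
qed

text \<open>Both sides are 1 at the identity and change sign under a transposition. The product form
  is wanted because it splits over pairs of positions, and so over pairs of edges.\<close>

lemma sign_eq_inversion_sign:
  assumes "p permutes {..<N}"
  shows "real_of_int (sign p) = inversion_sign N p"
  using assms finite_lessThan
proof (induction rule: permutes_induct)
  case id
  then show ?case by (simp add: inversion_sign_id[unfolded id_def] inversion_sign_id)
next
  case (swap a b p)
  have "permutation p" using swap permutes_imp_permutation by blast
  then have "sign (Transposition.transpose a b \<circ> p) = - sign p"
    using swap by (simp add: sign_compose sign_swap_id permutation_swap_id)
  moreover have "inversion_sign N (Transposition.transpose a b \<circ> p) = - inversion_sign N p"
    using swap by (subst inversion_sign_compose) (auto simp: inversion_sign_transpose permutes_swap_id)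
  ultimately show ?case using swap.IH by (simp only: of_int_minus)
qed

lemma prod_lessThan_double:
  "(\<Prod>i<2 * n. g i) = (\<Prod>k<n. g (2 * k) * g (Suc (2 * k)) :: 'a::comm_monoid_mult)"
  by (induction n) (auto simp: mult_ac)

text \<open>The blocks \<open>2 * k, Suc (2 * k)\<close> will hold the two ends of an edge: the
  first product collects the orientations of single edges, the second the interaction of two
  edges.\<close>

lemma inversion_sign_blocks:
  "inversion_sign (2 * n) p =
    (\<Prod>k<n. sgn (real (p (Suc (2 * k))) - real (p (2 * k)))) *
    (\<Prod>l<n. \<Prod>k<l.
       sgn (real (p (2 * l)) - real (p (2 * k))) * sgn (real (p (2 * l)) - real (p (Suc (2 * k)))) *
       sgn (real (p (Suc (2 * l))) - real (p (2 * k))) * sgn (real (p (Suc (2 * l))) - real (p (Suc (2 * k)))))"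
proof -
  let ?s = "\<lambda>i j. sgn (real (p j) - real (p i))"
  have "inversion_sign (2 * n) p = (\<Prod>j<2*n. \<Prod>i<j. ?s i j)"
    unfolding inversion_sign_def
    by (subst prod.Sigma) (auto intro!: prod.reindex_bij_witness[of _ "\<lambda>(i,j). (j,i)" "\<lambda>(i,j). (j,i)"])
  also have "\<dots> = (\<Prod>l<n. (\<Prod>i<2*l. ?s i (2*l)) * (\<Prod>i<Suc (2*l). ?s i (Suc (2*l))))"
    by (rule prod_lessThan_double)
  also have "\<dots> = (\<Prod>l<n. ?s (2*l) (Suc (2*l)) * (\<Prod>k<l.
       ?s (2*k) (2*l) * ?s (Suc (2*k)) (2*l) * ?s (2*k) (Suc (2*l)) * ?s (Suc (2*k)) (Suc (2*l))))"
    by (intro prod.cong refl, unfold prod.lessThan_Suc prod_lessThan_double prod.distrib) (simp add: mult_ac)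
  finally show ?thesis by (simp add: prod.distrib)
qed

section \<open>Pfaffian sums\<close>

text \<open>
  The Pfaffian without its normalisation: every perfect matching of the index set is counted
  \<open>card (block_perms n)\<close> times, once for every way of listing its pairs.
\<close>

definition pfsum :: "nat \<Rightarrow> (nat \<Rightarrow> nat \<Rightarrow> real) \<Rightarrow> real" where
  "pfsum n A = (\<Sum>\<sigma> | \<sigma> permutes {..<2 * n}.
     of_int (sign \<sigma>) * (\<Prod>k<n. A (\<sigma> (2 * k)) (\<sigma> (Suc (2 * k)))))"

definition fdet :: "nat \<Rightarrow> (nat \<Rightarrow> nat \<Rightarrow> real) \<Rightarrow> real" where
  "fdet N B = Determinant.det (Matrix.mat N N (\<lambda>(i, j). B i j))"

lemma permutes_less:
  assumes "p permutes {..<N}" "i < N"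
  shows "p i < N"
  using permutes_in_image[OF assms(1)] assms(2) by blast

lemma fdet_columns:
  "fdet N B = (\<Sum>\<sigma> | \<sigma> permutes {..<N}. of_int (sign \<sigma>) * (\<Prod>i<N. B (\<sigma> i) i))"
proof -
  have "fdet N B = (\<Sum>p | p permutes {0..<N}. of_int (sign p) * (\<Prod>j<N. Matrix.mat N N (\<lambda>(i, j). B i j) $$ (p j, j)))"
    unfolding fdet_def by (rule det_col) simp
  also have "\<dots> = (\<Sum>\<sigma> | \<sigma> permutes {..<N}. of_int (sign \<sigma>) * (\<Prod>i<N. B (\<sigma> i) i))"
    unfolding atLeast0LessThan
    by (intro sum.cong refl arg_cong2[of _ _ _ _ "(*)"] prod.cong) (auto simp: permutes_less)
  finally show ?thesis .
qed

text \<open>The sum is the determinant of the matrix whose column \<open>i\<close> is column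
  \<open>f i\<close> of \<open>B\<close>. If \<open>f\<close> is not injective, two columns agree;
  otherwise reindexing extracts its sign.\<close>

lemma alternating_sum_columns:
  assumes f: "\<forall>i<N. f i < N" "\<forall>i\<ge>N. f i = i"
  shows "(\<Sum>\<sigma> | \<sigma> permutes {..<N}. of_int (sign \<sigma>) * (\<Prod>i<N. B (\<sigma> i) (f i)))
    = (if f permutes {..<N} then of_int (sign f) * fdet N B else 0)"
proof (cases "f permutes {..<N}")
  case True
  have pf: "permutation f" using True permutes_imp_permutation by blast
  have "(\<Sum>\<sigma> | \<sigma> permutes {..<N}. of_int (sign \<sigma>) * (\<Prod>i<N. B (\<sigma> i) (f i)))
     = (\<Sum>\<sigma> | \<sigma> permutes {..<N}. of_int (sign (\<sigma> \<circ> f)) * (\<Prod>i<N. B ((\<sigma> \<circ> f) i) (f i)))"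
    by (rule sum.reindex_bij_witness[of _ "\<lambda>\<sigma>. \<sigma> \<circ> f" "\<lambda>\<sigma>. \<sigma> \<circ> Hilbert_Choice.inv f"])
       (use True in \<open>auto intro!: permutes_compose permutes_inv simp: comp_assoc permutes_inv_o\<close>)
  also have "\<dots> = (\<Sum>\<sigma> | \<sigma> permutes {..<N}. of_int (sign f) * (of_int (sign \<sigma>) * (\<Prod>i<N. B (\<sigma> i) i)))"
  proof (intro sum.cong refl)
    fix \<sigma> assume "\<sigma> \<in> {\<sigma>. \<sigma> permutes {..<N}}"
    then have "permutation \<sigma>" using permutes_imp_permutation by blast
    moreover have "(\<Prod>i<N. B ((\<sigma> \<circ> f) i) (f i)) = (\<Prod>i<N. B (\<sigma> i) i)"
      using prod.permute[OF True, of "\<lambda>i. B (\<sigma> i) i"] by (simp add: comp_def)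
    ultimately show "of_int (sign (\<sigma> \<circ> f)) * (\<Prod>i<N. B ((\<sigma> \<circ> f) i) (f i)) =
       real_of_int (sign f) * (of_int (sign \<sigma>) * (\<Prod>i<N. B (\<sigma> i) i))"
      using pf by (simp only: sign_compose) simp
  qed
  finally show ?thesis using True by (simp add: fdet_columns sum_distrib_left)
next
  case False
  have "\<not> inj_on f {..<N}"
  proof
    assume inj: "inj_on f {..<N}"
    then have "bij_betw f {..<N} {..<N}"
      using f(1) endo_inj_surj[of "{..<N}" f] by (auto simp: bij_betw_def)
    then have "f permutes {..<N}" using f(2) by (intro bij_imp_permutes) auto
    with False show False by simp
  qed
  then obtain i j where ij: "i < N" "j < N" "i \<noteq> j" "f i = f j" by (auto simp: inj_on_def)
  have "(\<Sum>\<sigma> | \<sigma> permutes {..<N}. of_int (sign \<sigma>) * (\<Prod>i<N. B (\<sigma> i) (f i))) = fdet N (\<lambda>i j. B i (f j))"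
    by (simp add: fdet_columns)
  also have "\<dots> = 0" unfolding fdet_def
    by (rule Determinant.det_identical_columns[of _ N i j]) (use ij in \<open>auto intro!: eq_vecI\<close>)
  finally show ?thesis using False by simp
qed

text \<open>The choices of \<open>a\<close> and \<open>b\<close> in the \<open>n\<close> factors are
  merged into one function on \<open>2 * n\<close> indices. Continuing it by the identity makes it
  unique and places the permutations among these functions.\<close>

lemma prod_double_sum:
  fixes F :: "nat \<Rightarrow> nat \<Rightarrow> nat \<Rightarrow> real"
  assumes "finite S"
  shows "(\<Prod>k<n. \<Sum>a\<in>S. \<Sum>b\<in>S. F k a b) =
    (\<Sum>f | (\<forall>i<2*n. f i \<in> S) \<and> (\<forall>i\<ge>2*n. f i = i). \<Prod>k<n. F k (f (2*k)) (f (Suc (2*k))))"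
proof -
  have "(\<Prod>k<n. \<Sum>a\<in>S. \<Sum>b\<in>S. F k a b) = (\<Prod>k<n. \<Sum>x\<in>S \<times> S. F k (fst x) (snd x))"
    by (simp add: sum.cartesian_product case_prod_unfold)
  also have "\<dots> = (\<Sum>g\<in>PiE {..<n} (\<lambda>_. S \<times> S). \<Prod>k<n. F k (fst (g k)) (snd (g k)))"
    using assms by (intro prod_sum_PiE) auto
  also have "\<dots> = (\<Sum>f | (\<forall>i<2*n. f i \<in> S) \<and> (\<forall>i\<ge>2*n. f i = i). \<Prod>k<n. F k (f (2*k)) (f (Suc (2*k))))"
  proof (rule sum.reindex_bij_witness[of _ "\<lambda>f. \<lambda>k\<in>{..<n}. (f (2*k), f (Suc (2*k)))"
        "\<lambda>g i. if i < 2*n then (if even i then fst (g (i div 2)) else snd (g (i div 2))) else i"])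
    fix g assume g: "g \<in> PiE {..<n} (\<lambda>_. S \<times> S)"
    let ?f = "\<lambda>i. if i < 2*n then (if even i then fst (g (i div 2)) else snd (g (i div 2))) else i"
    show "(\<lambda>k\<in>{..<n}. (?f (2*k), ?f (Suc (2*k)))) = g"
      using g by (auto simp: fun_eq_iff PiE_def extensional_def restrict_def)
    have "g (i div 2) \<in> S \<times> S" if "i < 2 * n" for i
      using g that by (intro PiE_mem[OF g]) auto
    then show "?f \<in> {f. (\<forall>i<2*n. f i \<in> S) \<and> (\<forall>i\<ge>2*n. f i = i)}"
      by (auto simp: mem_Times_iff)
    show "(\<Prod>k<n. F k (?f (2*k)) (?f (Suc (2*k)))) = (\<Prod>k<n. F k (fst (g k)) (snd (g k)))"
      by (intro prod.cong) auto
  next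
    fix f :: "nat \<Rightarrow> nat" assume f: "f \<in> {f. (\<forall>i<2*n. f i \<in> S) \<and> (\<forall>i\<ge>2*n. f i = i)}"
    let ?g = "\<lambda>k\<in>{..<n}. (f (2*k), f (Suc (2*k)))"
    show "?g \<in> PiE {..<n} (\<lambda>_. S \<times> S)" using f by auto
    have "i div 2 < n \<longleftrightarrow> i < 2 * n" for i by auto
    then show "(\<lambda>i. if i < 2*n then (if even i then fst (?g (i div 2)) else snd (?g (i div 2))) else i) = f"
      using f by (auto simp: fun_eq_iff elim!: evenE oddE)
  qed
  finally show ?thesis .
qed

text \<open>The rule \<open>Pf (B A B^T) = det B * Pf A\<close>. After expansion the sum over
  \<open>\<sigma>\<close> is an alternating sum of columns, so only those choices \<open>f\<close>
  survive that are permutations.\<close>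

lemma pfsum_congruence:
  "pfsum n (\<lambda>i j. \<Sum>a<2*n. \<Sum>b<2*n. B i a * A a b * B j b) = fdet (2 * n) B * pfsum n A"
proof -
  let ?F = "{f. (\<forall>i<2*n. f i \<in> {..<2*n}) \<and> (\<forall>i\<ge>2*n. f i = i)}"
  let ?A = "\<lambda>f. \<Prod>k<n. A (f (2*k)) (f (Suc (2*k)))"
  let ?S = "\<lambda>f. \<Sum>\<sigma> | \<sigma> permutes {..<2*n}. of_int (sign \<sigma>) * (\<Prod>i<2*n. B (\<sigma> i) (f i))"
  have sub: "{\<sigma>. \<sigma> permutes {..<2*n}} \<subseteq> ?F"
    by (auto simp: permutes_less permutes_not_in)
  have fin: "finite ?F"
  proof -
    show ?thesis
      using Missing_Misc.finite_bounded_functions[of "{..<2*n}" "{..<2*n}"] by (simp add: not_less Ball_def)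
  qed
  have "pfsum n (\<lambda>i j. \<Sum>a<2*n. \<Sum>b<2*n. B i a * A a b * B j b) =
    (\<Sum>\<sigma> | \<sigma> permutes {..<2*n}. of_int (sign \<sigma>) * (\<Sum>f\<in>?F.
       \<Prod>k<n. B (\<sigma> (2*k)) (f (2*k)) * A (f (2*k)) (f (Suc (2*k))) * B (\<sigma> (Suc (2*k))) (f (Suc (2*k)))))"
    unfolding pfsum_def
    by (intro sum.cong refl arg_cong2[of _ _ _ _ "(*)"]) (rule prod_double_sum, simp)
  also have "\<dots> = (\<Sum>\<sigma> | \<sigma> permutes {..<2*n}. \<Sum>f\<in>?F. ?A f * (of_int (sign \<sigma>) * (\<Prod>i<2*n. B (\<sigma> i) (f i))))"
    unfolding prod_lessThan_double by (simp add: sum_distrib_left prod.distrib mult_ac)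
  also have "\<dots> = (\<Sum>f\<in>?F. ?A f * ?S f)"
    by (subst sum.swap) (simp add: sum_distrib_left)
  also have "\<dots> = (\<Sum>f\<in>?F. ?A f * (if f permutes {..<2*n} then of_int (sign f) * fdet (2*n) B else 0))"
    by (intro sum.cong refl) (auto simp: alternating_sum_columns)
  also have "\<dots> = (\<Sum>f | f permutes {..<2*n}. ?A f * (of_int (sign f) * fdet (2*n) B))"
    using fin sub by (intro sum.mono_neutral_cong_right) auto
  finally show ?thesis by (simp add: pfsum_def sum_distrib_left mult_ac)
qed

section \<open>The standard symplectic form, a direct sum of 2 by 2 blocks with entries 1 and
  -1\<close>

definition std_form :: "nat \<Rightarrow> nat \<Rightarrow> real" where
  "std_form i j = (if i div 2 = j div 2 then real j - real i else 0)"

definition partial_form :: "nat \<Rightarrow> nat \<Rightarrow> nat \<Rightarrow> real" where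
  "partial_form k i j = (if i < 2 * k then std_form i j else 0)"

text \<open>The permutations that map blocks to blocks. There are \<open>2 ^ n * fact n\<close> of
  them, but the number stays symbolic because it cancels in the end.\<close>

definition block_perms :: "nat \<Rightarrow> (nat \<Rightarrow> nat) set" where
  "block_perms n = {\<sigma>. \<sigma> permutes {..<2 * n} \<and> (\<forall>k<n. \<sigma> (2 * k) div 2 = \<sigma> (Suc (2 * k)) div 2)}"

lemma finite_block_perms: "finite (block_perms n)"
  unfolding block_perms_def by (rule finite_subset[OF _ finite_permutations[of "{..<2*n}"]]) auto

lemma block_perms_pos: "0 < card (block_perms n)"
proof -
  have "id \<in> block_perms n" by (auto simp: block_perms_def permutes_id)
  then show ?thesis using finite_block_perms by (auto simp: card_gt_0_iff)
qed

lemma pfsum_cong: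
  assumes "\<And>i j. i < 2 * n \<Longrightarrow> j < 2 * n \<Longrightarrow> A i j = B i j"
  shows "pfsum n A = pfsum n B"
  unfolding pfsum_def
proof (intro sum.cong refl arg_cong2[of _ _ _ _ "(*)"] prod.cong)
  fix \<sigma> k assume "\<sigma> \<in> {\<sigma>. \<sigma> permutes {..<2 * n}}" "k \<in> {..<n}"
  then show "A (\<sigma> (2 * k)) (\<sigma> (Suc (2 * k))) = B (\<sigma> (2 * k)) (\<sigma> (Suc (2 * k)))"
    using permutes_less[of \<sigma> "2 * n" "2 * k"] permutes_less[of \<sigma> "2 * n" "Suc (2 * k)"]
    by (simp add: assms)
qed

lemma sgn_nat_diff_square:
  assumes "a \<noteq> b"
  shows "sgn (real a - real b) * sgn (real a - real b) = 1"
  using assms by (simp add: sgn_if)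

text \<open>Each orientation factor is 1 or -1 and occurs squared, so only the interactions between
  different blocks remain.\<close>

lemma sign_times_orientations:
  assumes "\<sigma> permutes {..<2 * n}"
  shows "of_int (sign \<sigma>) * (\<Prod>k<n. sgn (real (\<sigma> (Suc (2 * k))) - real (\<sigma> (2 * k)))) =
    (\<Prod>l<n. \<Prod>k<l.
       sgn (real (\<sigma> (2 * l)) - real (\<sigma> (2 * k))) * sgn (real (\<sigma> (2 * l)) - real (\<sigma> (Suc (2 * k)))) *
       sgn (real (\<sigma> (Suc (2 * l))) - real (\<sigma> (2 * k))) * sgn (real (\<sigma> (Suc (2 * l))) - real (\<sigma> (Suc (2 * k)))))"
proof -
  have "(\<Prod>k<n. sgn (real (\<sigma> (Suc (2 * k))) - real (\<sigma> (2 * k)))) *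
    (\<Prod>k<n. sgn (real (\<sigma> (Suc (2 * k))) - real (\<sigma> (2 * k)))) = 1"
    unfolding prod.distrib[symmetric]
    by (intro prod.neutral ballI sgn_nat_diff_square) (metis assms n_not_Suc_n permutes_inj inj_eq)
  then show ?thesis
    unfolding sign_eq_inversion_sign[OF assms] inversion_sign_blocks by (simp add: mult.commute)
qed

lemma sgn_blocks:
  assumes "a div 2 = b div 2" "c div 2 = d div 2" "a div 2 \<noteq> (c::nat) div 2"
  shows "sgn (real c - real a) * sgn (real c - real b) * sgn (real d - real a) * sgn (real d - real b) = 1"
proof -
  have "a < c \<and> b < c \<and> a < d \<and> b < d \<or> a > c \<and> b > c \<and> a > d \<and> b > d"
    using assms by linarith
  then show ?thesis by auto
qed

text \<open>Only permutations preserving the blocks give nonzero terms, and each of these is 1: two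
  blocks are disjoint intervals, so the four signs between them agree.\<close>

lemma pfsum_std_form: "pfsum n std_form = card (block_perms n)"
proof -
  have "pfsum n std_form = (\<Sum>\<sigma>\<in>block_perms n. 1)"
    unfolding pfsum_def
  proof (rule sum.mono_neutral_cong_right)
    show "\<forall>\<sigma>\<in>{\<sigma>. \<sigma> permutes {..<2 * n}} - block_perms n.
       of_int (sign \<sigma>) * (\<Prod>k<n. std_form (\<sigma> (2 * k)) (\<sigma> (Suc (2 * k)))) = 0"
    proof clarify
      fix \<sigma> assume "\<sigma> permutes {..<2 * n}" "\<sigma> \<notin> block_perms n"
      then obtain k where "k < n" "\<sigma> (2 * k) div 2 \<noteq> \<sigma> (Suc (2 * k)) div 2"
        by (auto simp: block_perms_def)
      then have "(\<Prod>k<n. std_form (\<sigma> (2 * k)) (\<sigma> (Suc (2 * k)))) = 0"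
        by (intro prod_zero bexI[of _ k]) (auto simp: std_form_def)
      then show "of_int (sign \<sigma>) * (\<Prod>k<n. std_form (\<sigma> (2 * k)) (\<sigma> (Suc (2 * k)))) = 0" by simp
    qed
  next
    fix \<sigma> assume s: "\<sigma> \<in> block_perms n"
    then have p: "\<sigma> permutes {..<2 * n}" by (simp add: block_perms_def)
    have inj: "\<sigma> i = \<sigma> j \<longleftrightarrow> i = j" for i j using permutes_inj[OF p] by (auto dest: injD)
    have blk: "\<sigma> (2 * k) div 2 = \<sigma> (Suc (2 * k)) div 2" if "k < n" for k
      using s that by (simp add: block_perms_def)
    have J1: "std_form (\<sigma> (2 * k)) (\<sigma> (Suc (2 * k))) = sgn (real (\<sigma> (Suc (2 * k))) - real (\<sigma> (2 * k)))" if "k < n" for k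
    proof -
      have "\<sigma> (2 * k) \<noteq> \<sigma> (Suc (2 * k))" by (simp add: inj)
      then have "\<sigma> (Suc (2 * k)) = Suc (\<sigma> (2 * k)) \<or> \<sigma> (2 * k) = Suc (\<sigma> (Suc (2 * k)))"
        using blk[OF that] by linarith
      then show ?thesis using blk[OF that] by (auto simp: std_form_def)
    qed
    have neq: "\<sigma> (2 * k) div 2 \<noteq> \<sigma> (2 * l) div 2" if "k < l" "l < n" for k l
    proof
      assume e: "\<sigma> (2 * k) div 2 = \<sigma> (2 * l) div 2"
      have "\<sigma> (2 * k) \<noteq> \<sigma> (Suc (2 * k))" "\<sigma> (2 * k) \<noteq> \<sigma> (2 * l)" "\<sigma> (2 * l) \<noteq> \<sigma> (Suc (2 * k))"
        using that by (auto simp: inj)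
      then show False using e blk[of k] that by linarith
    qed
    have "of_int (sign \<sigma>) * (\<Prod>k<n. std_form (\<sigma> (2 * k)) (\<sigma> (Suc (2 * k)))) =
       of_int (sign \<sigma>) * (\<Prod>k<n. sgn (real (\<sigma> (Suc (2 * k))) - real (\<sigma> (2 * k))))"
      by (simp add: J1)
    also have "\<dots> = 1"
      unfolding sign_times_orientations[OF p]
      by (intro prod.neutral ballI sgn_blocks) (use blk neq in auto)
    finally show "of_int (sign \<sigma>) * (\<Prod>k<n. std_form (\<sigma> (2 * k)) (\<sigma> (Suc (2 * k)))) = 1" .
  qed (auto simp: block_perms_def finite_permutations)
  then show ?thesis by simp
qed

text \<open>The index \<open>2 * k\<close> occurs in every term, and both row and column
  \<open>2 * k\<close> of the truncated form are zero.\<close>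

lemma pfsum_partial_form:
  assumes "k < n"
  shows "pfsum n (partial_form k) = 0"
  unfolding pfsum_def
proof (intro sum.neutral ballI)
  fix \<sigma> assume "\<sigma> \<in> {\<sigma>. \<sigma> permutes {..<2 * n}}"
  then have p: "\<sigma> permutes {..<2 * n}" by simp
  obtain m where m: "\<sigma> m = 2 * k" using permutes_surj[OF p] by (metis surjD)
  have mn: "m < 2 * n" using m assms p by (metis lessThan_iff mult_less_cancel1 permutes_in_image zero_less_numeral)
  have "partial_form k (\<sigma> (2 * (m div 2))) (\<sigma> (Suc (2 * (m div 2)))) = 0"
  proof (cases "even m")
    case True
    then show ?thesis using m by (simp add: partial_form_def)
  next
    case False
    then show ?thesis using m by (auto simp: partial_form_def std_form_def)
  qed
  moreover have "m div 2 < n" using mn by auto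
  ultimately have "(\<Prod>k'<n. partial_form k (\<sigma> (2 * k')) (\<sigma> (Suc (2 * k')))) = 0"
    by (intro prod_zero) auto
  then show "of_int (sign \<sigma>) * (\<Prod>k'<n. partial_form k (\<sigma> (2 * k')) (\<sigma> (Suc (2 * k')))) = 0"
    by simp
qed

lemma std_form_skew: "std_form j i = - std_form i j" by (simp add: std_form_def)

text \<open>Each column has a single entry 1 or -1, in the row \<open>s\<close> of the other index
  of its block. The form is thus inverted by its transpose, which explains the coefficients in
  \<open>project\<close>.\<close>

lemma std_form_orthogonal:
  assumes "j < 2 * k" "m < 2 * k"
  shows "(\<Sum>i<2*k. std_form i j * std_form i m) = (if j = m then 1 else 0)"
proof -
  have two: "i = 2 * c \<or> i = Suc (2 * c)" if "i div 2 = c" for i c :: nat using that by linarith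
  obtain b where b: "j = 2 * b \<or> j = Suc (2 * b)" by (metis two)
  define s where "s = (if j = 2 * b then Suc (2 * b) else 2 * b)"
  have s: "s < 2 * k" using assms(1) b unfolding s_def by auto
  have sj: "s div 2 = b" "j div 2 = b" using b by (auto simp: s_def)
  have nz: "std_form i j = 0" if "i \<noteq> s" for i
  proof (cases "i div 2 = b")
    case True
    then have "i = j" using two[OF True] b that by (auto simp: s_def split: if_splits)
    then show ?thesis by (simp add: std_form_def)
  next
    case False
    then show ?thesis using sj by (simp add: std_form_def)
  qed
  have "(\<Sum>i<2*k. std_form i j * std_form i m) = std_form s j * std_form s m"
    using s by (subst sum.remove[of _ s]) (auto simp: nz)
  also have "\<dots> = (if j = m then 1 else 0)"
  proof (cases "m div 2 = b")
    case True
    from two[OF True] b show ?thesis by (elim disjE) (simp_all add: std_form_def s_def)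
  next
    case False
    then show ?thesis using sj by (auto simp: std_form_def)
  qed
  finally show ?thesis .
qed

lemma sum_rotate:
  fixes f :: "'a \<Rightarrow> 'b \<Rightarrow> 'c \<Rightarrow> 'd::comm_monoid_add"
  shows "(\<Sum>i\<in>A. \<Sum>j\<in>B. \<Sum>k\<in>C. f i j k) = (\<Sum>k\<in>C. \<Sum>i\<in>A. \<Sum>j\<in>B. f i j k)"
proof -
  have "(\<Sum>i\<in>A. \<Sum>j\<in>B. \<Sum>k\<in>C. f i j k) = (\<Sum>i\<in>A. \<Sum>k\<in>C. \<Sum>j\<in>B. f i j k)"
    by (intro sum.cong refl sum.swap)
  also have "\<dots> = (\<Sum>k\<in>C. \<Sum>i\<in>A. \<Sum>j\<in>B. f i j k)" by (rule sum.swap)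
  finally show ?thesis .
qed

section \<open>Bounding a determinant by the sum of the squared entries\<close>

lemma root_power_nonneg:
  assumes "0 \<le> P" "0 < n"
  shows "(P powr (1 / real n)) ^ n = P"
proof (cases "P = 0")
  case False
  then have "(P powr (1 / real n)) ^ n = (P powr (1 / real n)) powr real n"
    by (subst powr_realpow) auto
  with assms show ?thesis by (simp add: powr_powr)
qed (use assms in simp)

text \<open>For an eigenvector \<open>v\<close> one has \<open>e * |v|^2 = |A v|^2\<close>, so
  \<open>e\<close> is a Rayleigh quotient. The matrix is made complex so that its characteristic
  polynomial splits.\<close>

lemma gram_eigenvalue_nonneg:
  fixes A :: "real mat"
  assumes A: "A \<in> carrier_mat n n"
    and ev: "eigenvalue (map_mat complex_of_real (transpose_mat A * A)) e"
  shows "\<exists>r\<ge>0. e = complex_of_real r"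
proof -
  let ?G = "map_mat complex_of_real (transpose_mat A * A)"
  obtain v where v: "v \<in> carrier_vec n" "v \<noteq> 0\<^sub>v n" "?G *\<^sub>v v = e \<cdot>\<^sub>v v"
    using ev A unfolding eigenvalue_def eigenvector_def by auto
  define x where "x = (\<lambda>i. vec_index v i)"
  have G: "?G $$ (i, j) = (\<Sum>k<n. complex_of_real (A $$ (k, i) * A $$ (k, j)))" if "i < n" "j < n" for i j
    using that A by (auto simp: scalar_prod_def atLeast0LessThan)
  have eig: "(\<Sum>j<n. ?G $$ (i, j) * x j) = e * x i" if "i < n" for i
  proof -
    have "vec_index (?G *\<^sub>v v) i = (\<Sum>j<n. ?G $$ (i, j) * x j)"
      using that A v(1) by (auto simp: scalar_prod_def x_def atLeast0LessThan intro!: sum.cong)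
    then show ?thesis using v that by (simp add: x_def)
  qed
  have "(\<Sum>i<n. cnj (x i) * (e * x i)) = (\<Sum>i<n. cnj (x i) * (\<Sum>j<n. ?G $$ (i, j) * x j))"
    by (intro sum.cong) (auto simp: eig)
  also have "\<dots> = (\<Sum>i<n. \<Sum>j<n. \<Sum>k<n. cnj (A $$ (k, i) * x i) * (A $$ (k, j) * x j))"
    by (intro sum.cong refl) (simp add: G sum_distrib_left sum_distrib_right mult_ac)
  also have "\<dots> = (\<Sum>k<n. \<Sum>i<n. \<Sum>j<n. cnj (A $$ (k, i) * x i) * (A $$ (k, j) * x j))"
    by (rule sum_rotate)
  also have "\<dots> = (\<Sum>k<n. cnj (\<Sum>i<n. A $$ (k, i) * x i) * (\<Sum>j<n. A $$ (k, j) * x j))"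
    by (simp add: sum_product)
  also have "\<dots> = complex_of_real (\<Sum>k<n. (norm (\<Sum>j<n. A $$ (k, j) * x j))\<^sup>2)"
    by (simp only: of_real_sum complex_norm_square mult.commute)
  finally have 1: "(\<Sum>i<n. cnj (x i) * (e * x i)) = complex_of_real (\<Sum>k<n. (norm (\<Sum>j<n. A $$ (k, j) * x j))\<^sup>2)" .
  have 2: "(\<Sum>i<n. cnj (x i) * (e * x i)) = e * complex_of_real (\<Sum>i<n. (norm (x i))\<^sup>2)"
    by (simp only: of_real_sum complex_norm_square sum_distrib_left mult_ac)
  obtain i where "i < n" "x i \<noteq> 0"
    using v(1,2) unfolding x_def by (metis carrier_vecD eq_vecI index_zero_vec(1) index_zero_vec(2))
  then have pos: "0 < (\<Sum>i<n. (norm (x i))\<^sup>2)"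
    by (intro sum_pos2[of _ i]) auto
  have "e * complex_of_real s = complex_of_real t \<Longrightarrow> 0 < s \<Longrightarrow> e = complex_of_real (t / s)" for s t
    by (simp add: field_simps)
  from this[OF trans[OF 2[symmetric] 1] pos]
  have "e = complex_of_real ((\<Sum>k<n. (norm (\<Sum>j<n. A $$ (k, j) * x j))\<^sup>2) / (\<Sum>i<n. (norm (x i))\<^sup>2))" .
  moreover have "0 \<le> (\<Sum>k<n. (norm (\<Sum>j<n. A $$ (k, j) * x j))\<^sup>2) / (\<Sum>i<n. (norm (x i))\<^sup>2)"
    by (intro divide_nonneg_nonneg sum_nonneg) auto
  ultimately show ?thesis by blast
qed

lemma trace_similar:
  fixes A B :: "'a::comm_ring_1 mat"
  assumes "similar_mat_wit A B P Q" "A \<in> carrier_mat n n"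
  shows "(\<Sum>i<n. A $$ (i, i)) = (\<Sum>i<n. B $$ (i, i))"
proof -
  note w = similar_mat_witD2[OF assms(2,1)]
  have "(\<Sum>i<n. A $$ (i, i)) = (\<Sum>i<n. (\<Sum>j<n. P $$ (i, j) * (\<Sum>k<n. B $$ (j, k) * Q $$ (k, i))))"
    using w by (intro sum.cong refl)
      (auto simp: w(3) scalar_prod_def atLeast0LessThan intro!: sum.cong)
  also have "\<dots> = (\<Sum>i<n. \<Sum>k<n. \<Sum>j<n. B $$ (j, k) * (Q $$ (k, i) * P $$ (i, j)))"
    unfolding sum_distrib_left by (rule sum.cong[OF refl], rule trans[OF sum.swap]) (simp add: mult_ac)
  also have "\<dots> = (\<Sum>k<n. \<Sum>j<n. \<Sum>i<n. B $$ (j, k) * (Q $$ (k, i) * P $$ (i, j)))"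
    by (rule sum_rotate[symmetric])
  also have "\<dots> = (\<Sum>k<n. \<Sum>j<n. B $$ (j, k) * (Q * P) $$ (k, j))"
  proof (intro sum.cong refl)
    fix k j assume "k \<in> {..<n}" "j \<in> {..<n}"
    then have "(Q * P) $$ (k, j) = (\<Sum>i<n. Q $$ (k, i) * P $$ (i, j))"
      using w by (subst index_mult_mat(1)) (auto simp: scalar_prod_def atLeast0LessThan)
    then show "(\<Sum>i<n. B $$ (j, k) * (Q $$ (k, i) * P $$ (i, j))) = B $$ (j, k) * (Q * P) $$ (k, j)"
      by (simp add: sum_distrib_left)
  qed
  also have "\<dots> = (\<Sum>k<n. \<Sum>j<n. if j = k then B $$ (j, k) else 0)"
    using w by (intro sum.cong refl) auto
  finally show ?thesis by simp
qed

text \<open>A weak form of Hadamard's inequality. The Schur form of the Gram matrix carries the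
  eigenvalues with multiplicity on its diagonal; their product is the squared determinant, their sum
  the sum of the squared entries.\<close>

lemma det_square_le:
  fixes A :: "real mat"
  assumes A: "A \<in> carrier_mat n n" and n: "0 < n"
  shows "(Determinant.det A)\<^sup>2 \<le> ((\<Sum>i<n. \<Sum>j<n. (A $$ (i, j))\<^sup>2) / n) ^ n"
proof -
  define G where "G = map_mat complex_of_real (transpose_mat A * A)"
  have G: "G \<in> carrier_mat n n" using A by (auto simp: G_def)
  obtain es where es: "char_poly G = (\<Prod>a\<leftarrow>es. [:- a, 1:])" "length es = n"
    using char_poly_factorized[OF G] by blast
  obtain B P Q where BPQ: "schur_decomposition G es = (B, P, Q)" by (metis prod_cases3)
  have S: "similar_mat_wit G B P Q" "upper_triangular B" "diag_mat B = es"
    using schur_decomposition[OF G es(1) BPQ] by auto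
  have B: "B \<in> carrier_mat n n" using similar_mat_witD2[OF G S(1)] by auto
  have "\<exists>r\<ge>0. e = complex_of_real r" if "e \<in> set es" for e
  proof (rule gram_eigenvalue_nonneg[OF A])
    have "poly (char_poly G) e = 0"
      unfolding es(1) poly_prod_list using that by (auto simp: prod_list_zero_iff)
    then show "eigenvalue (map_mat complex_of_real (transpose_mat A * A)) e"
      using eigenvalue_root_char_poly[OF G] by (simp add: G_def)
  qed
  then obtain r where r: "\<And>e. e \<in> set es \<Longrightarrow> 0 \<le> r e \<and> e = complex_of_real (r e)" by metis
  define x where "x = (\<lambda>i. r (es ! i))"
  have x: "0 \<le> x i" "es ! i = complex_of_real (x i)" if "i < n" for i
    using r[of "es ! i"] that es(2) by (auto simp: x_def)
  have "complex_of_real ((Determinant.det A)\<^sup>2) = complex_of_real (Determinant.det (transpose_mat A * A))"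
    using A by (simp add: det_mult[of _ n] Determinant.det_transpose[OF A] power2_eq_square)
  also have "\<dots> = Determinant.det G"
    unfolding G_def by (rule of_real_hom.hom_det[symmetric])
  also have "\<dots> = Determinant.det B"
    using S(1) by (intro det_similar) (auto simp: similar_mat_def)
  also have "\<dots> = prod_list es"
    using det_upper_triangular[OF S(2) B] S(3) by simp
  also have "\<dots> = (\<Prod>i<n. es ! i)"
    using es(2) by (simp add: prod.list_conv_set_nth atLeast0LessThan)
  also have "\<dots> = complex_of_real (\<Prod>i<n. x i)"
    by (simp add: x)
  finally have det: "(Determinant.det A)\<^sup>2 = (\<Prod>i<n. x i)" by (simp only: of_real_eq_iff)
  have "complex_of_real (\<Sum>i<n. x i) = (\<Sum>i<n. es ! i)" by (simp add: x)
  also have "\<dots> = (\<Sum>i<n. B $$ (i, i))"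
    using S(3) B by (intro sum.cong refl) (auto simp: diag_mat_def)
  also have "\<dots> = (\<Sum>i<n. G $$ (i, i))" by (rule trace_similar[OF S(1) G, symmetric])
  also have "\<dots> = (\<Sum>i<n. \<Sum>j<n. complex_of_real ((A $$ (j, i))\<^sup>2))"
    using A by (intro sum.cong refl)
      (auto simp: G_def scalar_prod_def atLeast0LessThan power2_eq_square intro!: sum.cong)
  also have "\<dots> = complex_of_real (\<Sum>i<n. \<Sum>j<n. (A $$ (j, i))\<^sup>2)" by simp
  finally have tr: "(\<Sum>i<n. x i) = (\<Sum>i<n. \<Sum>j<n. (A $$ (i, j))\<^sup>2)"
    by (subst sum.swap) (simp only: of_real_eq_iff)
  have "(\<Prod>i<n. x i) powr (1 / real (card {..<n})) \<le> (\<Sum>i<n. x i / real (card {..<n}))"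
    using x n by (intro arith_geom_mean) auto
  then have "((\<Prod>i<n. x i) powr (1 / n)) ^ n \<le> ((\<Sum>i<n. x i) / n) ^ n"
    by (intro power_mono) (auto simp: sum_divide_distrib)
  moreover have "((\<Prod>i<n. x i) powr (1 / n)) ^ n = (\<Prod>i<n. x i)"
    using x n by (intro root_power_nonneg prod_nonneg) auto
  ultimately show ?thesis unfolding det tr by simp
qed

section \<open>Symplectic bases of a skew form\<close>

locale skew_form =
  fixes n :: nat and A :: "nat \<Rightarrow> nat \<Rightarrow> real"
  assumes skew: "A j i = - A i j"
begin

definition omega :: "(nat \<Rightarrow> real) \<Rightarrow> (nat \<Rightarrow> real) \<Rightarrow> real" where
  "omega u v = (\<Sum>a<2*n. \<Sum>b<2*n. u a * A a b * v b)"

lemma omega_skew: "omega v u = - omega u v"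
proof -
  have "omega v u = (\<Sum>b<2*n. \<Sum>a<2*n. v a * A a b * u b)"
    unfolding omega_def by (rule sum.swap)
  also have "\<dots> = (\<Sum>b<2*n. \<Sum>a<2*n. - (u b * A b a * v a))"
  proof (intro sum.cong refl)
    fix a b show "v a * A a b * u b = - (u b * A b a * v a)" using skew[of a b] by simp
  qed
  finally show ?thesis by (simp add: omega_def sum_negf)
qed

lemma omega_diff_left: "omega (\<lambda>a. u a - w a) v = omega u v - omega w v"
  by (simp add: omega_def algebra_simps sum_subtractf)

lemma omega_sum_left: "omega (\<lambda>a. \<Sum>i\<in>I. c i * f i a) v = (\<Sum>i\<in>I. c i * omega (f i) v)"
proof -
  have "omega (\<lambda>a. \<Sum>i\<in>I. c i * f i a) v = (\<Sum>a<2*n. \<Sum>b<2*n. \<Sum>i\<in>I. c i * (f i a * A a b * v b))"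
    by (simp add: omega_def sum_distrib_right sum_distrib_left mult_ac)
  also have "\<dots> = (\<Sum>i\<in>I. \<Sum>a<2*n. \<Sum>b<2*n. c i * (f i a * A a b * v b))"
    by (rule sum_rotate)
  finally show ?thesis by (simp add: omega_def sum_distrib_left)
qed

lemma omega_scale_left: "omega (\<lambda>a. c * u a) v = c * omega u v"
  by (simp add: omega_def sum_distrib_left mult_ac)

lemma omega_unit:
  assumes "a < 2 * n" "b < 2 * n"
  shows "omega (\<lambda>x. if x = a then 1 else 0) (\<lambda>x. if x = b then 1 else 0) = A a b"
proof -
  have "omega (\<lambda>x. if x = a then 1 else 0) (\<lambda>x. if x = b then 1 else 0) =
    (\<Sum>x<2*n. \<Sum>y<2*n. if y = b then (if x = a then A x y else 0) else 0)"
    unfolding omega_def by (intro sum.cong refl) auto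
  then show ?thesis using assms by simp
qed

definition symplectic_system :: "nat \<Rightarrow> (nat \<Rightarrow> nat \<Rightarrow> real) \<Rightarrow> bool" where
  "symplectic_system k w \<longleftrightarrow> (\<forall>i<2*k. \<forall>j<2*k. omega (w i) (w j) = std_form i j)"

text \<open>The component of \<open>v\<close> orthogonal to the span of the system. The coefficients
  come from inverting the Gram matrix \<open>std_form\<close> by its transpose.\<close>

definition project :: "nat \<Rightarrow> (nat \<Rightarrow> nat \<Rightarrow> real) \<Rightarrow> (nat \<Rightarrow> real) \<Rightarrow> nat \<Rightarrow> real" where
  "project k w v = (\<lambda>a. v a - (\<Sum>i<2*k. (\<Sum>j<2*k. omega v (w j) * std_form i j) * w i a))"

lemma omega_project_left:
  "omega (project k w v) u = omega v u - (\<Sum>i<2*k. (\<Sum>j<2*k. omega v (w j) * std_form i j) * omega (w i) u)"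
  unfolding project_def omega_diff_left omega_sum_left ..

lemma omega_project_basis:
  assumes w: "symplectic_system k w" and m: "m < 2 * k"
  shows "omega (project k w v) (w m) = 0"
proof -
  have "(\<Sum>i<2*k. (\<Sum>j<2*k. omega v (w j) * std_form i j) * omega (w i) (w m)) =
    (\<Sum>i<2*k. \<Sum>j<2*k. omega v (w j) * (std_form i j * std_form i m))"
    using w m by (intro sum.cong refl) (simp add: symplectic_system_def sum_distrib_left sum_distrib_right mult_ac)
  also have "\<dots> = (\<Sum>j<2*k. omega v (w j) * (\<Sum>i<2*k. std_form i j * std_form i m))"
    by (subst sum.swap) (simp add: sum_distrib_left)
  also have "\<dots> = (\<Sum>j<2*k. omega v (w j) * (if j = m then 1 else 0))"
    using m by (intro sum.cong refl) (auto simp: std_form_orthogonal)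
  also have "\<dots> = omega v (w m)" using m by (simp add: if_distrib cong: if_cong)
  finally show ?thesis by (simp add: omega_project_left)
qed

text \<open>The part removed from \<open>v\<close> lies in the span of \<open>w\<close>, to which
  the projection of \<open>u\<close> is orthogonal.\<close>

lemma omega_project_project:
  assumes w: "symplectic_system k w"
  shows "omega (project k w u) (project k w v) = omega (project k w u) v"
proof -
  have "omega (project k w v) (project k w u) = omega v (project k w u)"
  proof (subst omega_project_left)
    have "omega (w i) (project k w u) = 0" if "i < 2 * k" for i
      using omega_skew[of "w i" "project k w u"] omega_project_basis[OF w that] by simp
    then show "omega v (project k w u) - (\<Sum>i<2*k. (\<Sum>j<2*k. omega v (w j) * std_form i j) * omega (w i) (project k w u))
      = omega v (project k w u)" by simp
  qed
  then show ?thesis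
    using omega_skew[of "project k w u" "project k w v"] omega_skew[of "project k w u" v] by simp
qed

text \<open>
  If all projected vectors were orthogonal to each other, the form would have rank at most \<open>2 * k\<close>
  and its Pfaffian sum would vanish.
\<close>

lemma symplectic_extend:
  assumes w: "symplectic_system k w" and k: "k < n" and nz: "pfsum n A \<noteq> 0"
  shows "\<exists>w'. symplectic_system (Suc k) w'"
proof -
  have "\<exists>u v. omega (project k w u) (project k w v) \<noteq> 0"
  proof (rule ccontr)
    assume "\<not> ?thesis"
    then have 0: "omega (project k w u) v = 0" for u v
      using omega_project_project[OF w] by metis
    have om: "omega u v = (\<Sum>i<2*k. \<Sum>j<2*k. omega u (w j) * std_form j i * omega v (w i))" for u v
    proof -
      have "omega u v = (\<Sum>i<2*k. (\<Sum>j<2*k. omega u (w j) * std_form i j) * omega (w i) v)"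
        using 0[of u v] by (simp add: omega_project_left)
      also have "\<dots> = (\<Sum>i<2*k. \<Sum>j<2*k. omega u (w j) * std_form j i * omega v (w i))"
      proof (intro sum.cong refl)
        fix i show "(\<Sum>j<2*k. omega u (w j) * std_form i j) * omega (w i) v = (\<Sum>j<2*k. omega u (w j) * std_form j i * omega v (w i))"
          unfolding sum_distrib_right
        proof (intro sum.cong refl)
          fix j show "omega u (w j) * std_form i j * omega (w i) v = omega u (w j) * std_form j i * omega v (w i)"
            using omega_skew[of v "w i"] std_form_skew[of i j] by simp
        qed
      qed
      finally show ?thesis .
    qed
    \<comment> \<open>The values of the form on unit vectors and \<open>w\<close>: by
      \<open>om\<close>, \<open>A\<close> is the product of \<open>B\<close>,
      \<open>partial_form k\<close> and the transpose of \<open>B\<close>.\<close>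
    define B where "B = (\<lambda>a j. if j < 2 * k then omega (\<lambda>x. if x = a then 1 else 0) (w j) else 0)"
    have "A a b = (\<Sum>p<2*n. \<Sum>q<2*n. B a p * partial_form k p q * B b q)" if ab: "a < 2 * n" "b < 2 * n" for a b
    proof -
      have "A a b = (\<Sum>q<2*k. \<Sum>p<2*k. B a p * partial_form k p q * B b q)"
        unfolding omega_unit[OF ab, symmetric] om[of "\<lambda>x. if x = a then 1 else 0" "\<lambda>x. if x = b then 1 else 0"]
        by (intro sum.cong refl) (auto simp: B_def partial_form_def)
      also have "\<dots> = (\<Sum>q<2*k. \<Sum>p<2*n. B a p * partial_form k p q * B b q)"
        using k by (intro sum.cong sum.mono_neutral_left refl) (auto simp: B_def)
      also have "\<dots> = (\<Sum>q<2*n. \<Sum>p<2*n. B a p * partial_form k p q * B b q)"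
        using k by (intro sum.mono_neutral_left) (auto simp: B_def)
      also have "\<dots> = (\<Sum>p<2*n. \<Sum>q<2*n. B a p * partial_form k p q * B b q)" by (rule sum.swap)
      finally show ?thesis .
    qed
    then have "pfsum n A = pfsum n (\<lambda>a b. \<Sum>p<2*n. \<Sum>q<2*n. B a p * partial_form k p q * B b q)"
      by (rule pfsum_cong)
    also have "\<dots> = 0" by (simp add: pfsum_congruence pfsum_partial_form[OF k])
    finally show False using nz by simp
  qed
  then obtain u v where uv: "omega (project k w u) (project k w v) \<noteq> 0" by blast
  define c where "c = omega (project k w u) (project k w v)"
  \<comment> \<open>Scaling turns the two projections into a hyperbolic pair,
    \<open>omega x y = 1\<close>.\<close>
  define x where "x = (\<lambda>a. inverse c * project k w u a)"
  define y where "y = project k w v"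
  define w' where "w' = (\<lambda>i. if i < 2 * k then w i else if i = 2 * k then x else y)"
  have self: "omega z z = 0" for z using omega_skew[of z z] by simp
  have xw: "omega x (w m) = 0" "omega y (w m) = 0" "omega (w m) x = 0" "omega (w m) y = 0" if "m < 2 * k" for m
    using omega_project_basis[OF w that] omega_skew[of "w m" x] omega_skew[of "w m" y]
    by (simp_all add: x_def y_def omega_scale_left)
  have xy: "omega x y = 1" "omega y x = -1"
    using uv omega_skew[of y x] unfolding x_def y_def omega_scale_left c_def by simp_all
  have "omega (w' i) (w' j) = std_form i j" if ij: "i < 2 * Suc k" "j < 2 * Suc k" for i j
  proof -
    have two: "i < 2 * k \<or> i = 2 * k \<or> i = Suc (2 * k)" "j < 2 * k \<or> j = 2 * k \<or> j = Suc (2 * k)"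
      using ij by auto
    have J0: "std_form p q = 0" "std_form q p = 0" if "p < 2 * k" "\<not> q < 2 * k" for p q
    proof -
      have "p div 2 < k" "k \<le> q div 2" using that by auto
      then show "std_form p q = 0" "std_form q p = 0" by (auto simp: std_form_def)
    qed
    show ?thesis
      using two w by (elim disjE) (simp_all add: w'_def symplectic_system_def J0 xw xy self, simp_all add: std_form_def)
  qed
  then show ?thesis unfolding symplectic_system_def by blast
qed

text \<open>Symplectic Gram-Schmidt: one hyperbolic pair is added at a time, and a nonzero Pfaffian
  sum guarantees that this does not stop before \<open>n\<close> pairs.\<close>

lemma symplectic_basis:
  assumes "pfsum n A \<noteq> 0" "k \<le> n"
  shows "\<exists>w. symplectic_system k w"
  using assms(2)
proof (induction k)
  case 0
  then show ?case by (auto simp: symplectic_system_def)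
next
  case (Suc k)
  then show ?case using symplectic_extend[OF _ _ assms(1)] by (metis Suc_leD Suc_le_lessD)
qed

end

lemma fdet_mult:
  "fdet N (\<lambda>i j. \<Sum>a<N. X i a * Y a j) = fdet N X * fdet N Y"
proof -
  have "Matrix.mat N N (\<lambda>(i, j). \<Sum>a<N. X i a * Y a j) = Matrix.mat N N (\<lambda>(i, j). X i j) * Matrix.mat N N (\<lambda>(i, j). Y i j)"
    by (rule eq_matI) (auto simp: scalar_prod_def atLeast0LessThan)
  then show ?thesis unfolding fdet_def by (simp add: det_mult[of _ N])
qed

lemma fdet_transpose: "fdet N (\<lambda>i j. X j i) = fdet N X"
proof -
  have "Matrix.mat N N (\<lambda>(i, j). X j i) = transpose_mat (Matrix.mat N N (\<lambda>(i, j). X i j))"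
    by (rule eq_matI) auto
  then show ?thesis unfolding fdet_def by (simp add: Determinant.det_transpose[of _ N])
qed

lemma fdet_cong:
  assumes "\<And>i j. i < N \<Longrightarrow> j < N \<Longrightarrow> X i j = Y i j"
  shows "fdet N X = fdet N Y"
  unfolding fdet_def using assms by (intro arg_cong[of _ _ Determinant.det] eq_matI) auto

lemma fdet_std_form_square: "(fdet (2 * n) std_form)\<^sup>2 = 1"
proof -
  have "(fdet (2 * n) std_form)\<^sup>2 = fdet (2 * n) (\<lambda>i j. std_form j i) * fdet (2 * n) std_form"
    by (simp add: fdet_transpose[of _ std_form] power2_eq_square)
  also have "\<dots> = fdet (2 * n) (\<lambda>i j. \<Sum>a<2*n. std_form a i * std_form a j)"
    by (rule fdet_mult[symmetric])
  also have "\<dots> = fdet (2 * n) (\<lambda>i j. if i = j then 1 else 0)"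
    by (rule fdet_cong) (simp add: std_form_orthogonal)
  also have "\<dots> = 1"
  proof -
    have "Matrix.mat (2*n) (2*n) (\<lambda>(i, j). if i = j then 1 else 0) = (1\<^sub>m (2 * n) :: real mat)"
      by (rule eq_matI) auto
    then show ?thesis unfolding fdet_def by simp
  qed
  finally show ?thesis .
qed

text \<open>Let \<open>?d\<close> be the determinant of a symplectic basis \<open>w\<close>. The
  congruence rule gives \<open>?c = ?d * pfsum n A\<close>, and taking determinants gives
  \<open>det std_form = ?d ^ 2 * det A\<close>. Eliminating \<open>?d\<close> relates the squared
  Pfaffian to the determinant.\<close>

theorem pfsum_square_le:
  assumes skew: "\<And>i j. A j i = - A i j" and n: "0 < n"
  shows "(pfsum n A)\<^sup>2 \<le> (real (card (block_perms n)))\<^sup>2 * ((\<Sum>i<2*n. \<Sum>j<2*n. (A i j)\<^sup>2) / real (2 * n)) ^ n"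
proof (cases "pfsum n A = 0")
  case True
  have "0 \<le> (\<Sum>i<2*n. \<Sum>j<2*n. (A i j)\<^sup>2) / real (2 * n)"
    by (intro divide_nonneg_nonneg sum_nonneg zero_le_power2) simp
  with True show ?thesis by (simp only: power2_eq_square mult_zero_left mult_nonneg_nonneg zero_le_power of_nat_0_le_iff)
next
  case False
  interpret skew_form n A by unfold_locales (rule skew)
  obtain w where w: "symplectic_system n w" using symplectic_basis[OF False] by blast
  let ?c = "real (card (block_perms n))" and ?d = "fdet (2 * n) w" and ?q = "(\<Sum>i<2*n. \<Sum>j<2*n. (A i j)\<^sup>2) / real (2 * n)"
  have q: "0 \<le> ?q" by (intro divide_nonneg_nonneg sum_nonneg zero_le_power2) simp
  have Jw: "std_form i j = (\<Sum>a<2*n. \<Sum>b<2*n. w i a * A a b * w j b)" if "i < 2 * n" "j < 2 * n" for i j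
    using w that by (simp add: symplectic_system_def omega_def)
  have "?c = pfsum n (\<lambda>i j. \<Sum>a<2*n. \<Sum>b<2*n. w i a * A a b * w j b)"
    unfolding pfsum_std_form[symmetric] by (rule pfsum_cong) (rule Jw)
  then have c: "?c = ?d * pfsum n A" by (simp add: pfsum_congruence)
  have "fdet (2 * n) std_form = fdet (2 * n) (\<lambda>i j. \<Sum>b<2*n. (\<Sum>a<2*n. w i a * A a b) * w j b)"
    by (rule fdet_cong, subst Jw) (auto simp: sum_distrib_right intro: sum.swap)
  also have "\<dots> = ?d * fdet (2 * n) A * ?d"
    by (simp add: fdet_mult[of "2 * n" "\<lambda>i b. \<Sum>a<2*n. w i a * A a b" "\<lambda>b j. w j b"] fdet_mult fdet_transpose[of _ w])
  finally have "1 = (?d * fdet (2 * n) A * ?d)\<^sup>2" using fdet_std_form_square by metis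
  then have 1: "1 = (?d\<^sup>2)\<^sup>2 * (fdet (2 * n) A)\<^sup>2" by (simp add: power2_eq_square mult_ac)
  have "(fdet (2 * n) A)\<^sup>2 \<le> ((\<Sum>i<2*n. \<Sum>j<2*n. (A i j)\<^sup>2) / real (2 * n)) ^ (2 * n)"
    using det_square_le[of "Matrix.mat (2*n) (2*n) (\<lambda>(i, j). A i j)" "2 * n"] n unfolding fdet_def by simp
  then have 2: "(fdet (2 * n) A)\<^sup>2 \<le> (?q ^ n)\<^sup>2" by (simp add: power_mult[symmetric] mult.commute)
  \<comment> \<open>Fourth powers are compared so that only the square of
    \<open>fdet (2 * n) std_form\<close> enters, which is 1; the root is taken at the end.\<close>
  have "((pfsum n A)\<^sup>2)\<^sup>2 = ((pfsum n A)\<^sup>2)\<^sup>2 * ((?d\<^sup>2)\<^sup>2 * (fdet (2 * n) A)\<^sup>2)"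
    using 1 by simp
  also have "\<dots> = (?c\<^sup>2)\<^sup>2 * (fdet (2 * n) A)\<^sup>2" unfolding c by (simp add: power_mult_distrib)
  also have "\<dots> \<le> (?c\<^sup>2)\<^sup>2 * (?q ^ n)\<^sup>2" using 2 by (intro mult_left_mono) auto
  finally have "((pfsum n A)\<^sup>2)\<^sup>2 \<le> (?c\<^sup>2 * ?q ^ n)\<^sup>2" by (simp add: power_mult_distrib)
  moreover have "0 \<le> ?c\<^sup>2 * ?q ^ n" by (intro mult_nonneg_nonneg zero_le_power q) auto
  ultimately show ?thesis by (rule power2_le_imp_le)
qed

section \<open>Crossing-free graphs\<close>

type_synonym pt = "real \<times> real"

definition line_at :: "pt \<Rightarrow> pt \<Rightarrow> real \<Rightarrow> real" where
  "line_at p q x = snd p + (snd q - snd p) / (fst q - fst p) * (x - fst p)"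

definition crossing_free :: "pt set \<Rightarrow> pt set set \<Rightarrow> bool" where
  "crossing_free S E \<longleftrightarrow> (\<forall>e\<in>E. e \<subseteq> S \<and> card e = 2) \<and>
     (\<forall>e\<in>E. \<forall>f\<in>E. e \<noteq> f \<longrightarrow> convex hull e \<inter> convex hull f = e \<inter> f)"

definition lft :: "pt set \<Rightarrow> pt" where
  "lft e = (SOME p. p \<in> e \<and> (\<forall>q\<in>e. fst p \<le> fst q))"

definition rgt :: "pt set \<Rightarrow> pt" where
  "rgt e = (SOME p. p \<in> e \<and> (\<forall>q\<in>e. fst q \<le> fst p))"

definition height :: "pt set \<Rightarrow> real \<Rightarrow> real" where
  "height e = line_at (lft e) (rgt e)"

definition slope :: "pt set \<Rightarrow> real" where
  "slope e = (snd (rgt e) - snd (lft e)) / (fst (rgt e) - fst (lft e))"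

definition xspan :: "pt set \<Rightarrow> real set" where
  "xspan e = {fst (lft e)..fst (rgt e)}"

lemma lft_rgt_pair:
  assumes "fst p < fst q"
  shows "lft {p, q} = p" "rgt {p, q} = q"
  unfolding lft_def rgt_def using assms by (auto intro!: some_equality)

lemma line_at_ends: "line_at p q (fst p) = snd p" "fst p \<noteq> fst q \<Longrightarrow> line_at p q (fst q) = snd q"
  by (simp_all add: line_at_def)

lemma convex_hull_pair:
  assumes "fst p < fst q"
  shows "convex hull {p, q} = {(x, line_at p q x) | x. fst p \<le> x \<and> x \<le> fst q}"
proof -
  have "convex hull {p, q} = closed_segment p q" by (simp add: segment_convex_hull)
  also have "\<dots> = {(x, line_at p q x) | x. fst p \<le> x \<and> x \<le> fst q}"
  proof (rule subset_antisym; rule subsetI)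
    fix z assume "z \<in> closed_segment p q"
    then obtain u where u: "0 \<le> u" "u \<le> 1" "z = (1 - u) *\<^sub>R p + u *\<^sub>R q" by (auto simp: in_segment)
    have fz: "fst z = fst p + u * (fst q - fst p)" and sz: "snd z = snd p + u * (snd q - snd p)"
      unfolding u(3) by (simp_all add: left_diff_distrib right_diff_distrib)
    have "u * (fst q - fst p) \<le> 1 * (fst q - fst p)"
      using u assms by (intro mult_right_mono) auto
    moreover have "0 \<le> u * (fst q - fst p)" using u assms by simp
    ultimately
    have "fst p \<le> fst z" "fst z \<le> fst q" using fz by auto
    moreover have "snd z = line_at p q (fst z)" using assms by (simp add: line_at_def fz sz)
    ultimately show "z \<in> {(x, line_at p q x) | x. fst p \<le> x \<and> x \<le> fst q}"
      by (cases z) auto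
  next
    fix z assume "z \<in> {(x, line_at p q x) | x. fst p \<le> x \<and> x \<le> fst q}"
    then obtain x where x: "z = (x, line_at p q x)" "fst p \<le> x" "x \<le> fst q" by auto
    define u where "u = (x - fst p) / (fst q - fst p)"
    have "u * (fst q - fst p) = x - fst p" using assms by (simp add: u_def)
    moreover have "snd z = snd p + u * (snd q - snd p)" using x(1) by (simp add: u_def line_at_def)
    ultimately have "z = (1 - u) *\<^sub>R p + u *\<^sub>R q"
      using x(1) by (simp add: prod_eq_iff algebra_simps)
    moreover have "0 \<le> u" "u \<le> 1" using x assms by (simp_all add: u_def)
    ultimately show "z \<in> closed_segment p q" by (auto simp: in_segment)
  qed
  finally show ?thesis .
qed

lemma height_eq: "height e x = snd (lft e) + slope e * (x - fst (lft e))"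
  by (simp add: height_def slope_def line_at_def)

lemma affine_root_between:
  fixes a b :: real
  assumes "x1 < x2" "a + b * x1 < 0" "0 < a + b * x2"
  shows "\<exists>x. x1 < x \<and> x < x2 \<and> a + b * x = 0"
proof -
  have b: "0 < b" using assms by (smt (verit) mult_left_mono_neg)
  then have "x1 < - a / b" "- a / b < x2" "a + b * (- a / b) = 0"
    using assms by (auto simp: field_simps)
  then show ?thesis by blast
qed

locale point_set =
  fixes S :: "pt set"
  assumes finite_S: "finite S" and inj_fst: "inj_on fst S"
begin

lemma fst_eq_iff: "p \<in> S \<Longrightarrow> q \<in> S \<Longrightarrow> fst p = fst q \<longleftrightarrow> p = q"
  using inj_fst by (auto dest: inj_onD)

lemma edge_ends:
  assumes "e \<subseteq> S" "card e = 2"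
  shows "e = {lft e, rgt e}" "fst (lft e) < fst (rgt e)" "lft e \<in> S" "rgt e \<in> S"
proof -
  obtain p q where pq: "e = {p, q}" "p \<noteq> q" using assms(2) by (auto simp: card_2_iff)
  then have "fst p \<noteq> fst q" using assms(1) fst_eq_iff by auto
  then obtain p' q' where e: "e = {p', q'}" "fst p' < fst q'"
    using pq by (metis insert_commute linorder_neqE_linordered_idom)
  show "e = {lft e, rgt e}" "fst (lft e) < fst (rgt e)" "lft e \<in> S" "rgt e \<in> S"
    using e assms(1) by (auto simp: lft_rgt_pair)
qed

lemma convex_hull_edge:
  assumes "e \<subseteq> S" "card e = 2"
  shows "convex hull e = {(x, height e x) | x. x \<in> xspan e}"
  using convex_hull_pair[OF edge_ends(2)[OF assms]] edge_ends(1)[OF assms]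
  by (simp add: height_def xspan_def)

lemma height_ends:
  assumes "e \<subseteq> S" "card e = 2"
  shows "height e (fst (lft e)) = snd (lft e)" "height e (fst (rgt e)) = snd (rgt e)"
  using edge_ends(2)[OF assms] by (simp_all add: height_def line_at_ends)

end

locale plane_graph = point_set +
  fixes E
  assumes cf: "crossing_free S E"
begin

lemma edge: "e \<in> E \<Longrightarrow> e \<subseteq> S" "e \<in> E \<Longrightarrow> card e = 2"
  using cf by (auto simp: crossing_free_def)

lemma finite_E: "finite E"
  by (rule finite_subset[of _ "Pow S"]) (use edge(1) finite_S in auto)

lemmas E_ends = edge_ends[OF edge]
lemmas E_height_ends = height_ends[OF edge]

lemma common_point:
  assumes "e \<in> E" "f \<in> E" "e \<noteq> f" "x \<in> xspan e" "x \<in> xspan f" "height e x = height f x"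
  shows "(x, height e x) \<in> e" "(x, height e x) \<in> f"
proof -
  have "(x, height e x) \<in> convex hull e \<inter> convex hull f"
    unfolding convex_hull_edge[OF edge[OF assms(1)]] convex_hull_edge[OF edge[OF assms(2)]]
    using assms(4-6) by blast
  then have "(x, height e x) \<in> e \<inter> f"
    using cf assms(1-3) unfolding crossing_free_def by blast
  then show "(x, height e x) \<in> e" "(x, height e x) \<in> f" by auto
qed

lemma end_of_mem:
  assumes "e \<in> E" "(x, y) \<in> e"
  shows "x = fst (lft e) \<and> y = snd (lft e) \<or> x = fst (rgt e) \<and> y = snd (rgt e)"
  using assms E_ends(1)[OF assms(1,1)] by (metis fst_conv insert_iff singletonD snd_conv)

text \<open>A strict change of order would make the two affine functions agree strictly between
  \<open>x1\<close> and \<open>x2\<close>, hence at an end of \<open>e\<close> inside its own span.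
  Equality at \<open>x2\<close> remains possible, since edges may share an end.\<close>

lemma no_sign_change:
  assumes ef: "e \<in> E" "f \<in> E" and x: "x1 < x2" "{x1..x2} \<subseteq> xspan e" "{x1..x2} \<subseteq> xspan f"
    and lt: "height e x1 < height f x1"
  shows "height e x2 \<le> height f x2"
proof (rule ccontr)
  assume gt: "\<not> ?thesis"
  have ne: "e \<noteq> f" using lt by auto
  let ?a = "(snd (lft e) - slope e * fst (lft e)) - (snd (lft f) - slope f * fst (lft f))"
  have d: "height e x - height f x = ?a + (slope e - slope f) * x" for x
    by (simp add: height_eq algebra_simps)
  obtain x where x': "x1 < x" "x < x2" "?a + (slope e - slope f) * x = 0"
    using affine_root_between[of x1 x2 ?a "slope e - slope f"] x(1) lt gt d[of x1] d[of x2] by auto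
  then have "height e x = height f x" using d[of x] by simp
  moreover have "x \<in> xspan e" "x \<in> xspan f" using x x' by auto
  ultimately have "(x, height e x) \<in> e" using common_point(1)[OF ef ne] by simp
  then have "x = fst (lft e) \<or> x = fst (rgt e)" using end_of_mem ef by blast
  moreover have "x1 \<in> xspan e" "x2 \<in> xspan e" using x by auto
  ultimately show False using x' by (auto simp: xspan_def)
qed

text \<open>Two such edges overlap up to the right end of the shorter one. This common point must be
  an end of both, so the edges coincide.\<close>

lemma same_germ:
  assumes ef: "e \<in> E" "f \<in> E" and l: "lft e = lft f" and s: "slope e = slope f"
  shows "e = f"
proof (rule ccontr)
  assume ne: "e \<noteq> f"
  let ?x = "min (fst (rgt e)) (fst (rgt f))"
  have h: "height e x = height f x" for x using l s by (simp add: height_eq)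
  have lt: "fst (lft e) < ?x" using E_ends(2)[OF ef(1,1)] E_ends(2)[OF ef(2,2)] l by simp
  then have m: "(?x, height e ?x) \<in> e" "(?x, height e ?x) \<in> f"
    using common_point[OF ef ne, of ?x] h l by (auto simp: xspan_def)
  then have "rgt e = rgt f"
    using end_of_mem[OF ef(1) m(1)] end_of_mem[OF ef(2) m(2)] lt l by (auto simp: prod_eq_iff)
  then show False using ne E_ends(1)[OF ef(1,1)] E_ends(1)[OF ef(2,2)] l by simp
qed

text \<open>
  The number of edges is bounded by charging.  At each point there is one steepest edge leaving to the right.
  Any other edge \<open>e\<close> leaving to the right spans a wedge with the next steeper one and is charged to the
  leftmost point of this wedge.  A point is charged at most once as a point of the upper side and at most once otherwise.
\<close>

definition fan_edges :: "pt set set" where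
  "fan_edges = {e \<in> E. \<exists>f\<in>E. lft f = lft e \<and> slope e < slope f}"

definition next_edge :: "pt set \<Rightarrow> pt set" where
  "next_edge e = (SOME f. f \<in> E \<and> lft f = lft e \<and> slope e < slope f \<and>
     (\<forall>g\<in>E. lft g = lft e \<and> slope e < slope g \<longrightarrow> slope f \<le> slope g))"

lemma next_edge:
  assumes "e \<in> fan_edges"
  shows "next_edge e \<in> E" "lft (next_edge e) = lft e" "slope e < slope (next_edge e)"
    "\<And>g. g \<in> E \<Longrightarrow> lft g = lft e \<Longrightarrow> slope e < slope g \<Longrightarrow> slope (next_edge e) \<le> slope g"
proof -
  let ?F = "{f \<in> E. lft f = lft e \<and> slope e < slope f}"
  have "finite ?F" "?F \<noteq> {}" using assms finite_E by (auto simp: fan_edges_def)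
  then obtain f where "f \<in> ?F" "\<forall>g\<in>?F. slope f \<le> slope g"
    using ex_min_if_finite[of "slope ` ?F"] by (metis (no_types, lifting) arg_min_least arg_min_if_finite(1))
  then have "\<exists>f. f \<in> E \<and> lft f = lft e \<and> slope e < slope f \<and>
     (\<forall>g\<in>E. lft g = lft e \<and> slope e < slope g \<longrightarrow> slope f \<le> slope g)" by auto
  from someI_ex[OF this, folded next_edge_def]
  show "next_edge e \<in> E" "lft (next_edge e) = lft e" "slope e < slope (next_edge e)"
    "\<And>g. g \<in> E \<Longrightarrow> lft g = lft e \<Longrightarrow> slope e < slope g \<Longrightarrow> slope (next_edge e) \<le> slope g" by auto
qed

definition wedge :: "pt set \<Rightarrow> pt set" where
  "wedge e = {q \<in> S. fst (lft e) < fst q \<and> fst q \<in> xspan e \<and> fst q \<in> xspan (next_edge e) \<and>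
     height e (fst q) \<le> snd q \<and> snd q \<le> height (next_edge e) (fst q)}"

definition apex :: "pt set \<Rightarrow> pt" where
  "apex e = (SOME q. q \<in> wedge e \<and> (\<forall>r\<in>wedge e. fst q \<le> fst r))"

lemma height_less_next:
  assumes "e \<in> fan_edges" "fst (lft e) < x"
  shows "height e x < height (next_edge e) x"
  using next_edge[OF assms(1)] assms(2) by (simp add: height_eq)

lemma apex:
  assumes e: "e \<in> fan_edges"
  shows "apex e \<in> wedge e" "\<And>r. r \<in> wedge e \<Longrightarrow> fst (apex e) \<le> fst r"
proof -
  have eE: "e \<in> E" using e by (simp add: fan_edges_def)
  note f = next_edge[OF e]
  \<comment> \<open>The right end of the shorter edge belongs to the wedge, so there is a point to
    charge.\<close>
  have "rgt e \<in> wedge e \<or> rgt (next_edge e) \<in> wedge e"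
  proof (cases "fst (rgt e) \<le> fst (rgt (next_edge e))")
    case True
    then show ?thesis
      using E_ends[OF eE eE] E_ends[OF f(1) f(1)] f(2) E_height_ends(2)[OF eE eE]
        height_less_next[OF e, of "fst (rgt e)"]
      by (auto simp: wedge_def xspan_def)
  next
    case False
    then show ?thesis
      using E_ends[OF eE eE] E_ends[OF f(1) f(1)] f(2) E_height_ends(2)[OF f(1) f(1)]
        height_less_next[OF e, of "fst (rgt (next_edge e))"]
      by (auto simp: wedge_def xspan_def)
  qed
  then have "wedge e \<noteq> {}" by auto
  moreover have "finite (wedge e)" using finite_S by (simp add: wedge_def)
  ultimately obtain q where "q \<in> wedge e" "\<forall>r\<in>wedge e. fst q \<le> fst r"
    by (metis arg_min_least arg_min_if_finite(1))
  then have "\<exists>q. q \<in> wedge e \<and> (\<forall>r\<in>wedge e. fst q \<le> fst r)" by blast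
  from someI_ex[OF this, folded apex_def]
  show "apex e \<in> wedge e" "\<And>r. r \<in> wedge e \<Longrightarrow> fst (apex e) \<le> fst r" by auto
qed

text \<open>With equal flags \<open>t\<close> the two wedges overlap on the vertical line through
  the common point (\<open>A\<close>). If the left ends agree, the choice of the next slope excludes
  different edges. Otherwise the left end \<open>a\<close> of \<open>e'\<close> precedes the
  leftmost point of the wedge of \<open>e\<close>, so it lies above or below this wedge, and an edge
  leaving \<open>a\<close> would have to cross a side of it.\<close>

lemma apex_inj:
  assumes e: "e \<in> fan_edges" and e': "e' \<in> fan_edges"
    and w: "apex e = apex e'"
    and t: "snd (apex e) = height (next_edge e) (fst (apex e)) \<longleftrightarrow>
      snd (apex e') = height (next_edge e') (fst (apex e'))"
    and le: "fst (lft e) \<le> fst (lft e')"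
  shows "e = e'"
proof -
  let ?f = "next_edge e" and ?f' = "next_edge e'"
  define x y where "x = fst (apex e)" and "y = snd (apex e)"
  have eE: "e \<in> E" "e' \<in> E" using e e' by (auto simp: fan_edges_def)
  note f = next_edge[OF e] and f' = next_edge[OF e']
  have W: "fst (lft e) < x" "x \<in> xspan e" "x \<in> xspan ?f" "height e x \<le> y" "y \<le> height ?f x"
    using apex(1)[OF e] by (auto simp: wedge_def x_def y_def)
  have W': "fst (lft e') < x" "x \<in> xspan e'" "x \<in> xspan ?f'" "height e' x \<le> y" "y \<le> height ?f' x"
    using apex(1)[OF e'] w by (auto simp: wedge_def x_def y_def)
  have t': "y = height ?f x \<longleftrightarrow> y = height ?f' x" using t w by (simp add: x_def y_def)
  have lt: "height e x < height ?f x" "height e' x < height ?f' x"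
    using height_less_next e e' W(1) W'(1) by auto
  have A: "height e x < height ?f' x" "height e' x < height ?f x"
    using W W' t' lt by auto
  show ?thesis
  proof (cases "lft e = lft e'")
    case True
    have sl: "slope g < slope g'" if "lft g = lft e" "lft g' = lft e" "height g x < height g' x" for g g'
      using that W(1) by (auto simp: height_eq mult_less_cancel_right)
    have "slope e < slope ?f'" "slope e' < slope ?f" using sl A True f f' by auto
    have "\<not> slope e < slope e'"
      using f(4)[OF eE(2)] True \<open>slope e' < slope ?f\<close> by fastforce
    moreover have "\<not> slope e' < slope e"
      using f'(4)[OF eE(1)] True \<open>slope e < slope ?f'\<close> by fastforce
    ultimately show ?thesis using same_germ[OF eE] True by simp
  next
    case False
    define a where "a = lft e'"
    have aS: "a \<in> S" unfolding a_def using E_ends(3)[OF eE(2,2)] .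
    have "fst (lft e) < fst a"
      using le False fst_eq_iff[OF E_ends(3)[OF eE(1,1)] aS] by (auto simp: a_def)
    moreover have "fst a < x" using W'(1) by (simp add: a_def)
    ultimately have sp: "{fst a..x} \<subseteq> xspan e" "{fst a..x} \<subseteq> xspan ?f" "{fst a..x} \<subseteq> xspan e'" "{fst a..x} \<subseteq> xspan ?f'"
      using W W' f(2) f'(2) by (auto simp: xspan_def a_def)
    have "a \<notin> wedge e" using apex(2)[OF e, of a] \<open>fst a < x\<close> by (auto simp: x_def)
    moreover have "fst a \<in> xspan e" "fst a \<in> xspan ?f" using sp(1,2) \<open>fst a < x\<close> by auto
    ultimately have "snd a < height e (fst a) \<or> height ?f (fst a) < snd a"
      using aS \<open>fst (lft e) < fst a\<close> \<open>fst a < x\<close> sp by (auto simp: wedge_def)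
    moreover have "height e' (fst a) = snd a" "height ?f' (fst a) = snd a"
      using f'(2) by (simp_all add: height_eq a_def)
    ultimately show ?thesis
      using no_sign_change[OF f'(1) eE(1) \<open>fst a < x\<close> sp(4,1)] no_sign_change[OF f(1) eE(2) \<open>fst a < x\<close> sp(2,3)] A
      by auto
  qed
qed

text \<open>One steepest edge and at most two charges per point. This weak form of Euler's
  \<open>3 * N - 6\<close> needs neither faces nor connectedness.\<close>

theorem card_edges_le: "card E \<le> 3 * card S"
proof -
  have "inj_on lft (E - fan_edges)"
  proof (rule inj_onI)
    fix e f assume e: "e \<in> E - fan_edges" and f: "f \<in> E - fan_edges" and l: "lft e = lft f"
    have "\<not> slope e < slope f" using e f l unfolding fan_edges_def by auto
    moreover have "\<not> slope f < slope e" using e f l unfolding fan_edges_def by auto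
    ultimately show "e = f" using same_germ[of e f] e f l by auto
  qed
  moreover have "lft ` (E - fan_edges) \<subseteq> S"
    using E_ends(3) by (intro image_subsetI) (metis DiffD1)
  ultimately have 1: "card (E - fan_edges) \<le> card S" by (rule card_inj_on_le) (rule finite_S)
  let ?g = "\<lambda>e. (apex e, snd (apex e) = height (next_edge e) (fst (apex e)))"
  have "inj_on ?g fan_edges"
  proof (rule inj_onI)
    fix e f assume e: "e \<in> fan_edges" and f: "f \<in> fan_edges" and g: "?g e = ?g f"
    have w: "apex e = apex f" using g by (rule Pair_inject)
    have t: "(snd (apex e) = height (next_edge e) (fst (apex e))) = (snd (apex f) = height (next_edge f) (fst (apex f)))"
      using g by (rule Pair_inject)
    show "e = f"
    proof (cases "fst (lft e) \<le> fst (lft f)")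
      case True
      then show ?thesis by (rule apex_inj[OF e f w t])
    next
      case False
      then have "fst (lft f) \<le> fst (lft e)" by simp
      then show ?thesis by (rule apex_inj[OF f e w[symmetric] t[symmetric], symmetric])
    qed
  qed
  moreover have "?g ` fan_edges \<subseteq> S \<times> UNIV"
  proof (rule image_subsetI)
    fix e assume "e \<in> fan_edges"
    then have "apex e \<in> S" using apex(1) wedge_def by simp
    then show "?g e \<in> S \<times> UNIV" by simp
  qed
  ultimately have "card fan_edges \<le> card (S \<times> (UNIV :: bool set))"
    by (rule card_inj_on_le) (simp add: finite_S)
  then have "card fan_edges \<le> 2 * card S" by (simp add: card_cartesian_product)
  moreover have "card E = card fan_edges + card (E - fan_edges)"
  proof -
    have "fan_edges \<subseteq> E" by (auto simp: fan_edges_def)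
    then show ?thesis
      using card_Diff_subset[of fan_edges E] card_mono[of E fan_edges] finite_E finite_subset[of fan_edges E]
      by linarith
  qed
  ultimately show ?thesis using 1 by simp
qed

end

section \<open>Counting perfect matchings of a crossing-free graph\<close>

lemma ordered_enumeration:
  fixes key :: "'a \<Rightarrow> real"
  assumes A: "finite A" and inj: "inj_on key A"
  shows "\<exists>v. bij_betw v {..<card A} A \<and> (\<forall>i j. i < j \<and> j < card A \<longrightarrow> key (v i) < key (v j))"
proof -
  let ?xs = "sorted_list_of_set (key ` A)"
  have len: "length ?xs = card A" using inj by (simp add: card_image)
  define v where "v = (\<lambda>i. the_inv_into A key (?xs ! i))"
  have v: "v i \<in> A" "key (v i) = ?xs ! i" if "i < card A" for i
  proof -
    have "?xs ! i \<in> set ?xs" using that len by (intro nth_mem) simp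
    then have m: "?xs ! i \<in> key ` A" using A by simp
    show "v i \<in> A" unfolding v_def by (rule the_inv_into_into[OF inj m order_refl])
    show "key (v i) = ?xs ! i" unfolding v_def by (rule f_the_inv_into_f[OF inj m])
  qed
  have less: "key (v i) < key (v j)" if "i < j" "j < card A" for i j
  proof -
    have "?xs ! i < ?xs ! j" by (rule sorted_wrt_nth_less[OF strict_sorted_list_of_set that(1)]) (use that(2) len in simp)
    then show ?thesis using that v(2)[of i] v(2)[of j] by simp
  qed
  have "inj_on v {..<card A}"
    by (rule inj_onI) (metis lessThan_iff linorder_neqE_nat less_irrefl less)
  moreover from this have "v ` {..<card A} = A"
    using v(1) A by (intro card_subset_eq) (auto simp: card_image)
  ultimately show ?thesis using less unfolding bij_betw_def by blast
qed

lemma prod_symmetric_square: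
  fixes b :: "nat \<Rightarrow> nat \<Rightarrow> real"
  assumes "\<And>k. b k k = 1"
  shows "(\<Prod>k<n. \<Prod>l<n. b k l) = (\<Prod>l<n. \<Prod>k<l. b k l * b l k)"
proof (induction n)
  case (Suc n)
  have "(\<Prod>k<Suc n. \<Prod>l<Suc n. b k l) = (\<Prod>k<n. \<Prod>l<n. b k l) * (\<Prod>k<n. b k n) * (\<Prod>l<n. b n l)"
    using assms by (simp add: prod.distrib)
  then show ?case by (simp add: Suc prod.distrib mult_ac)
qed simp

context point_set
begin

definition vertex :: "nat \<Rightarrow> pt" where
  "vertex = (SOME v. bij_betw v {..<card S} S \<and> (\<forall>i j. i < j \<and> j < card S \<longrightarrow> fst (v i) < fst (v j)))"

lemma bij_vertex: "bij_betw vertex {..<card S} S"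
  and vertex_less: "i < j \<Longrightarrow> j < card S \<Longrightarrow> fst (vertex i) < fst (vertex j)"
  using someI_ex[OF ordered_enumeration[OF finite_S inj_fst], folded vertex_def] by blast+

lemma sgn_vertex:
  assumes "i < card S" "j < card S"
  shows "sgn (real j - real i) = sgn (fst (vertex j) - fst (vertex i))"
  using vertex_less[of i j] vertex_less[of j i] assms
  by (cases i j rule: linorder_cases) auto

end

definition below :: "pt set \<Rightarrow> pt \<Rightarrow> bool" where
  "below e r \<longleftrightarrow> fst (lft e) < fst r \<and> fst r < fst (rgt e) \<and> snd r < height e (fst r)"

definition below_sign :: "pt set \<Rightarrow> pt \<Rightarrow> real" where
  "below_sign e r = (if below e r then -1 else 1)"

context plane_graph
begin

text \<open>
  The first four factors are the contribution of two pairs to the sign of a permutation: they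
  multiply to \<open>-1\<close> exactly if the projections of the segments interleave.  Since the
  segments are disjoint, in this case exactly one of the two inner endpoints lies below the other segment.
\<close>

definition pair_sign :: "pt \<Rightarrow> pt \<Rightarrow> pt \<Rightarrow> pt \<Rightarrow> real" where
  "pair_sign p q r s = sgn (fst r - fst p) * sgn (fst r - fst q) * sgn (fst s - fst p) * sgn (fst s - fst q) *
     (below_sign {p, q} r * below_sign {p, q} s * (below_sign {r, s} p * below_sign {r, s} q))"

lemma height_neq:
  assumes "e \<in> E" "f \<in> E" "e \<inter> f = {}" "x \<in> xspan e" "x \<in> xspan f"
  shows "height e x \<noteq> height f x"
proof
  assume h: "height e x = height f x"
  have "e \<noteq> f" using assms(1,3) edge(2)[OF assms(1)] by auto
  from common_point[OF assms(1,2) this assms(4,5) h] show False using assms(3) by blast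
qed

text \<open>The projections are disjoint, interleaved or nested. In the nested case the inner
  segment stays on one side of the outer one, so its two ends contribute equal signs.\<close>

lemma pair_sign_ordered:
  assumes ef: "e \<in> E" "f \<in> E" and d: "e \<inter> f = {}" and lt: "fst (lft e) < fst (lft f)"
  shows "pair_sign (lft e) (rgt e) (lft f) (rgt f) = 1"
proof -
  define p q r s where "p = lft e" and "q = rgt e" and "r = lft f" and "s = rgt f"
  have e: "{p, q} = e" and f: "{r, s} = f" and pq: "fst p < fst q" and rs: "fst r < fst s"
    using E_ends(1,2)[OF ef(1,1)] E_ends(1,2)[OF ef(2,2)] by (auto simp: p_def q_def r_def s_def)
  have S: "p \<in> S" "q \<in> S" "r \<in> S" "s \<in> S"
    using edge(1) ef e f by auto
  have ne: "fst q \<noteq> fst r" "fst q \<noteq> fst s"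
    using d e f S by (auto simp: fst_eq_iff)
  have pr: "fst p < fst r" using lt by (simp add: p_def r_def)
  have hr: "height f (fst r) = snd r" and hs: "height f (fst s) = snd s" and hq: "height e (fst q) = snd q"
    using E_height_ends[OF ef(1,1)] E_height_ends[OF ef(2,2)] by (simp_all add: q_def r_def s_def)
  have be: "below e z \<longleftrightarrow> fst p < fst z \<and> fst z < fst q \<and> snd z < height e (fst z)" for z
    by (simp add: below_def p_def q_def)
  have bf: "below f z \<longleftrightarrow> fst r < fst z \<and> fst z < fst s \<and> snd z < height f (fst z)" for z
    by (simp add: below_def r_def s_def)
  have P: "pair_sign p q r s = sgn (fst r - fst p) * sgn (fst r - fst q) * sgn (fst s - fst p) * sgn (fst s - fst q) *
     (below_sign e r * below_sign e s * (below_sign f p * below_sign f q))"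
    by (simp add: pair_sign_def e f)
  have xe: "x \<in> xspan e \<longleftrightarrow> fst p \<le> x \<and> x \<le> fst q" and xf: "x \<in> xspan f \<longleftrightarrow> fst r \<le> x \<and> x \<le> fst s" for x
    by (simp_all add: xspan_def p_def q_def r_def s_def)
  consider "fst q < fst r" | "fst r < fst q" "fst q < fst s" | "fst s < fst q" using ne by linarith
  then have "pair_sign p q r s = 1"
  proof cases
    case 1
    then show ?thesis using pq rs pr unfolding P by (simp add: below_sign_def be bf)
  next
    case 2
    have sp: "{fst r..fst q} \<subseteq> xspan e" "{fst r..fst q} \<subseteq> xspan f" using 2 pr xe xf by auto
    have m: "fst r \<in> xspan e" "fst r \<in> xspan f" "fst q \<in> xspan e" "fst q \<in> xspan f" using 2 pr xe xf by auto
    \<comment> \<open>The vertical order is the same at both ends of the common range, so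
      \<open>r\<close> is below \<open>e\<close> exactly if \<open>q\<close> is not below
      \<open>f\<close>.\<close>
    have "height e (fst r) < height f (fst r) \<longleftrightarrow> height e (fst q) < height f (fst q)"
      using no_sign_change[OF ef 2(1) sp] no_sign_change[OF ef(2,1) 2(1) sp(2,1)]
        height_neq[OF ef d, of "fst r"] height_neq[OF ef d, of "fst q"] m by fastforce
    moreover have "height e (fst r) \<noteq> height f (fst r)" using height_neq[OF ef d, of "fst r"] m by auto
    ultimately have "below e r \<longleftrightarrow> \<not> below f q" using be bf 2 pr hr hq by auto
    moreover have "\<not> below e s" "\<not> below f p" using be bf 2 pr by auto
    ultimately show ?thesis using pq rs pr 2 unfolding P by (simp add: below_sign_def)
  next
    case 3
    have sp: "{fst r..fst s} \<subseteq> xspan e" "{fst r..fst s} \<subseteq> xspan f" using 3 pr xe xf by auto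
    have m: "fst r \<in> xspan e" "fst r \<in> xspan f" "fst s \<in> xspan e" "fst s \<in> xspan f" using 3 pr rs xe xf by auto
    have "height e (fst r) < height f (fst r) \<longleftrightarrow> height e (fst s) < height f (fst s)"
      using no_sign_change[OF ef rs sp] no_sign_change[OF ef(2,1) rs sp(2,1)]
        height_neq[OF ef d, of "fst r"] height_neq[OF ef d, of "fst s"] m by fastforce
    moreover have "height e (fst r) \<noteq> height f (fst r)" "height e (fst s) \<noteq> height f (fst s)"
      using height_neq[OF ef d, of "fst r"] height_neq[OF ef d, of "fst s"] m by auto
    ultimately have "below e r \<longleftrightarrow> below e s" using be 3 pr rs hr hs by auto
    moreover have "\<not> below f q" "\<not> below f p" using bf 3 pr by auto
    ultimately show ?thesis using pq rs pr 3 unfolding P by (simp add: below_sign_def)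
  qed
  then show ?thesis by (simp add: p_def q_def r_def s_def)
qed

lemma pair_sign_commute: "pair_sign r s p q = pair_sign p q r s"
proof -
  have "sgn (fst p - fst r) * sgn (fst p - fst s) * sgn (fst q - fst r) * sgn (fst q - fst s) =
    sgn (fst r - fst p) * sgn (fst r - fst q) * sgn (fst s - fst p) * sgn (fst s - fst q)"
    by (simp add: sgn_if)
  then show ?thesis by (simp add: pair_sign_def mult_ac)
qed

lemma pair_sign_swap: "pair_sign q p r s = pair_sign p q r s" "pair_sign p q s r = pair_sign p q r s"
  by (simp_all add: pair_sign_def insert_commute mult_ac)

lemma pair_sign_eq_1:
  assumes ef: "{p, q} \<in> E" "{r, s} \<in> E" and d: "{p, q} \<inter> {r, s} = {}"
  shows "pair_sign p q r s = 1"
proof -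
  let ?e = "{p, q}" and ?f = "{r, s}"
  have *: "pair_sign p q r s = pair_sign (lft ?e) (rgt ?e) (lft ?f) (rgt ?f)"
    using E_ends(1)[OF ef(1,1)] E_ends(1)[OF ef(2,2)] pair_sign_swap by (metis doubleton_eq_iff)
  have "fst (lft ?e) \<noteq> fst (lft ?f)"
    using E_ends(1,3)[OF ef(1,1)] E_ends(1,3)[OF ef(2,2)] d fst_eq_iff by (metis disjoint_iff insertCI)
  then show ?thesis
    unfolding * using pair_sign_ordered[OF ef d] pair_sign_ordered[OF ef(2,1)] d pair_sign_commute
    by (metis Int_commute linorder_neqE_linordered_idom)
qed

text \<open>
  An explicit Kasteleyn orientation: it depends on the points only, not on the graph.
\<close>

definition signed_adjacency :: "nat \<Rightarrow> nat \<Rightarrow> real" where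
  "signed_adjacency i j = (if {vertex i, vertex j} \<in> E then sgn (real j - real i) * (\<Prod>r\<in>S. below_sign {vertex i, vertex j} r) else 0)"

lemma signed_adjacency_skew: "signed_adjacency j i = - signed_adjacency i j"
proof -
  have "sgn (real i - real j) = - sgn (real j - real i)" by (simp add: sgn_if)
  then show ?thesis by (simp add: signed_adjacency_def insert_commute)
qed

lemma below_sign_end:
  assumes "{p, q} \<in> E"
  shows "below_sign {p, q} p = 1" "below_sign {p, q} q = 1"
  using E_ends(1)[OF assms assms] unfolding below_sign_def below_def
  by (metis doubleton_eq_iff less_irrefl)+

text \<open>The sign and the orientations reduce to a product over pairs of blocks, and the signs
  for points below edges are distributed over the same pairs. Each pair of disjoint edges then
  contributes its \<open>pair_sign\<close>, which is 1.\<close>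

lemma signed_adjacency_term:
  assumes n: "card S = 2 * n" and p: "\<sigma> permutes {..<2 * n}"
    and E: "\<And>k. k < n \<Longrightarrow> {vertex (\<sigma> (2 * k)), vertex (\<sigma> (Suc (2 * k)))} \<in> E"
  shows "of_int (sign \<sigma>) * (\<Prod>k<n. signed_adjacency (\<sigma> (2 * k)) (\<sigma> (Suc (2 * k)))) = 1"
proof -
  let ?v = "\<lambda>m. vertex (\<sigma> m)" and ?e = "\<lambda>k. {vertex (\<sigma> (2 * k)), vertex (\<sigma> (Suc (2 * k)))}"
  let ?o = "\<lambda>i j. sgn (real (\<sigma> j) - real (\<sigma> i))"
  \<comment> \<open>The contribution of both ends of edge \<open>l\<close> to the sign of edge
    \<open>k\<close>. The diagonal value 1 is correct since \<open>below\<close> excludes the ends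
    of an edge.\<close>
  define b where "b = (\<lambda>k l. if k = l then 1 else below_sign (?e k) (?v (2 * l)) * below_sign (?e k) (?v (Suc (2 * l))))"
  have bij: "bij_betw ?v {..<2 * n} S"
    using bij_betw_trans[OF permutes_imp_bij[OF p]] bij_vertex n by (simp add: comp_def)
  have \<sigma>: "\<sigma> m < card S" if "m < 2 * n" for m using permutes_less[OF p that] n by simp
  have prodS: "(\<Prod>r\<in>S. below_sign (?e k) r) = (\<Prod>l<n. b k l)" if k: "k < n" for k
  proof -
    have "(\<Prod>r\<in>S. below_sign (?e k) r) = (\<Prod>m<2*n. below_sign (?e k) (?v m))"
      by (rule prod.reindex_bij_betw[OF bij, symmetric])
    also have "\<dots> = (\<Prod>l<n. below_sign (?e k) (?v (2 * l)) * below_sign (?e k) (?v (Suc (2 * l))))"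
      by (rule prod_lessThan_double)
    also have "\<dots> = (\<Prod>l<n. b k l)"
      by (intro prod.cong refl) (auto simp: b_def below_sign_end[OF E[OF k]])
    finally show ?thesis .
  qed
  have "(\<Prod>k<n. signed_adjacency (\<sigma> (2 * k)) (\<sigma> (Suc (2 * k)))) = (\<Prod>k<n. ?o (2 * k) (Suc (2 * k)) * (\<Prod>l<n. b k l))"
    by (intro prod.cong refl) (simp add: signed_adjacency_def E prodS)
  then have "of_int (sign \<sigma>) * (\<Prod>k<n. signed_adjacency (\<sigma> (2 * k)) (\<sigma> (Suc (2 * k)))) =
     (of_int (sign \<sigma>) * (\<Prod>k<n. ?o (2 * k) (Suc (2 * k)))) * (\<Prod>k<n. \<Prod>l<n. b k l)"
    by (simp add: prod.distrib)
  also have "\<dots> = (\<Prod>l<n. \<Prod>k<l. ?o (2 * k) (2 * l) * ?o (Suc (2 * k)) (2 * l) *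
      ?o (2 * k) (Suc (2 * l)) * ?o (Suc (2 * k)) (Suc (2 * l))) * (\<Prod>l<n. \<Prod>k<l. b k l * b l k)"
    unfolding sign_times_orientations[OF p] by (subst prod_symmetric_square) (simp_all add: b_def)
  also have "\<dots> = (\<Prod>l<n. \<Prod>k<l. ?o (2 * k) (2 * l) * ?o (Suc (2 * k)) (2 * l) *
      ?o (2 * k) (Suc (2 * l)) * ?o (Suc (2 * k)) (Suc (2 * l)) * (b k l * b l k))"
    by (simp only: prod.distrib)
  also have "\<dots> = 1"
  proof (intro prod.neutral ballI)
    fix l k assume "l \<in> {..<n}" "k \<in> {..<l}"
    then have kl: "k < n" "l < n" "k \<noteq> l" by auto
    have inj: "?v a = ?v b \<longleftrightarrow> a = b" if "a < 2 * n" "b < 2 * n" for a b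
      using bij that unfolding bij_betw_def by (auto dest: inj_onD)
    have "Suc (2 * k) \<noteq> 2 * l" "2 * k \<noteq> Suc (2 * l)" by presburger+
    then have "?e k \<inter> ?e l = {}" using kl by (auto simp: inj)
    from pair_sign_eq_1[OF E[OF kl(1)] E[OF kl(2)] this]
    show "?o (2 * k) (2 * l) * ?o (Suc (2 * k)) (2 * l) *
      ?o (2 * k) (Suc (2 * l)) * ?o (Suc (2 * k)) (Suc (2 * l)) * (b k l * b l k) = 1"
      using kl \<sigma> by (simp add: pair_sign_def b_def sgn_vertex)
  qed
  finally show ?thesis .
qed

end

section \<open>Perfect matchings and their listings by permutations\<close>

definition perfect_matching :: "'a set \<Rightarrow> 'a set set \<Rightarrow> bool" where
  "perfect_matching S M \<longleftrightarrow> (\<forall>e\<in>M. e \<subseteq> S \<and> card e = 2) \<and> (\<forall>p\<in>S. \<exists>!e. e \<in> M \<and> p \<in> e)"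

lemma perfect_matching_finite:
  assumes "perfect_matching S M" "finite S"
  shows "finite M"
  by (rule finite_subset[of _ "Pow S"]) (use assms in \<open>auto simp: perfect_matching_def\<close>)

lemma perfect_matching_disjoint:
  assumes "perfect_matching S M" "e \<in> M" "f \<in> M" "p \<in> e" "p \<in> f"
  shows "e = f"
  using assms unfolding perfect_matching_def by blast

lemma card_perfect_matching:
  assumes M: "perfect_matching S M" and "finite S"
  shows "card S = 2 * card M"
proof -
  have "S = \<Union>M" using M unfolding perfect_matching_def by blast
  moreover have "card (\<Union>M) = sum card M"
  proof (rule card_Union_disjoint)
    show "pairwise disjnt M"
      using perfect_matching_disjoint[OF M] unfolding pairwise_def disjnt_def by blast
    show "\<And>e. e \<in> M \<Longrightarrow> finite e"
      using M by (metis card.infinite perfect_matching_def zero_neq_numeral)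
  qed
  moreover have "sum card M = (\<Sum>e\<in>M. 2)" using M by (intro sum.cong) (auto simp: perfect_matching_def)
  ultimately show ?thesis by simp
qed

context point_set
begin

text \<open>For a matching these are the ways of writing down its pairs; for the whole edge set
  \<open>E\<close> they are the nonzero terms of the Pfaffian sum.\<close>

definition listing :: "nat \<Rightarrow> pt set set \<Rightarrow> (nat \<Rightarrow> nat) \<Rightarrow> bool" where
  "listing n M \<sigma> \<longleftrightarrow> \<sigma> permutes {..<2 * n} \<and>
     (\<forall>k<n. {vertex (\<sigma> (2 * k)), vertex (\<sigma> (Suc (2 * k)))} \<in> M)"

lemma listing_exists:
  assumes M: "perfect_matching S M" and n: "card S = 2 * n"
  shows "\<exists>\<sigma>. listing n M \<sigma>"
proof -
  have "card M = n" using card_perfect_matching[OF M finite_S] n by simp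
  then obtain h where h: "bij_betw h {..<n} M"
    using bij_betw_from_nat_into_finite[OF perfect_matching_finite[OF M finite_S]] by auto
  define g where "g = (\<lambda>i. if even i then lft (h (i div 2)) else rgt (h (i div 2)))"
  have hM: "h k \<in> M" if "k < n" for k using h that by (auto simp: bij_betw_def)
  have hS: "h k \<subseteq> S" "card (h k) = 2" if "k < n" for k
    using M hM[OF that] by (auto simp: perfect_matching_def)
  have gh: "g i \<in> h (i div 2)" "g i \<in> S" if "i < 2 * n" for i
  proof -
    have "i div 2 < n" using that by auto
    from edge_ends[OF hS[OF this]] show "g i \<in> h (i div 2)" "g i \<in> S" unfolding g_def by auto
  qed
  have ginj: "inj_on g {..<2 * n}"
  proof (rule inj_onI)
    fix i j assume ij: "i \<in> {..<2 * n}" "j \<in> {..<2 * n}" "g i = g j"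
    then have lt: "i div 2 < n" "j div 2 < n" by auto
    have "h (i div 2) = h (j div 2)"
      using perfect_matching_disjoint[OF M hM[OF lt(1)] hM[OF lt(2)], of "g i"] gh[of i] gh[of j] ij by simp
    then have d: "i div 2 = j div 2" using h lt by (auto simp: bij_betw_def dest: inj_onD)
    have "fst (lft (h (i div 2))) < fst (rgt (h (i div 2)))" by (rule edge_ends[OF hS[OF lt(1)]])
    then have "even i \<longleftrightarrow> even j" using ij(3) d unfolding g_def by (auto split: if_splits)
    then show "i = j" using d by (metis dvd_mult_div_cancel odd_two_times_div_two_succ)
  qed
  define w where "w = the_inv_into {..<card S} vertex"
  have vinj: "inj_on vertex {..<card S}" and vim: "vertex ` {..<card S} = S"
    using bij_vertex by (auto simp: bij_betw_def)
  have vw: "vertex (w p) = p" "w p < 2 * n" if "p \<in> S" for p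
    using f_the_inv_into_f[OF vinj, of p] the_inv_into_into[OF vinj, of p "{..<card S}"] that vim n
    by (auto simp: w_def)
  define \<sigma> where "\<sigma> = (\<lambda>i. if i < 2 * n then w (g i) else i)"
  have "inj_on \<sigma> {..<2 * n}"
  proof (rule inj_onI)
    fix i j assume ij: "i \<in> {..<2 * n}" "j \<in> {..<2 * n}" "\<sigma> i = \<sigma> j"
    then have "vertex (w (g i)) = vertex (w (g j))" by (simp add: \<sigma>_def)
    then have "g i = g j" using ij gh(2) by (simp add: vw)
    then show "i = j" using ginj ij by (auto dest: inj_onD)
  qed
  moreover have "\<sigma> ` {..<2 * n} \<subseteq> {..<2 * n}" 
  proof (rule image_subsetI)
    fix i assume "i \<in> {..<2 * n}"
    then show "\<sigma> i \<in> {..<2 * n}" using vw(2)[OF gh(2)[of i]] by (simp add: \<sigma>_def)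
  qed
  ultimately have "bij_betw \<sigma> {..<2 * n} {..<2 * n}"
    using endo_inj_surj[of "{..<2 * n}" \<sigma>] by (simp add: bij_betw_def)
  then have "\<sigma> permutes {..<2 * n}" by (rule bij_imp_permutes) (simp add: \<sigma>_def)
  moreover have "{vertex (\<sigma> (2 * k)), vertex (\<sigma> (Suc (2 * k)))} \<in> M" if k: "k < n" for k
  proof -
    have "{vertex (\<sigma> (2 * k)), vertex (\<sigma> (Suc (2 * k)))} = {g (2 * k), g (Suc (2 * k))}"
      using k gh(2)[of "2 * k"] gh(2)[of "Suc (2 * k)"] by (simp add: \<sigma>_def vw)
    also have "\<dots> = h k" using edge_ends(1)[OF hS[OF k]] by (simp add: g_def)
    finally show ?thesis using hM[OF k] by simp
  qed
  ultimately show ?thesis unfolding listing_def by blast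
qed

lemma listing_determines:
  assumes M: "perfect_matching S M" and n: "card S = 2 * n" and \<sigma>: "listing n M \<sigma>"
  shows "M = {{vertex (\<sigma> (2 * k)), vertex (\<sigma> (Suc (2 * k)))} | k. k < n}"
proof (rule subset_antisym; rule subsetI)
  fix e assume "e \<in> {{vertex (\<sigma> (2 * k)), vertex (\<sigma> (Suc (2 * k)))} | k. k < n}"
  then show "e \<in> M" using \<sigma> by (auto simp: listing_def)
next
  fix e assume e: "e \<in> M"
  have p: "\<sigma> permutes {..<2 * n}" using \<sigma> by (simp add: listing_def)
  have eS: "e \<subseteq> S" "card e = 2" using M e by (auto simp: perfect_matching_def)
  have "lft e \<in> vertex ` \<sigma> ` {..<2 * n}"
    using edge_ends(3)[OF eS] bij_vertex n permutes_image[OF p] by (simp add: bij_betw_def)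
  then obtain m where m: "m < 2 * n" "lft e = vertex (\<sigma> m)" by auto
  let ?k = "m div 2"
  have k: "?k < n" using m(1) by auto
  then have E: "{vertex (\<sigma> (2 * ?k)), vertex (\<sigma> (Suc (2 * ?k)))} \<in> M" using \<sigma> by (simp add: listing_def)
  have "m = 2 * ?k \<or> m = Suc (2 * ?k)" by linarith
  then have "lft e \<in> {vertex (\<sigma> (2 * ?k)), vertex (\<sigma> (Suc (2 * ?k)))}" using m(2) by auto
  moreover have "lft e \<in> e" using edge_ends(1)[OF eS] by auto
  ultimately have "e = {vertex (\<sigma> (2 * ?k)), vertex (\<sigma> (Suc (2 * ?k)))}"
    using perfect_matching_disjoint[OF M e E] by blast
  then show "e \<in> {{vertex (\<sigma> (2 * k)), vertex (\<sigma> (Suc (2 * k)))} | k. k < n}" using k by blast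
qed

text \<open>A block permutation only reorders the pairs and exchanges ends within pairs.\<close>

lemma listing_compose:
  assumes \<rho>: "listing n M \<rho>" and \<sigma>: "\<sigma> \<in> block_perms n"
  shows "listing n M (\<rho> \<circ> \<sigma>)"
  unfolding listing_def
proof (intro conjI allI impI)
  have p: "\<sigma> permutes {..<2 * n}" using \<sigma> by (simp add: block_perms_def)
  show "\<rho> \<circ> \<sigma> permutes {..<2 * n}"
    using \<rho> p by (intro permutes_compose) (simp_all add: listing_def)
  fix k assume k: "k < n"
  let ?m = "\<sigma> (2 * k) div 2"
  have "\<sigma> (2 * k) < 2 * n" using permutes_less[OF p, of "2 * k"] k by simp
  then have m: "?m < n" by auto
  have b: "\<sigma> (Suc (2 * k)) div 2 = ?m" using \<sigma> k by (simp add: block_perms_def)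
  have ne: "\<sigma> (2 * k) \<noteq> \<sigma> (Suc (2 * k))" using inj_eq[OF permutes_inj[OF p], of "2 * k" "Suc (2 * k)"] by simp
  have two: "i = 2 * (i div 2) \<or> i = Suc (2 * (i div 2))" for i :: nat by linarith
  have "\<sigma> (2 * k) = 2 * ?m \<and> \<sigma> (Suc (2 * k)) = Suc (2 * ?m) \<or>
      \<sigma> (2 * k) = Suc (2 * ?m) \<and> \<sigma> (Suc (2 * k)) = 2 * ?m"
    using two[of "\<sigma> (2 * k)"] two[of "\<sigma> (Suc (2 * k))"] ne unfolding b by linarith
  moreover have "{vertex (\<rho> (2 * ?m)), vertex (\<rho> (Suc (2 * ?m)))} \<in> M" using \<rho> m by (simp add: listing_def)
  ultimately show "{vertex ((\<rho> \<circ> \<sigma>) (2 * k)), vertex ((\<rho> \<circ> \<sigma>) (Suc (2 * k)))} \<in> M"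
    unfolding comp_apply by (elim disjE conjE) (simp_all only: insert_commute)
qed

end

context plane_graph
begin

lemma pfsum_signed_adjacency:
  assumes n: "card S = 2 * n"
  shows "pfsum n signed_adjacency = card {\<sigma>. listing n E \<sigma>}"
proof -
  have "pfsum n signed_adjacency = (\<Sum>\<sigma> | listing n E \<sigma>. 1)"
    unfolding pfsum_def
  proof (rule sum.mono_neutral_cong_right)
    show "\<forall>\<sigma>\<in>{\<sigma>. \<sigma> permutes {..<2 * n}} - {\<sigma>. listing n E \<sigma>}.
       of_int (sign \<sigma>) * (\<Prod>k<n. signed_adjacency (\<sigma> (2 * k)) (\<sigma> (Suc (2 * k)))) = 0"
    proof (rule ballI)
      fix \<sigma> assume "\<sigma> \<in> {\<sigma>. \<sigma> permutes {..<2 * n}} - {\<sigma>. listing n E \<sigma>}"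
      then obtain k where "k < n" "{vertex (\<sigma> (2 * k)), vertex (\<sigma> (Suc (2 * k)))} \<notin> E"
        by (auto simp: listing_def)
      then have "(\<Prod>k<n. signed_adjacency (\<sigma> (2 * k)) (\<sigma> (Suc (2 * k)))) = 0"
        by (intro prod_zero bexI[of _ k]) (auto simp: signed_adjacency_def)
      then show "of_int (sign \<sigma>) * (\<Prod>k<n. signed_adjacency (\<sigma> (2 * k)) (\<sigma> (Suc (2 * k)))) = 0" by simp
    qed
  next
    fix \<sigma> assume "\<sigma> \<in> {\<sigma>. listing n E \<sigma>}"
    then show "of_int (sign \<sigma>) * (\<Prod>k<n. signed_adjacency (\<sigma> (2 * k)) (\<sigma> (Suc (2 * k)))) = 1"
      using n by (intro signed_adjacency_term) (auto simp: listing_def)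
  qed (auto simp: listing_def finite_permutations)
  then show ?thesis by simp
qed

definition matchings :: "pt set set set" where
  "matchings = {M. M \<subseteq> E \<and> perfect_matching S M}"

lemma finite_matchings: "finite matchings"
  unfolding matchings_def by (rule finite_subset[of _ "Pow E"]) (use finite_E in auto)

text \<open>Each matching has a listing for every block permutation, and a listing determines its
  matching. The factor cancels against the one in \<open>pfsum_square_le\<close>.\<close>

lemma card_matchings_mult_le:
  assumes n: "card S = 2 * n"
  shows "card matchings * card (block_perms n) \<le> card {\<sigma>. listing n E \<sigma>}"
proof -
  have "\<forall>M\<in>matchings. \<exists>\<rho>. listing n M \<rho>" using listing_exists[OF _ n] by (auto simp: matchings_def)
  then obtain \<rho> where \<rho>: "\<And>M. M \<in> matchings \<Longrightarrow> listing n M (\<rho> M)" by metis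
  have L: "listing n M (\<rho> M \<circ> \<sigma>)" if "M \<in> matchings" "\<sigma> \<in> block_perms n" for M \<sigma>
    using listing_compose[OF \<rho>] that by blast
  have "inj_on (\<lambda>(M, \<sigma>). \<rho> M \<circ> \<sigma>) (matchings \<times> block_perms n)"
  proof (rule inj_onI, clarify)
    fix M \<sigma> M' \<sigma>'
    assume M: "M \<in> matchings" "M' \<in> matchings" and s: "\<sigma> \<in> block_perms n" "\<sigma>' \<in> block_perms n"
      and eq: "\<rho> M \<circ> \<sigma> = \<rho> M' \<circ> \<sigma>'"
    have PM: "perfect_matching S M" "perfect_matching S M'" using M by (simp_all add: matchings_def)
    have MM: "M = M'"
      by (rule trans[OF listing_determines[OF PM(1) n L[OF M(1) s(1)]]
            listing_determines[OF PM(2) n L[OF M(2) s(2)], folded eq, symmetric]])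
    have "inj (\<rho> M)" using \<rho>[OF M(1)] permutes_inj unfolding listing_def by blast
    then have "\<sigma> = \<sigma>'" using eq MM by (simp add: fun_eq_iff inj_eq)
    then show "M = M' \<and> \<sigma> = \<sigma>'" using MM by simp
  qed
  moreover have "(\<lambda>(M, \<sigma>). \<rho> M \<circ> \<sigma>) ` (matchings \<times> block_perms n) \<subseteq> {\<sigma>. listing n E \<sigma>}"
  proof (rule image_subsetI, clarify)
    fix M \<sigma> assume M: "M \<in> matchings" and s: "\<sigma> \<in> block_perms n"
    have "M \<subseteq> E" using M by (simp add: matchings_def)
    then show "listing n E (\<rho> M \<circ> \<sigma>)" using L[OF M s] unfolding listing_def by blast
  qed
  moreover have "finite {\<sigma>. listing n E \<sigma>}"
    by (rule finite_subset[OF _ finite_permutations[of "{..<2*n}"]]) (auto simp: listing_def)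
  ultimately have "card (matchings \<times> block_perms n) \<le> card {\<sigma>. listing n E \<sigma>}" by (rule card_inj_on_le)
  then show ?thesis by (simp add: card_cartesian_product)
qed

lemma sum_signed_adjacency_squares:
  assumes n: "card S = 2 * n"
  shows "(\<Sum>i<2*n. \<Sum>j<2*n. (signed_adjacency i j)\<^sup>2) \<le> 12 * n"
proof -
  let ?P = "{(i, j). i < 2 * n \<and> j < 2 * n \<and> {vertex i, vertex j} \<in> E}"
  have one: "(\<Prod>r\<in>S. below_sign e r)\<^sup>2 = 1" for e
    unfolding prod_power_distrib by (intro prod.neutral) (auto simp: below_sign_def)
  have K1: "(signed_adjacency i j)\<^sup>2 \<le> (if {vertex i, vertex j} \<in> E then 1 else 0)" for i j
    by (simp add: signed_adjacency_def power_mult_distrib one sgn_if)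
  have inj: "vertex a = vertex b \<longleftrightarrow> a = b" if "a < 2 * n" "b < 2 * n" for a b
    using bij_vertex that n by (auto simp: bij_betw_def dest: inj_onD)
  have fin: "finite ?P" by (rule finite_subset[of _ "{..<2*n} \<times> {..<2*n}"]) auto
  have "(\<Sum>i<2*n. \<Sum>j<2*n. (signed_adjacency i j)\<^sup>2) \<le> (\<Sum>i<2*n. \<Sum>j<2*n. if {vertex i, vertex j} \<in> E then 1 else 0)"
    by (intro sum_mono K1)
  also have "\<dots> = (\<Sum>x\<in>{..<2*n} \<times> {..<2*n}. if {vertex (fst x), vertex (snd x)} \<in> E then 1 else 0)"
    by (simp add: sum.cartesian_product case_prod_unfold)
  also have "\<dots> = (\<Sum>x\<in>?P. 1)"
    by (rule sum.mono_neutral_cong_right) auto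
  also have "\<dots> = card ?P" by simp
  also have "card ?P \<le> card (E \<times> (UNIV :: bool set))"
  proof (rule card_inj_on_le)
    \<comment> \<open>The flag \<open>i < j\<close> separates the two entries belonging to one
      edge.\<close>
    show "inj_on (\<lambda>(i, j). ({vertex i, vertex j}, i < j)) ?P"
      by (rule inj_onI) (auto simp: doubleton_eq_iff inj)
    show "(\<lambda>(i, j). ({vertex i, vertex j}, i < j)) ` ?P \<subseteq> E \<times> UNIV" by auto
  qed (simp add: finite_E)
  \<comment> \<open>\<open>12 = 2 * 3 * 2\<close>: two entries for each of at most
    \<open>3 * card S\<close> edges, and \<open>card S = 2 * n\<close>.\<close>
  also have "card (E \<times> (UNIV :: bool set)) \<le> 12 * n"
    using card_edges_le n by (simp add: card_cartesian_product)
  finally show ?thesis by (simp only: of_nat_le_iff)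
qed

text \<open>The base 6 is the bound \<open>12 * n / (2 * n)\<close> on the mean sum of squares per
  row.\<close>

theorem card_matchings_square_le:
  assumes n: "card S = 2 * n"
  shows "(real (card matchings))\<^sup>2 \<le> 6 ^ n"
proof (cases "n = 0")
  case True
  then have "S = {}" using n finite_S by simp
  then have "M = {}" if "M \<in> matchings" for M
    using that unfolding matchings_def perfect_matching_def by (auto simp: subset_empty)
  then have "matchings \<subseteq> {{}}" by blast
  then have "card matchings \<le> card {{} :: pt set set}" by (intro card_mono) auto
  then show ?thesis using True by (simp add: power_le_one)
next
  case False
  let ?c = "real (card (block_perms n))"
  have c: "0 < ?c" using block_perms_pos by simp
  have "real (card matchings) * ?c \<le> pfsum n signed_adjacency"
    unfolding pfsum_signed_adjacency[OF n] of_nat_mult[symmetric] of_nat_le_iff by (rule card_matchings_mult_le[OF n])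
  then have "(real (card matchings) * ?c)\<^sup>2 \<le> (pfsum n signed_adjacency)\<^sup>2" by (intro power_mono) auto
  also have "\<dots> \<le> ?c\<^sup>2 * ((\<Sum>i<2*n. \<Sum>j<2*n. (signed_adjacency i j)\<^sup>2) / real (2 * n)) ^ n"
    using False by (intro pfsum_square_le signed_adjacency_skew) simp
  also have "\<dots> \<le> ?c\<^sup>2 * 6 ^ n"
  proof (intro mult_left_mono power_mono)
    show "(\<Sum>i<2*n. \<Sum>j<2*n. (signed_adjacency i j)\<^sup>2) / real (2 * n) \<le> 6"
      using sum_signed_adjacency_squares[OF n] False by (simp add: field_simps)
    show "0 \<le> (\<Sum>i<2*n. \<Sum>j<2*n. (signed_adjacency i j)\<^sup>2) / real (2 * n)"
      by (intro divide_nonneg_nonneg sum_nonneg zero_le_power2) simp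
  qed simp
  finally have "?c\<^sup>2 * (real (card matchings))\<^sup>2 \<le> ?c\<^sup>2 * 6 ^ n" by (simp add: power_mult_distrib mult.commute)
  then show ?thesis using c by (simp add: mult_le_cancel_left_pos)
qed

end

section \<open>Extending disjoint segments\<close>

text \<open>The segment runs at \<open>x\<close> into the relative interior of another one in its
  current extent. As \<open>lo\<close> and \<open>hi\<close> only move outwards, this persists in
  later extensions.\<close>

definition blocked :: "'e set \<Rightarrow> ('e \<Rightarrow> real \<Rightarrow> real) \<Rightarrow> ('e \<Rightarrow> real) \<Rightarrow> ('e \<Rightarrow> real) \<Rightarrow> 'e \<Rightarrow> real \<Rightarrow> bool" where
  "blocked M h lo hi e x \<longleftrightarrow> (\<exists>f\<in>M. f \<noteq> e \<and> lo f < x \<and> x < hi f \<and> h f x = h e x)"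

definition disjoint_interiors :: "'e set \<Rightarrow> ('e \<Rightarrow> real \<Rightarrow> real) \<Rightarrow> ('e \<Rightarrow> real) \<Rightarrow> ('e \<Rightarrow> real) \<Rightarrow> bool" where
  "disjoint_interiors M h lo hi \<longleftrightarrow> (\<forall>e\<in>M. \<forall>f\<in>M. \<forall>x. e \<noteq> f \<and> x \<in> {lo e..hi e} \<and> x \<in> {lo f..hi f} \<and> h e x = h f x \<longrightarrow>
     x \<in> {lo e, hi e, lo f, hi f})"

locale segment_family =
  fixes M :: "'e set" and h :: "'e \<Rightarrow> real \<Rightarrow> real" and a b :: "'e \<Rightarrow> real" and R :: real
  assumes finite_M: "finite M"
    and affine_h: "\<And>e. \<exists>c d. \<forall>x. h e x = c + d * x"
    and ab: "\<And>e. e \<in> M \<Longrightarrow> - R < a e \<and> a e < b e \<and> b e < R"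
    and disjoint: "\<And>e f x. e \<in> M \<Longrightarrow> f \<in> M \<Longrightarrow> e \<noteq> f \<Longrightarrow> x \<in> {a e..b e} \<Longrightarrow> x \<in> {a f..b f} \<Longrightarrow> h e x \<noteq> h f x"
    and generic: "\<And>e f. e \<in> M \<Longrightarrow> f \<in> M \<Longrightarrow> e \<noteq> f \<Longrightarrow> h e (a f) \<noteq> h f (a f) \<and> h e (b f) \<noteq> h f (b f)"
begin

text \<open>\<open>DL\<close> and \<open>DR\<close> collect the segments whose left or right end has
  already been moved. The strict inequalities put the original ends into the interior of the
  extended segments.\<close>

definition extension :: "('e \<Rightarrow> real) \<Rightarrow> ('e \<Rightarrow> real) \<Rightarrow> 'e set \<Rightarrow> 'e set \<Rightarrow> bool" where
  "extension lo hi DL DR \<longleftrightarrow> disjoint_interiors M h lo hi \<and>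
     (\<forall>e\<in>M. - R \<le> lo e \<and> hi e \<le> R \<and>
       (if e \<in> DL then lo e < a e \<and> (lo e = - R \<or> blocked M h lo hi e (lo e)) else lo e = a e) \<and>
       (if e \<in> DR then b e < hi e \<and> (hi e = R \<or> blocked M h lo hi e (hi e)) else hi e = b e))"

lemma extension_empty: "extension a b {} {}"
  unfolding extension_def disjoint_interiors_def using disjoint ab by fastforce

lemma finite_meeting:
  assumes "e \<in> M" "f \<in> M" "e \<noteq> f"
  shows "finite {x. h f x = h e x}"
proof -
  obtain c d c' d' where h: "\<And>x. h e x = c + d * x" "\<And>x. h f x = c' + d' * x" using affine_h by metis
  have ne: "h f (a e) \<noteq> h e (a e)" using generic[OF assms(2,1)] assms(3) by auto
  have "{x. h f x = h e x} \<subseteq> {(c - c') / (d' - d)}"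
  proof
    fix x assume "x \<in> {x. h f x = h e x}"
    then have eq: "(d' - d) * x = c - c'" by (simp add: h algebra_simps)
    have "d' \<noteq> d" using ne eq by (auto simp: h)
    then show "x \<in> {(c - c') / (d' - d)}" using eq by (simp add: field_simps)
  qed
  then show ?thesis by (rule finite_subset) simp
qed

text \<open>
  The left end of \<open>e\<close> is moved to the first meeting with another segment.  If that segment itself ends there, then
  it is in turn blocked by a third one, which serves to block \<open>e\<close>.
\<close>

lemma extend_left_end:
  assumes ext: "extension lo hi DL DR" and e: "e \<in> M" "e \<notin> DL"
  shows "\<exists>l. extension (lo(e := l)) hi (insert e DL) DR"
proof -
  have dis: "disjoint_interiors M h lo hi" using ext by (simp add: extension_def)
  have bnd: "- R \<le> lo f" "hi f \<le> R" "lo f \<le> a f" "b f \<le> hi f" if "f \<in> M" for f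
    using ext that unfolding extension_def by (auto split: if_splits)
  have loe: "lo e = a e" using ext e unfolding extension_def by auto
  \<comment> \<open>All meetings to the left of \<open>e\<close> inside the slab, including those at
    an end of \<open>f\<close>; the border \<open>- R\<close> serves if there is none.\<close>
  let ?C = "{x. - R \<le> x \<and> x < a e \<and> (\<exists>f\<in>M. f \<noteq> e \<and> lo f \<le> x \<and> x \<le> hi f \<and> h f x = h e x)}"
  have "?C \<subseteq> (\<Union>f\<in>M - {e}. {x. h f x = h e x})" by auto
  then have fin: "finite ?C"
    using finite_M finite_meeting[OF e(1)] by (auto intro: finite_subset)
  define l where "l = Max (insert (- R) ?C)"
  have l_in: "l \<in> insert (- R) ?C" unfolding l_def by (rule Max_in) (use fin in auto)
  have l_max: "x \<le> l" if "x \<in> ?C" for x unfolding l_def by (rule Max_ge) (use fin that in auto)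
  have l: "- R \<le> l" "l < a e" using l_in ab[OF e(1)] by auto
  let ?lo = "lo(e := l)"
  have lo_le: "?lo f \<le> lo f" for f using l loe by auto
  have mono: "blocked M h ?lo hi f x" if "blocked M h lo hi f x" for f x
    using that lo_le unfolding blocked_def by (meson le_less_trans)
  have stop: "l = - R \<or> blocked M h ?lo hi e l"
  proof (cases "l = - R")
    case False
    then obtain f where f: "f \<in> M" "f \<noteq> e" "lo f \<le> l" "l \<le> hi f" "h f l = h e l" using l_in by auto
    have via: "blocked M h ?lo hi e l" if B: "blocked M h lo hi f l"
    proof -
      obtain g where g: "g \<in> M" "lo g < l" "l < hi g" "h g l = h f l" using B unfolding blocked_def by blast
      then have "g \<noteq> e" using l loe by auto
      with g f(5) show ?thesis unfolding blocked_def by auto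
    qed
    consider "lo f < l" "l < hi f" | "l = lo f" | "l = hi f" using f by linarith
    then show ?thesis
    proof cases
      case 1
      then show ?thesis using f unfolding blocked_def by auto
    next
      case 2
      \<comment> \<open>By \<open>generic\<close> an original end is not on the line of
        \<open>e\<close>. The end of \<open>f\<close> has therefore been moved and, not being on the
        border, is blocked.\<close>
      have "f \<in> DL" using ext f 2 generic[OF e(1) f(1)] unfolding extension_def by (auto split: if_splits)
      then have "blocked M h lo hi f l" using ext f 2 False unfolding extension_def by auto
      then show ?thesis using via by simp
    next
      case 3
      have "f \<in> DR" using ext f 3 generic[OF e(1) f(1)] unfolding extension_def by (auto split: if_splits)
      moreover have "hi f \<noteq> R" using 3 l ab[OF e(1)] by auto
      ultimately have "blocked M h lo hi f l" using ext f 3 unfolding extension_def by auto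
      then show ?thesis using via by simp
    qed
  qed simp
  \<comment> \<open>Left of \<open>a e\<close> a meeting belongs to \<open>?C\<close> and is not
    beyond \<open>l\<close>; at \<open>a e\<close> there is none by \<open>generic\<close>; further
    right nothing has changed.\<close>
  have new: "x \<in> {l, hi e, lo f, hi f}"
    if f: "f \<in> M" "f \<noteq> e" and x: "l \<le> x" "x \<le> hi e" "lo f \<le> x" "x \<le> hi f" "h e x = h f x" for f x
  proof -
    consider "x = l" | "l < x" "x < a e" | "x = a e" | "a e < x" using x by linarith
    then show ?thesis
    proof cases
      case 2
      then have "x \<in> ?C" using f x l by auto
      then show ?thesis using l_max[of x] 2 by simp
    next
      case 3
      then show ?thesis using generic[OF f(1) e(1)] f x by auto
    next
      case 4
      then show ?thesis using dis f x loe e(1) unfolding disjoint_interiors_def by fastforce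
    qed simp
  qed
  have "disjoint_interiors M h ?lo hi"
    unfolding disjoint_interiors_def
  proof (intro ballI allI impI)
    fix f g x assume f: "f \<in> M" and g: "g \<in> M" and
      x: "f \<noteq> g \<and> x \<in> {?lo f..hi f} \<and> x \<in> {?lo g..hi g} \<and> h f x = h g x"
    show "x \<in> {?lo f, hi f, ?lo g, hi g}"
    proof (cases "f = e \<or> g = e")
      case True
      then show ?thesis using new[of g x] new[of f x] f g x by auto
    next
      case False
      then show ?thesis using dis f g x unfolding disjoint_interiors_def by simp
    qed
  qed
  moreover have "- R \<le> ?lo f \<and> hi f \<le> R \<and>
       (if f \<in> insert e DL then ?lo f < a f \<and> (?lo f = - R \<or> blocked M h ?lo hi f (?lo f)) else ?lo f = a f) \<and>
       (if f \<in> DR then b f < hi f \<and> (hi f = R \<or> blocked M h ?lo hi f (hi f)) else hi f = b f)" if f: "f \<in> M" for f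
  proof -
    have E: "(if f \<in> DL then lo f < a f \<and> (lo f = - R \<or> blocked M h lo hi f (lo f)) else lo f = a f)"
      "(if f \<in> DR then b f < hi f \<and> (hi f = R \<or> blocked M h lo hi f (hi f)) else hi f = b f)"
      using ext f unfolding extension_def by auto
    have "(if f \<in> DR then b f < hi f \<and> (hi f = R \<or> blocked M h ?lo hi f (hi f)) else hi f = b f)"
      using E(2) mono by (auto split: if_splits)
    moreover have "(if f \<in> insert e DL then ?lo f < a f \<and> (?lo f = - R \<or> blocked M h ?lo hi f (?lo f)) else ?lo f = a f)"
      using E(1) mono stop l by (cases "f = e") (auto split: if_splits)
    moreover have "- R \<le> ?lo f" using l bnd[OF f] by simp
    ultimately show ?thesis using bnd(2)[OF f] by blast
  qed
  ultimately have "extension ?lo hi (insert e DL) DR" unfolding extension_def by blast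
  then show ?thesis by blast
qed

lemma extend_left_ends:
  assumes "extension lo hi {} DR" "D \<subseteq> M"
  shows "\<exists>lo'. extension lo' hi D DR"
proof -
  have "finite D" using assms(2) finite_M finite_subset by blast
  then show ?thesis using assms(2)
  proof (induction D rule: finite_induct)
    case empty
    then show ?case using assms(1) by blast
  next
    case (insert e D)
    then show ?case using extend_left_end by (metis insert_subset)
  qed
qed

end

text \<open>The reflection \<open>x\<close> to \<open>- x\<close> exchanges left and right ends, so
  the construction for left ends also serves for right ends.\<close>

lemma segment_family_reflect:
  assumes "segment_family M h a b R"
  shows "segment_family M (\<lambda>e x. h e (- x)) (\<lambda>e. - b e) (\<lambda>e. - a e) R"
proof -
  interpret segment_family M h a b R by fact
  show ?thesis
  proof
    fix e show "\<exists>c d. \<forall>x. h e (- x) = c + d * x"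
      using affine_h[of e] by (metis mult_minus_left mult_minus_right)
  next
    fix e assume "e \<in> M"
    then show "- R < - b e \<and> - b e < - a e \<and> - a e < R" using ab[of e] by linarith
  qed (use finite_M disjoint generic in auto)
qed

lemma blocked_reflect:
  "blocked M (\<lambda>e x. h e (- x)) (\<lambda>e. - hi e) (\<lambda>e. - lo e) e (- x) = blocked M h lo hi e x"
  unfolding blocked_def by auto

lemma disjoint_interiors_reflect:
  assumes "disjoint_interiors M h lo hi"
  shows "disjoint_interiors M (\<lambda>e x. h e (- x)) (\<lambda>e. - hi e) (\<lambda>e. - lo e)"
  unfolding disjoint_interiors_def
proof (intro ballI allI impI)
  fix e f x assume "e \<in> M" "f \<in> M" "e \<noteq> f \<and> x \<in> {- hi e..- lo e} \<and> x \<in> {- hi f..- lo f} \<and> h e (- x) = h f (- x)"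
  then have "- x \<in> {lo e, hi e, lo f, hi f}"
    using assms unfolding disjoint_interiors_def by (auto simp del: insert_iff)
  then show "x \<in> {- hi e, - lo e, - hi f, - lo f}" by auto
qed

lemma extension_reflect:
  assumes "segment_family M h a b R" "segment_family.extension M h a b R lo hi DL DR"
  shows "segment_family.extension M (\<lambda>e x. h e (- x)) (\<lambda>e. - b e) (\<lambda>e. - a e) R (\<lambda>e. - hi e) (\<lambda>e. - lo e) DR DL"
  using assms(2) disjoint_interiors_reflect[of M h lo hi]
  unfolding segment_family.extension_def[OF assms(1)] segment_family.extension_def[OF segment_family_reflect[OF assms(1)]]
    blocked_reflect by (auto split: if_splits)

theorem (in segment_family) full_extension: "\<exists>lo hi. extension lo hi M M"
proof -
  interpret r: segment_family M "\<lambda>e x. h e (- x)" "\<lambda>e. - b e" "\<lambda>e. - a e" R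
    by (rule segment_family_reflect) unfold_locales
  have sf: "segment_family M h a b R" by unfold_locales
  obtain lo where "extension lo b M {}" using extend_left_ends[OF extension_empty] by blast
  from extension_reflect[OF sf this] obtain lo' where
    "r.extension lo' (\<lambda>e. - lo e) M M" using r.extend_left_ends by blast
  from extension_reflect[OF r.segment_family_axioms this] show ?thesis by auto
qed

section \<open>Convexity of the cells\<close>

text \<open>Twice the signed area of the triangle, positive for counterclockwise order.\<close>

definition cross :: "pt \<Rightarrow> pt \<Rightarrow> pt \<Rightarrow> real" where
  "cross p q r = (fst q - fst p) * (snd r - snd p) - (snd q - snd p) * (fst r - fst p)"

lemma cross_combination: "cross p q ((1 - t) *\<^sub>R z + t *\<^sub>R z') = (1 - t) * cross p q z + t * cross p q z'"
  by (simp add: cross_def algebra_simps)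

lemma cross_rotate: "cross q r p = cross p q r" "cross r p q = cross p q r"
  by (simp_all add: cross_def algebra_simps)

lemma cross_sum: "cross q r z + cross r p z + cross p q z = cross p q r"
  by (simp add: cross_def algebra_simps)

lemma barycentric_combination:
  assumes "cross p q r \<noteq> 0"
  shows "z = (cross q r z / cross p q r) *\<^sub>R p + (cross r p z / cross p q r) *\<^sub>R q + (cross p q z / cross p q r) *\<^sub>R r"
proof -
  have "cross p q r * fst z = cross q r z * fst p + cross r p z * fst q + cross p q z * fst r"
       "cross p q r * snd z = cross q r z * snd p + cross r p z * snd q + cross p q z * snd r"
    by (simp_all add: cross_def algebra_simps)
  then show ?thesis using assms by (simp add: prod_eq_iff field_simps)
qed

lemma collinear_of_cross_zero:
  assumes "cross p q r = 0"
  shows "collinear {p, q, r}"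
proof (cases "p = q")
  case True
  then show ?thesis by simp
next
  case False
  have "\<exists>c. r = p + c *\<^sub>R (q - p)"
  proof (cases "fst p = fst q")
    case True
    then have s: "snd q - snd p \<noteq> 0" using False by (simp add: prod_eq_iff)
    then have "r = p + ((snd r - snd p) / (snd q - snd p)) *\<^sub>R (q - p)"
      using assms True by (simp add: prod_eq_iff cross_def)
    then show ?thesis by blast
  next
    case False
    define k where "k = (fst r - fst p) / (fst q - fst p)"
    have "k * (fst q - fst p) = fst r - fst p" using False by (simp add: k_def)
    moreover have "k * (snd q - snd p) = snd r - snd p"
    proof -
      have "k * (snd q - snd p) = (fst q - fst p) * (snd r - snd p) / (fst q - fst p)"
        using assms by (simp add: k_def cross_def mult.commute)
      then show ?thesis using False by simp
    qed
    ultimately have "r = p + k *\<^sub>R (q - p)" by (simp add: prod_eq_iff)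
    then show ?thesis by blast
  qed
  then have "\<exists>c. r - p = c *\<^sub>R (q - p)" by (metis add_diff_cancel_left')
  then have "collinear {0, q - p, r - p}" by (auto simp: collinear_lemma)
  then have "collinear {q, p, r}" by (simp add: collinear_3)
  then show ?thesis by (simp add: insert_commute)
qed

locale arrangement =
  fixes M :: "'e set" and h :: "'e \<Rightarrow> real \<Rightarrow> real" and lo hi :: "'e \<Rightarrow> real" and R :: real
  assumes finite_M: "finite M"
    and affine_h: "\<And>e. \<exists>c d. \<forall>x. h e x = c + d * x"
    and lo_hi: "\<And>e. e \<in> M \<Longrightarrow> - R \<le> lo e \<and> lo e < hi e \<and> hi e \<le> R"
    and interiors: "disjoint_interiors M h lo hi"
    and left_end: "\<And>e. e \<in> M \<Longrightarrow> lo e = - R \<or> blocked M h lo hi e (lo e)"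
    and right_end: "\<And>e. e \<in> M \<Longrightarrow> hi e = R \<or> blocked M h lo hi e (hi e)"
    and distinct_lines: "\<And>e f. e \<in> M \<Longrightarrow> f \<in> M \<Longrightarrow> e \<noteq> f \<Longrightarrow> \<exists>x. h e x \<noteq> h f x"
begin

definition seg :: "'e \<Rightarrow> pt set" where
  "seg e = {z. lo e \<le> fst z \<and> fst z \<le> hi e \<and> snd z = h e (fst z)}"

definition free :: "pt set" where
  "free = {z. - R < fst z \<and> fst z < R \<and> (\<forall>e\<in>M. z \<notin> seg e)}"

text \<open>Cells will be the classes of this relation rather than connected components; its
  transitivity is the convexity of the cells.\<close>

definition vis :: "pt \<Rightarrow> pt \<Rightarrow> bool" where
  "vis p q \<longleftrightarrow> closed_segment p q \<subseteq> free"

lemma convex_seg: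
  assumes "z \<in> seg e" "z' \<in> seg e" "0 \<le> t" "t \<le> 1"
  shows "(1 - t) *\<^sub>R z + t *\<^sub>R z' \<in> seg e"
proof -
  obtain c d where h: "\<And>x. h e x = c + d * x" using affine_h by metis
  have "lo e \<le> (1 - t) * fst z + t * fst z'"
    using convex_bound_le[of "- fst z" "- lo e" "- fst z'" "1 - t" t] assms by (simp add: seg_def)
  moreover have "(1 - t) * fst z + t * fst z' \<le> hi e"
    using assms by (intro convex_bound_le) (auto simp: seg_def)
  ultimately show ?thesis using assms by (simp add: seg_def h algebra_simps)
qed

lemma interiors_meet:
  assumes "e \<in> M" "f \<in> M" "lo e < x" "x < hi e" "lo f < x" "x < hi f" "h e x = h f x"
  shows "e = f"
  using interiors assms unfolding disjoint_interiors_def by (metis atLeastAtMost_iff insertE less_irrefl less_imp_le singletonD)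

lemma closed_segment_cases:
  fixes p q r :: pt
  assumes "collinear {p, q, r}"
  shows "closed_segment p r \<subseteq> closed_segment p q \<union> closed_segment q r"
proof -
  consider "p \<in> closed_segment q r" | "q \<in> closed_segment r p" | "r \<in> closed_segment p q"
    using assms unfolding collinear_between_cases between_mem_segment by blast
  then show ?thesis
  proof cases
    case 1
    then show ?thesis using subset_closed_segment[of p r q r] by auto
  next
    case 2
    then show ?thesis using Un_closed_segment[of q p r] by (auto simp: closed_segment_commute)
  next
    case 3
    then show ?thesis using subset_closed_segment[of p r p q] by auto
  qed
qed

context
  fixes p q r :: pt and D :: real
  assumes D: "D = cross p q r" "D \<noteq> 0"
    and pq: "closed_segment p q \<subseteq> free" and qr: "closed_segment q r \<subseteq> free"
begin

definition "bp z = cross q r z / D"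
definition "bq z = cross r p z / D"
definition "br z = cross p q z / D"
definition "tri = {z. 0 \<le> bp z \<and> 0 \<le> bq z \<and> 0 \<le> br z}"

lemma b_sum: "bp z + bq z + br z = 1"
proof -
  have "cross q r z + cross r p z + cross p q z = D" unfolding D(1) by (rule cross_sum)
  then show ?thesis
    using D(2) unfolding bp_def bq_def br_def add_divide_distrib[symmetric] by simp
qed

lemma b_combination: "z = bp z *\<^sub>R p + bq z *\<^sub>R q + br z *\<^sub>R r"
proof -
  have "cross p q r \<noteq> 0" using D by simp
  from barycentric_combination[OF this, of z] show ?thesis unfolding bp_def bq_def br_def unfolding D(1) .
qed

lemma b_linear:
  "bp ((1 - t) *\<^sub>R z + t *\<^sub>R z') = (1 - t) * bp z + t * bp z'"
  "bq ((1 - t) *\<^sub>R z + t *\<^sub>R z') = (1 - t) * bq z + t * bq z'"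
  "br ((1 - t) *\<^sub>R z + t *\<^sub>R z') = (1 - t) * br z + t * br z'"
  by (simp_all only: bp_def bq_def br_def cross_combination add_divide_distrib times_divide_eq_right)

lemma side_free:
  assumes "z \<in> tri" "bp z = 0 \<or> br z = 0"
  shows "z \<in> free"
  using assms(2)
proof
  assume "br z = 0"
  then have "z = (1 - bq z) *\<^sub>R p + bq z *\<^sub>R q" "bq z \<le> 1"
    using b_combination[of z] b_sum[of z] assms(1) by (simp_all add: tri_def eq_diff_eq[symmetric])
  then have "z \<in> closed_segment p q" unfolding in_segment using assms(1) tri_def by blast
  then show ?thesis using pq by blast
next
  assume "bp z = 0"
  then have "z = (1 - br z) *\<^sub>R q + br z *\<^sub>R r" "br z \<le> 1"
    using b_combination[of z] b_sum[of z] assms(1) by (simp_all add: tri_def eq_diff_eq[symmetric])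
  then have "z \<in> closed_segment q r" unfolding in_segment using assms(1) tri_def by blast
  then show ?thesis using qr by blast
qed

text \<open>
  \<open>bp\<close>, \<open>bq\<close> and \<open>br\<close> are barycentric coordinates.  A segment inside the triangle can leave it only
  through the side \<open>p r\<close>, where \<open>bq\<close> vanishes, hence never in a direction in which \<open>bq\<close> does not decrease.
\<close>

lemma no_escape:
  assumes f: "f \<in> M" "z \<in> seg f" "z' \<in> seg f" and z: "z \<in> tri" and le: "bq z \<le> bq z'"
  shows "z' \<in> tri"
proof (rule ccontr)
  assume z': "z' \<notin> tri"
  define g where "g = (\<lambda>t. (1 - t) *\<^sub>R z + t *\<^sub>R z')"
  \<comment> \<open>\<open>m\<close> is nonnegative at \<open>z\<close> and not positive at
    \<open>z'\<close>. At a zero of \<open>m\<close> the segment meets one of the two free sides,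
    since \<open>bq\<close> stays nonnegative.\<close>
  define m where "m = (\<lambda>t. min (bp (g t)) (br (g t)))"
  have m: "m = (\<lambda>t. min ((1 - t) * bp z + t * bp z') ((1 - t) * br z + t * br z'))"
    by (simp add: m_def g_def b_linear)
  have "m 1 \<le> 0" using z' z le by (auto simp: m tri_def)
  moreover have "0 \<le> m 0" using z by (auto simp: m tri_def)
  moreover have "continuous_on {0..1} m" unfolding m by (intro continuous_intros)
  ultimately obtain t where t: "0 \<le> t" "t \<le> 1" "m t = 0" using IVT2'[of m 1 0 0] by auto
  have "0 \<le> bq (g t)"
  proof -
    have "0 \<le> bq z" using z by (simp add: tri_def)
    then show ?thesis using t le unfolding g_def b_linear by (intro add_nonneg_nonneg mult_nonneg_nonneg) auto
  qed
  then have "g t \<in> tri" "bp (g t) = 0 \<or> br (g t) = 0"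
    using t(3) by (auto simp: m_def tri_def min_def split: if_splits)
  then have "g t \<in> free" by (rule side_free)
  moreover have "g t \<in> seg f" unfolding g_def using convex_seg[OF f(2,3) t(1,2)] .
  ultimately show False using f(1) by (auto simp: free_def)
qed

lemma bq_along: "\<exists>c d. \<forall>x. bq (x, h f x) = c + d * x"
proof -
  obtain c d where h: "\<And>x. h f x = c + d * x" using affine_h by metis
  have "bq (x, h f x) = ((fst p - fst r) * (c - snd r) + (snd p - snd r) * fst r) / D
      + ((fst p - fst r) * d - (snd p - snd r)) / D * x" for x
    using D(2) by (simp add: bq_def cross_def h field_simps)
  then show ?thesis by blast
qed

definition ends :: "'e \<Rightarrow> pt set" where
  "ends e = {(lo e, h e (lo e)), (hi e, h e (hi e))}"

lemma ends_seg: "e \<in> M \<Longrightarrow> ends e \<subseteq> seg e"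
  using lo_hi[of e] by (auto simp: ends_def seg_def)

text \<open>\<open>bq\<close> is affine along \<open>f\<close>, so it does not decrease towards one
  of the ends, and by \<open>no_escape\<close> this end is still in the triangle.\<close>

lemma reach_end:
  assumes f: "f \<in> M" "z \<in> seg f" and z: "z \<in> tri"
  shows "\<exists>z'\<in>ends f. z' \<in> tri \<and> bq z \<le> bq z'"
proof -
  obtain c d where cd: "\<And>x. bq (x, h f x) = c + d * x" using bq_along by metis
  have zz: "z = (fst z, h f (fst z))" "lo f \<le> fst z" "fst z \<le> hi f" using f(2) by (auto simp: seg_def prod_eq_iff)
  have bz: "bq z = c + d * fst z" using cd[of "fst z"] zz(1) by simp
  have "\<exists>z'\<in>ends f. bq z \<le> bq z'"
  proof (cases "0 \<le> d")
    case True
    then show ?thesis using zz(3) by (auto simp: bz cd ends_def mult_left_mono)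
  next
    case False
    then show ?thesis using zz(2) by (auto simp: bz cd ends_def mult_left_mono_neg)
  qed
  then show ?thesis using no_escape[OF f _ z] ends_seg[OF f(1)] by blast
qed

text \<open>An affine function that is maximal at an interior point is constant. Ends outside the
  triangle are no exception: by \<open>no_escape\<close> their values are smaller.\<close>

lemma maximal_constant:
  assumes f: "f \<in> M" "lo f < x" "x < hi f" and z: "(x, h f x) \<in> tri"
    and max: "\<And>z'. z' \<in> ends f \<Longrightarrow> z' \<in> tri \<Longrightarrow> bq z' \<le> bq (x, h f x)"
  shows "bq (x', h f x') = bq (x, h f x)" "(lo f, h f (lo f)) \<in> tri"
proof -
  obtain c d where cd: "\<And>x. bq (x, h f x) = c + d * x" using bq_along by metis
  have s: "(x, h f x) \<in> seg f" using f by (simp add: seg_def)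
  have E: "bq z' \<le> bq (x, h f x)" if "z' \<in> ends f" for z'
    using max[OF that] no_escape[OF f(1) s _ z, of z'] ends_seg[OF f(1)] that by fastforce
  have "d * x \<ge> d * lo f" "d * x \<ge> d * hi f"
    using E[of "(lo f, h f (lo f))"] E[of "(hi f, h f (hi f))"] by (auto simp: ends_def cd)
  then have "d = 0" using f(2,3) by (metis mult_le_cancel_left not_less linorder_neqE_linordered_idom)
  then show eq: "bq (x', h f x') = bq (x, h f x)" for x' by (simp add: cd)
  show "(lo f, h f (lo f)) \<in> tri"
    using no_escape[OF f(1) s _ z] eq ends_seg[OF f(1)] by (metis ends_def insertI1 order_refl subsetD)
qed

lemma tri_slab:
  assumes "z \<in> tri"
  shows "- R < fst z" "fst z < R"
proof -
  have fr: "p \<in> free" "q \<in> free" "r \<in> free" using pq qr by auto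
  have fz: "fst z = bp z * fst p + bq z * fst q + br z * fst r"
    using arg_cong[OF b_combination[of z], of fst] by simp
  have nn: "0 \<le> bp z" "0 \<le> bq z" "0 \<le> br z" using assms by (auto simp: tri_def)
  define hi' where "hi' = max (fst p) (max (fst q) (fst r))"
  define lo' where "lo' = min (fst p) (min (fst q) (fst r))"
  have "bp z * fst p + bq z * fst q + br z * fst r \<le> bp z * hi' + bq z * hi' + br z * hi'"
    using nn by (intro add_mono mult_left_mono) (auto simp: hi'_def)
  also have "\<dots> = hi'" using b_sum[of z] by (metis distrib_right mult_1)
  also have "\<dots> < R" using fr by (auto simp: hi'_def free_def)
  finally show "fst z < R" using fz by simp
  have "- R < lo'" using fr by (auto simp: lo'_def free_def)
  also have "lo' = bp z * lo' + bq z * lo' + br z * lo'" using b_sum[of z] by (metis distrib_right mult_1)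
  also have "\<dots> \<le> bp z * fst p + bq z * fst q + br z * fst r"
    using nn by (intro add_mono mult_left_mono) (auto simp: lo'_def)
  finally show "- R < fst z" using fz by simp
qed

text \<open>
  Take an end inside the triangle for which \<open>bq\<close> is maximal.  The segment blocking it must be parallel to
  \<open>p r\<close>, and so must be the segment blocking the left end of the latter, which is absurd.
\<close>

lemma tri_free: "e \<in> M \<Longrightarrow> seg e \<inter> tri = {}"
proof (rule ccontr)
  assume e: "e \<in> M" and "seg e \<inter> tri \<noteq> {}"
  then obtain z where "z \<in> seg e" "z \<in> tri" by auto
  let ?X = "(\<Union>f\<in>M. ends f) \<inter> tri"
  have ne: "?X \<noteq> {}" using reach_end[OF e \<open>z \<in> seg e\<close> \<open>z \<in> tri\<close>] e by auto
  have fin: "finite ?X" using finite_M by (auto simp: ends_def)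
  have "Max (bq ` ?X) \<in> bq ` ?X" by (rule Max_in) (use fin ne in auto)
  then obtain w where w: "w \<in> ?X" "Max (bq ` ?X) = bq w" by (rule imageE) simp
  have wmax: "bq z \<le> bq w" if "z \<in> ?X" for z
    unfolding w(2)[symmetric] by (rule Max_ge) (use fin that in auto)
  obtain f0 where f0: "f0 \<in> M" "w \<in> ends f0" and wt: "w \<in> tri" using w(1) by auto
  have "blocked M h lo hi f0 (fst w)" "snd w = h f0 (fst w)"
    using left_end[OF f0(1)] right_end[OF f0(1)] tri_slab[OF wt] f0(2) by (auto simp: ends_def)
  then obtain f where f: "f \<in> M" "lo f < fst w" "fst w < hi f" "w = (fst w, h f (fst w))"
    by (auto simp: blocked_def prod_eq_iff)
  define x where "x = fst w"
  have fx: "(x, h f x) \<in> tri" "bq (x, h f x) = bq w" using wt f(4) by (simp_all add: x_def)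
  have emax: "bq z \<le> bq w" if "z \<in> ends g" "z \<in> tri" "g \<in> M" for z g using wmax[of z] that by blast
  have fc: "bq (x', h f x') = bq w" for x'
    using maximal_constant(1)[of f x x'] f(1-3) fx emax[OF _ _ f(1)] by (simp add: x_def)
  have fl: "(lo f, h f (lo f)) \<in> tri"
    using maximal_constant(2)[of f x] f(1-3) fx emax[OF _ _ f(1)] by (simp add: x_def)
  define y where "y = lo f"
  have "blocked M h lo hi f y" using left_end[OF f(1)] tri_slab[OF fl] by (auto simp: y_def)
  then obtain g where g: "g \<in> M" "g \<noteq> f" "lo g < y" "y < hi g" "h g y = h f y"
    unfolding blocked_def by blast
  have gc: "bq (x', h g x') = bq w" for x'
    using maximal_constant(1)[of g y x'] g fl fc[of y] emax[OF _ _ g(1)] by (simp add: y_def)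
  \<comment> \<open>The segment \<open>f\<close> is the graph of a function, so \<open>p r\<close>,
    being parallel to it, is not vertical.\<close>
  have pr: "fst p \<noteq> fst r"
  proof
    assume eq: "fst p = fst r"
    have "bq (0, h f 0) = bq (1, h f 1)" by (simp only: fc)
    then have "cross r p (0, h f 0) = cross r p (1, h f 1)" using D(2) by (simp add: bq_def)
    then have "snd p = snd r" using eq by (simp add: cross_def algebra_simps)
    then have "D = 0" using eq D(1) by (simp add: cross_def)
    then show False using D(2) by simp
  qed
  \<comment> \<open>Both segments lie on one level line of \<open>bq\<close> and overlap just to the
    right of \<open>y\<close>, against the disjointness of interiors.\<close>
  have same: "h f x' = h g x'" for x'
  proof -
    have "bq (x', h f x') = bq (x', h g x')" by (simp only: fc gc)
    then show ?thesis using pr D(2) by (simp add: bq_def cross_def)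
  qed
  define m where "m = (y + min (hi f) (hi g)) / 2"
  have "lo f < m" "m < hi f" "lo g < m" "m < hi g" using g f lo_hi[OF f(1)] by (auto simp: m_def y_def min_def)
  then have "f = g" using interiors_meet[OF f(1) g(1)] same by blast
  then show False using g(2) by simp
qed

lemma third_side_free: "closed_segment p r \<subseteq> free"
proof
  fix z assume "z \<in> closed_segment p r"
  then obtain u where u: "0 \<le> u" "u \<le> 1" "z = (1 - u) *\<^sub>R p + u *\<^sub>R r" by (auto simp: in_segment)
  have p: "bp p = 1" "bq p = 0" "br p = 0" and r: "bp r = 0" "bq r = 0" "br r = 1"
    using D by (simp_all add: bp_def bq_def br_def cross_def algebra_simps)
  have "z \<in> tri" using u by (simp add: tri_def b_linear p r)
  then show "z \<in> free" using tri_slab[of z] tri_free by (auto simp: free_def)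
qed

end

text \<open>A proper triangle with two free sides contains no part of a segment, so its third side
  is free. In the collinear case the third side is covered by the other two.\<close>

lemma vis_trans:
  assumes "vis p q" "vis q r"
  shows "vis p r"
proof (cases "cross p q r = 0")
  case True
  then show ?thesis
    using closed_segment_cases[OF collinear_of_cross_zero] assms unfolding vis_def by blast
next
  case False
  then show ?thesis using third_side_free[OF refl False] assms unfolding vis_def by blast
qed

lemma vis_sym: "vis p q \<Longrightarrow> vis q p"
  by (simp add: vis_def closed_segment_commute)

lemma vis_refl: "vis p p \<longleftrightarrow> p \<in> free"
  by (simp add: vis_def)

end

section \<open>The number of cells\<close>

context arrangement
begin

definition cell :: "pt \<Rightarrow> pt set" where
  "cell u = {v. vis u v}"

lemma h_continuous: "continuous_on A (h e)" "continuous (at x within A) (h e)"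
proof -
  obtain c d where "\<And>x. h e x = c + d * x" using affine_h by metis
  then have "h e = (\<lambda>x. c + d * x)" by auto
  then show "continuous_on A (h e)" "continuous (at x within A) (h e)"
    by (auto intro!: continuous_intros)
qed

lemma closed_seg: "closed (seg e)"
proof -
  have c: "continuous_on UNIV (\<lambda>z::pt. h e (fst z))"
    by (rule continuous_on_compose2[OF h_continuous(1)[of UNIV]]) (auto intro: continuous_intros)
  show ?thesis
    unfolding seg_def by (intro closed_Collect_conj closed_Collect_le closed_Collect_eq c continuous_intros)
qed

lemma open_free: "open free"
proof -
  have "free = {z. - R < fst z} \<inter> {z. fst z < R} \<inter> - (\<Union>e\<in>M. seg e)" by (auto simp: free_def)
  moreover have "closed (\<Union>e\<in>M. seg e)" using finite_M closed_seg by auto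
  ultimately show ?thesis
    by (simp only: open_Int open_Collect_less continuous_on_fst continuous_on_id continuous_on_const open_Compl)
qed

lemma vis_free: "vis u v \<Longrightarrow> u \<in> free" "vis u v \<Longrightarrow> v \<in> free"
  by (auto simp: vis_def)

lemma cell_self: "u \<in> free \<Longrightarrow> u \<in> cell u"
  by (simp add: cell_def vis_refl)

lemma cell_free: "cell u \<subseteq> free"
  using vis_free(2) unfolding cell_def by blast

lemma cell_eq: "v \<in> cell u \<Longrightarrow> cell v = cell u"
  unfolding cell_def using vis_trans vis_sym by blast

lemma convex_subset_cell:
  assumes "convex T" "T \<subseteq> free" "v \<in> T" "v \<in> cell u"
  shows "T \<subseteq> cell u"
proof
  fix w assume "w \<in> T"
  then have "vis v w" using assms(1-3) unfolding vis_def by (meson closed_segment_subset order_trans)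
  then show "w \<in> cell u" using assms(4) vis_trans by (auto simp: cell_def)
qed

lemma convex_cell: "convex (cell u)"
  unfolding convex_contains_segment
proof (intro ballI)
  fix v w assume "v \<in> cell u" "w \<in> cell u"
  then have vw: "vis v w" unfolding cell_def using vis_trans vis_sym by blast
  have "closed_segment v w \<subseteq> cell u"
    by (rule convex_subset_cell[OF convex_closed_segment _ ends_in_segment(1) \<open>v \<in> cell u\<close>])
      (use vw in \<open>simp add: vis_def\<close>)
  then show "closed_segment v w \<subseteq> cell u" .
qed

lemma ball_subset_cell:
  assumes "v \<in> cell u"
  shows "\<exists>d>0. ball v d \<subseteq> cell u"
proof -
  obtain d where "d > 0" "ball v d \<subseteq> free" using open_free cell_free assms open_contains_ball by blast
  then show ?thesis using convex_subset_cell[OF convex_ball, of v d v u] assms by auto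
qed

text \<open>
  A cell not reaching the left border has a leftmost point, which is the left end of some segment \<open>g\<close>, blocked there by
  \<open>through g\<close>; near this end the cell is adjacent to \<open>g\<close> on the side of \<open>through g\<close>, and so it is
  determined by \<open>g\<close>.  A cell reaching the left border is determined by the segment below it, if any.
\<close>

definition through :: "'e \<Rightarrow> 'e" where
  "through g = (SOME k. k \<in> M \<and> k \<noteq> g \<and> lo k < lo g \<and> lo g < hi k \<and> h k (lo g) = h g (lo g))"

definition labels_below :: "'e \<Rightarrow> bool" where
  "labels_below g \<longleftrightarrow> lo g \<noteq> - R \<and> (\<forall>\<^sub>F x in at_right (lo g). h (through g) x < h g x)"

text \<open>A label fixes a germ: abscissas just right of the left end or border, then ordinates
  next to \<open>g\<close>, or far down for \<open>None\<close>. Two cells with the same germ share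
  a point. On the border a segment labels the cell above it.\<close>

fun labelled :: "pt set \<Rightarrow> 'e option \<Rightarrow> bool" where
  "labelled C None \<longleftrightarrow> (\<forall>\<^sub>F x in at_right (- R). \<forall>\<^sub>F y in at_bot. (x, y) \<in> C)"
| "labelled C (Some g) \<longleftrightarrow> (\<forall>\<^sub>F x in at_right (lo g).
     \<forall>\<^sub>F y in (if labels_below g then at_left (h g x) else at_right (h g x)). (x, y) \<in> C)"

lemma through_eq:
  assumes "g \<in> M" "k \<in> M" "k \<noteq> g" "lo k < lo g" "lo g < hi k" "h k (lo g) = h g (lo g)"
  shows "through g = k"
proof -
  have "through g \<in> M \<and> through g \<noteq> g \<and> lo (through g) < lo g \<and> lo g < hi (through g) \<and> h (through g) (lo g) = h g (lo g)"
    unfolding through_def by (rule someI[of _ k]) (use assms in auto)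
  then show ?thesis using interiors_meet[of "through g" k "lo g"] assms by auto
qed

lemma nested_eventually_unique:
  assumes "\<forall>\<^sub>F x in at_right (a::real). \<forall>\<^sub>F y in F x. P x (y::real)" "\<forall>\<^sub>F x in at_right a. \<forall>\<^sub>F y in F x. Q x y"
    and "\<And>x. F x \<noteq> bot"
  shows "\<exists>x y. P x y \<and> Q x y"
proof -
  have "\<forall>\<^sub>F x in at_right a. \<exists>y. P x y \<and> Q x y"
    using assms(1,2)
  proof eventually_elim
    case (elim x)
    then have "\<forall>\<^sub>F y in F x. P x y \<and> Q x y" by (rule eventually_conj)
    then show ?case using eventually_happens[of _ "F x"] assms(3) by blast
  qed
  then show ?thesis using eventually_happens[of _ "at_right a"] trivial_limit_at_right_real by blast
qed

lemma labelled_unique: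
  assumes "labelled (cell u) l" "labelled (cell v) l"
  shows "cell u = cell v"
proof -
  have "\<exists>x y. (x, y) \<in> cell u \<and> (x, y) \<in> cell v"
  proof (cases l)
    case None
    then show ?thesis
      using nested_eventually_unique[where a = "- R" and F = "\<lambda>x. at_bot" and P = "\<lambda>x y. (x, y) \<in> cell u" and Q = "\<lambda>x y. (x, y) \<in> cell v"] assms by simp
  next
    case (Some g)
    then show ?thesis
      using nested_eventually_unique[where a = "lo g"
          and F = "\<lambda>x. if labels_below g then at_left (h g x) else at_right (h g x)"
          and P = "\<lambda>x y. (x, y) \<in> cell u" and Q = "\<lambda>x y. (x, y) \<in> cell v"] assms
      by (simp add: trivial_limit_at_left_real trivial_limit_at_right_real split: if_splits)
  qed
  then show ?thesis using cell_eq by metis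
qed

text \<open>Different lines are ordered by their values at \<open>x0\<close> or, if these agree, by
  their slopes.\<close>

lemma eventually_order:
  assumes "e \<in> M" "f \<in> M" "e \<noteq> f"
  shows "(\<forall>\<^sub>F x in at_right x0. h e x < h f x) \<or> (\<forall>\<^sub>F x in at_right x0. h f x < h e x)"
proof -
  obtain c d c' d' where h: "\<And>x. h e x = c + d * x" "\<And>x. h f x = c' + d' * x" using affine_h by metis
  define k where "k = c - c' + (d - d') * x0"
  have diff: "h e x - h f x = k + (d - d') * (x - x0)" for x by (simp add: h k_def algebra_simps)
  have lim: "((\<lambda>x. h e x - h f x) \<longlongrightarrow> k) (at_right x0)"
    unfolding diff by (auto intro!: tendsto_eq_intros)
  have gt: "\<forall>\<^sub>F x in at_right x0. x0 < x" by (rule eventually_at_right_less)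
  consider "k < 0" | "k > 0" | "k = 0" "d < d'" | "k = 0" "d' < d" | "k = 0" "d = d'" by linarith
  then show ?thesis
  proof cases
    case 1
    then show ?thesis using order_tendstoD(2)[OF lim 1] by simp
  next
    case 2
    then show ?thesis using order_tendstoD(1)[OF lim 2] by simp
  next
    case 3
    then have "\<forall>\<^sub>F x in at_right x0. h e x < h f x"
      using gt diff by (auto elim!: eventually_mono) (smt (verit) mult_neg_pos)
    then show ?thesis ..
  next
    case 4
    then have "\<forall>\<^sub>F x in at_right x0. h f x < h e x"
      using gt diff by (auto elim!: eventually_mono) (smt (verit) mult_pos_pos)
    then show ?thesis ..
  next
    case 5
    then show ?thesis using diff distinct_lines[OF assms] by simp
  qed
qed

definition active :: "real \<Rightarrow> 'e set" where
  "active x0 = {e \<in> M. lo e \<le> x0 \<and> x0 < hi e}"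

text \<open>Finitely many segments have finitely many ends and pairwise orders, so all of these are
  constant in a common strip just right of \<open>x0\<close>.\<close>

lemma germ_structure:
  "\<exists>b>x0. \<forall>x. x0 < x \<and> x < b \<longrightarrow> (\<forall>e\<in>M. lo e \<le> x \<and> x \<le> hi e \<longleftrightarrow> e \<in> active x0) \<and>
     (\<forall>e\<in>M. \<forall>f\<in>M. \<forall>x'. x0 < x' \<and> x' < b \<and> h e x < h f x \<longrightarrow> h e x' < h f x')"
proof -
  have gt: "\<forall>\<^sub>F x in at_right x0. x0 < x" by (rule eventually_at_right_less)
  have lt: "\<forall>\<^sub>F x in at_right x0. x < c" if "x0 < c" for c
    using that by (auto simp: eventually_at_right)
  have act: "\<forall>\<^sub>F x in at_right x0. lo e \<le> x \<and> x \<le> hi e \<longleftrightarrow> e \<in> active x0" if "e \<in> M" for e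
  proof -
    consider "x0 < lo e" | "lo e \<le> x0" "x0 < hi e" | "hi e \<le> x0" by linarith
    then show ?thesis
    proof cases
      case 1
      show ?thesis using lt[OF 1] by eventually_elim (use 1 in \<open>auto simp: active_def\<close>)
    next
      case 2
      show ?thesis using gt lt[OF 2(2)] by eventually_elim (use 2 that in \<open>auto simp: active_def\<close>)
    next
      case 3
      show ?thesis using gt by eventually_elim (use 3 in \<open>auto simp: active_def\<close>)
    qed
  qed
  define less where "less = (\<lambda>e f. \<forall>\<^sub>F x in at_right x0. h e x < h f x)"
  have ord: "\<forall>\<^sub>F x in at_right x0. h e x < h f x \<longleftrightarrow> less e f" if ef: "e \<in> M" "f \<in> M" for e f
  proof (cases "e = f")
    case True
    then show ?thesis
      by (auto simp: less_def trivial_limit_at_right_real)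
  next
    case False
    show ?thesis
    proof (cases "less e f")
      case True
      then show ?thesis by (auto simp: less_def elim: eventually_mono)
    next
      case F: False
      then have "\<forall>\<^sub>F x in at_right x0. h f x < h e x" using eventually_order[OF ef False] by (auto simp: less_def)
      then show ?thesis by eventually_elim (use F in auto)
    qed
  qed
  have "\<forall>\<^sub>F x in at_right x0. (\<forall>e\<in>M. lo e \<le> x \<and> x \<le> hi e \<longleftrightarrow> e \<in> active x0) \<and> (\<forall>e\<in>M. \<forall>f\<in>M. h e x < h f x \<longleftrightarrow> less e f)"
    using act ord finite_M by (intro eventually_conj eventually_ball_finite ballI) auto
  then obtain b where "b > x0" and b: "\<And>x. x0 < x \<Longrightarrow> x < b \<Longrightarrow>
      (\<forall>e\<in>M. lo e \<le> x \<and> x \<le> hi e \<longleftrightarrow> e \<in> active x0) \<and> (\<forall>e\<in>M. \<forall>f\<in>M. h e x < h f x \<longleftrightarrow> less e f)"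
    unfolding eventually_at_right_field by blast
  then show ?thesis by (intro exI[of _ b]) blast
qed

lemma gap_avoiding_finite:
  fixes L U F :: "real set"
  assumes fin: "finite L" "finite U" "finite F" and lt: "\<And>l u. l \<in> L \<Longrightarrow> u \<in> U \<Longrightarrow> l < u"
  shows "\<exists>y. (\<forall>l\<in>L. l < y) \<and> (\<forall>u\<in>U. y < u) \<and> y \<notin> F"
proof -
  define p where "p = (if L = {} then (if U = {} then 0 else Min U - 1) else Max L)"
  define q where "q = (if U = {} then p + 1 else Min U)"
  have "p < q"
  proof (cases "U = {} \<or> L = {}")
    case False
    then have "Max L \<in> L" "Min U \<in> U" using fin by auto
    then show ?thesis using False lt by (auto simp: p_def q_def)
  qed (auto simp: p_def q_def)
  then have "infinite ({p<..<q} - F)" using fin(3) by (simp add: infinite_Ioo)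
  then obtain y where y: "p < y" "y < q" "y \<notin> F" by (metis Diff_iff finite.emptyI greaterThanLessThan_iff ex_in_conv)
  have "l \<le> p" if "l \<in> L" for l using that fin by (auto simp: p_def)
  moreover have "q \<le> u" if "u \<in> U" for u using that fin by (auto simp: q_def)
  ultimately have "(\<forall>l\<in>L. l < y) \<and> (\<forall>u\<in>U. y < u) \<and> y \<notin> F"
    using y by (meson le_less_trans less_le_trans)
  then show ?thesis ..
qed

lemma h_le_limit:
  assumes "x0 < b" "\<And>x. x0 < x \<Longrightarrow> x < b \<Longrightarrow> h e x \<le> h f x"
  shows "h e x0 \<le> h f x0"
proof (rule tendsto_le[OF trivial_limit_at_right_real])
  show "(h e \<longlongrightarrow> h e x0) (at_right x0)" "(h f \<longlongrightarrow> h f x0) (at_right x0)"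
    using h_continuous(2) by (auto simp: continuous_within)
  show "\<forall>\<^sub>F x in at_right x0. h e x \<le> h f x"
    unfolding eventually_at_right_field using assms by blast
qed


lemma eventually_at_right_less_bound: "(a::real) < c \<Longrightarrow> \<forall>\<^sub>F y in at_right a. y < c"
  by (auto simp: eventually_at_right)

lemma eventually_at_left_greater_bound: "(c::real) < a \<Longrightarrow> \<forall>\<^sub>F y in at_left a. c < y"
  by (auto simp: eventually_at_left)

text \<open>Just right of its least abscissa \<open>x0\<close> the cell fills the strip between the
  active segments below it (\<open>L\<close>) and above it (\<open>U\<close>). If \<open>x0\<close>
  is not on the border, the top of \<open>L\<close> and the bottom of \<open>U\<close> must meet
  over \<open>x0\<close>, and one of them begins there.\<close>

lemma label_exists:
  assumes u: "u \<in> free"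
  shows "\<exists>l\<in>insert None (Some ` M). labelled (cell u) l"
proof -
  define C where "C = cell u"
  define x0 where "x0 = Inf (fst ` C)"
  have uC: "u \<in> C" unfolding C_def by (rule cell_self[OF u])
  have slab: "- R < fst z" "fst z < R" if "z \<in> C" for z
    using subsetD[OF cell_free that[unfolded C_def]] by (simp_all add: free_def)
  have bdd: "bdd_below (fst ` C)" by (rule bdd_belowI2[of _ "- R"]) (use slab in force)
  have low: "x0 \<le> fst z" if "z \<in> C" for z unfolding x0_def using bdd that by (intro cInf_lower) auto
  have R0: "- R \<le> x0" unfolding x0_def using uC slab by (intro cInf_greatest) (auto intro: less_imp_le)
  \<comment> \<open>The cell is open, so the infimum is not attained.\<close>
  have strict: "x0 < fst z" if z: "z \<in> C" for z
  proof -
    obtain d where d: "d > 0" "ball z d \<subseteq> C" using ball_subset_cell z unfolding C_def by blast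
    have "(fst z - d / 2, snd z) \<in> ball z d" using d(1) by (cases z) (auto simp: dist_prod_def dist_real_def)
    then have "x0 \<le> fst z - d / 2" using low d(2) by fastforce
    then show ?thesis using d(1) by simp
  qed
  obtain b0 where b0: "x0 < b0" and
    act: "\<And>x e. x0 < x \<Longrightarrow> x < b0 \<Longrightarrow> e \<in> M \<Longrightarrow> lo e \<le> x \<and> x \<le> hi e \<longleftrightarrow> e \<in> active x0" and
    ord: "\<And>x x' e f. x0 < x \<Longrightarrow> x < b0 \<Longrightarrow> e \<in> M \<Longrightarrow> f \<in> M \<Longrightarrow> x0 < x' \<Longrightarrow> x' < b0 \<Longrightarrow> h e x < h f x \<Longrightarrow> h e x' < h f x'"
    using germ_structure[of x0] by blast
  define b where "b = min b0 (fst u)"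
  have b: "x0 < b" "b \<le> b0" "b \<le> fst u" using b0 strict[OF uC] by (auto simp: b_def)
  define x1 where "x1 = (x0 + b) / 2"
  have x1: "x0 < x1" "x1 < b" using b by (auto simp: x1_def)
  obtain y1 where y1: "(x1, y1) \<in> C"
  proof -
    have "\<exists>c\<in>C. fst c < x1"
      using x1(1) uC unfolding x0_def by (subst (asm) cInf_less_iff) (use bdd in auto)
    then obtain c where c: "c \<in> C" "fst c < x1" by blast
    define t where "t = (x1 - fst c) / (fst u - fst c)"
    have t: "0 \<le> t" "t \<le> 1" "t * (fst u - fst c) = x1 - fst c" using c x1 b by (auto simp: t_def)
    have "(1 - t) *\<^sub>R c + t *\<^sub>R u \<in> C"
      using convex_cell[of u] c(1) uC t(1,2) unfolding C_def by (auto intro: convexD)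
    moreover have "fst ((1 - t) *\<^sub>R c + t *\<^sub>R u) = x1" using t(3) by (simp add: algebra_simps)
    ultimately have "(x1, snd ((1 - t) *\<^sub>R c + t *\<^sub>R u)) \<in> C" by (metis prod.collapse)
    then show ?thesis by (rule that)
  qed
  define L where "L = {e \<in> active x0. h e x1 < y1}"
  define U where "U = {e \<in> active x0. y1 < h e x1}"
  have AM: "e \<in> M" "lo e \<le> x0" "x0 < hi e" if "e \<in> active x0" for e using that by (auto simp: active_def)
  have LM: "e \<in> M" "e \<in> active x0" if "e \<in> L" for e using that AM by (auto simp: L_def)
  have UM: "e \<in> M" "e \<in> active x0" if "e \<in> U" for e using that AM by (auto simp: U_def)
  have fin: "finite L" "finite U" using finite_M LM UM by (auto intro: finite_subset)
  have cover: "e \<in> L \<or> e \<in> U" if "e \<in> active x0" for e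
  proof -
    have "lo e \<le> x1" "x1 \<le> hi e" using act[of x1 e] that AM[OF that] x1 b by auto
    moreover have "(x1, y1) \<notin> seg e" using y1 cell_free AM[OF that] unfolding C_def free_def by blast
    ultimately have "y1 \<noteq> h e x1" by (simp add: seg_def)
    then show ?thesis using that by (auto simp: L_def U_def)
  qed
  have LU: "h e x < h f x" if "e \<in> L" "f \<in> U" "x0 < x" "x < b" for e f x
  proof (rule ord[of x1])
    show "h e x1 < h f x1" using that(1,2) by (simp add: L_def U_def)
  qed (use that x1 b LM(1) UM(1) in simp_all)
  \<comment> \<open>The piece of the strip around \<open>(x1, y1)\<close>. It is convex and free,
    hence part of the cell.\<close>
  define T where "T = {z. x0 < fst z \<and> fst z < b \<and> (\<forall>e\<in>L. h e (fst z) < snd z) \<and> (\<forall>e\<in>U. snd z < h e (fst z))}"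
  have T_convex: "convex T"
  proof (rule convexI)
    fix z z' and s t :: real assume z: "z \<in> T" "z' \<in> T" and st: "0 \<le> s" "0 \<le> t" "s + t = 1"
    have cc: "s * a + t * a' < s * c + t * c'" if "a < c" "a' < c'" for a a' c c' :: real
    proof (cases "s = 0")
      case True
      then show ?thesis using st that by simp
    next
      case False
      then show ?thesis using st that by (intro add_less_le_mono mult_strict_left_mono mult_left_mono) auto
    qed
    have hc: "h e (s * fst z + t * fst z') = s * h e (fst z) + t * h e (fst z')" for e
    proof -
      obtain c d where "\<And>x. h e x = c + d * x" using affine_h by metis
      moreover have "c = s * c + t * c" using st(3) by (metis distrib_right mult_1)
      ultimately show ?thesis by (simp add: algebra_simps)
    qed
    have xx: "x0 = s * x0 + t * x0" "b = s * b + t * b" using st(3) by (metis distrib_right mult_1)+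
    have "x0 < s * fst z + t * fst z'" using cc[of x0 "fst z" x0 "fst z'"] z xx(1) by (simp add: T_def)
    moreover have "s * fst z + t * fst z' < b" using cc[of "fst z" b "fst z'" b] z xx(2) by (simp add: T_def)
    ultimately show "s *\<^sub>R z + t *\<^sub>R z' \<in> T"
      using z by (auto simp: T_def hc intro!: cc)
  qed
  have bR: "b < R" using b(3) slab(2)[OF uC] by simp
  have T_free: "T \<subseteq> free"
  proof
    fix z assume z: "z \<in> T"
    then have x: "x0 < fst z" "fst z < b" by (auto simp: T_def)
    have "z \<notin> seg e" if "e \<in> M" for e
    proof
      assume "z \<in> seg e"
      then have s: "lo e \<le> fst z" "fst z \<le> hi e" "snd z = h e (fst z)" by (auto simp: seg_def)
      then have "e \<in> active x0" using act[of "fst z" e] x b that by auto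
      then show False using cover[of e] z s(3) by (auto simp: T_def)
    qed
    then show "z \<in> free" using x R0 bR by (auto simp: free_def)
  qed
  have "(x1, y1) \<in> T" using x1 by (auto simp: T_def L_def U_def)
  then have TC: "T \<subseteq> C" unfolding C_def using convex_subset_cell[OF T_convex T_free] y1 by (simp add: C_def)
  have atT: "\<forall>\<^sub>F x in at_right x0. P x" if "\<And>x. x0 < x \<Longrightarrow> x < b \<Longrightarrow> P x" for P
    unfolding eventually_at_right_field using b(1) that by blast
  have above: "\<forall>\<^sub>F y in at_right (h e x). (x, y) \<in> C"
    if e: "e \<in> L" "\<And>e'. e' \<in> L \<Longrightarrow> h e' x \<le> h e x" and x: "x0 < x" "x < b" for e x
  proof -
    have "\<forall>\<^sub>F y in at_right (h e x). \<forall>f\<in>U. y < h f x"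
      using LU[OF e(1) _ x] by (intro eventually_ball_finite fin ballI) (blast intro: eventually_at_right_less_bound)
    moreover have "\<forall>\<^sub>F y in at_right (h e x). h e x < y" by (rule eventually_at_right_less)
    ultimately show ?thesis
    proof eventually_elim
      case (elim y)
      then have "(x, y) \<in> T" using e(2) x by (fastforce simp: T_def)
      then show ?case using TC by blast
    qed
  qed
  have below: "\<forall>\<^sub>F y in at_left (h f x). (x, y) \<in> C"
    if f: "f \<in> U" "\<And>f'. f' \<in> U \<Longrightarrow> h f x \<le> h f' x" and x: "x0 < x" "x < b" for f x
  proof -
    have "\<forall>\<^sub>F y in at_left (h f x). \<forall>e\<in>L. h e x < y"
      using LU[OF _ f(1) x] by (intro eventually_ball_finite fin ballI) (blast intro: eventually_at_left_greater_bound)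
    moreover have "\<forall>\<^sub>F y in at_left (h f x). y < h f x" by (rule eventually_at_leftI[of "h f x - 1"]) auto
    ultimately show ?thesis
    proof eventually_elim
      case (elim y)
      then have "(x, y) \<in> T" using f(2) x by (fastforce simp: T_def)
      then show ?case using TC by blast
    qed
  qed
  have topL: "\<exists>e\<in>L. \<forall>e'\<in>L. \<forall>x. x0 < x \<and> x < b \<longrightarrow> h e' x \<le> h e x" if ne: "L \<noteq> {}"
  proof -
    have "Max ((\<lambda>e. h e x1) ` L) \<in> (\<lambda>e. h e x1) ` L" using fin ne by (intro Max_in) auto
    then obtain e where e: "e \<in> L" "h e x1 = Max ((\<lambda>e. h e x1) ` L)" by auto
    have "h e' x \<le> h e x" if "e' \<in> L" "x0 < x" "x < b" for e' x
    proof (rule ccontr)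
      assume "\<not> ?thesis"
      then have "h e x1 < h e' x1" using ord[of x e e' x1] that e(1) LM x1 b by auto
      moreover have "h e' x1 \<le> h e x1" unfolding e(2) using fin that by (intro Max_ge) auto
      ultimately show False by simp
    qed
    then show ?thesis using e(1) by blast
  qed
  have botU: "\<exists>f\<in>U. \<forall>f'\<in>U. \<forall>x. x0 < x \<and> x < b \<longrightarrow> h f x \<le> h f' x" if ne: "U \<noteq> {}"
  proof -
    have "Min ((\<lambda>e. h e x1) ` U) \<in> (\<lambda>e. h e x1) ` U" using fin ne by (intro Min_in) auto
    then obtain f where f: "f \<in> U" "h f x1 = Min ((\<lambda>e. h e x1) ` U)" by auto
    have "h f x \<le> h f' x" if "f' \<in> U" "x0 < x" "x < b" for f' x
    proof (rule ccontr)
      assume "\<not> ?thesis"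
      then have "h f' x1 < h f x1" using ord[of x f' f x1] that f(1) UM x1 b by auto
      moreover have "h f x1 \<le> h f' x1" unfolding f(2) using fin that by (intro Min_le) auto
      ultimately show False by simp
    qed
    then show ?thesis using f(1) by blast
  qed
  show ?thesis
  proof (cases "x0 = - R")
    case True
    show ?thesis
    proof (cases "L = {}")
      case LE: True
      have "\<forall>\<^sub>F y in at_bot. (x, y) \<in> C" if x: "x0 < x" "x < b" for x
      proof -
        have "\<forall>\<^sub>F y in at_bot. \<forall>e\<in>U. y < h e x"
          by (intro eventually_ball_finite fin ballI eventually_gt_at_bot)
        then show ?thesis
          by eventually_elim (use x LE TC in \<open>auto simp: T_def\<close>)
      qed
      then have "labelled C None" using atT True by simp
      then show ?thesis by (auto simp: C_def)
    next
      case False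
      then obtain e where e: "e \<in> L" "\<And>e' x. e' \<in> L \<Longrightarrow> x0 < x \<Longrightarrow> x < b \<Longrightarrow> h e' x \<le> h e x"
        using topL by blast
      have loe: "lo e = x0" using AM[OF LM(2)[OF e(1)]] lo_hi[OF LM(1)[OF e(1)]] True by auto
      then have "\<not> labels_below e" using True by (simp add: labels_below_def)
      then have "labelled C (Some e)" using atT above[OF e(1)] e(2) loe by simp
      then show ?thesis using LM(1)[OF e(1)] unfolding C_def by blast
    qed
  next
    case False
    then have Rx: "- R < x0" using R0 by simp
    have lim: "h e x0 \<le> h f x0" if "e \<in> L" "f \<in> U" for e f
      using h_le_limit[OF b(1), of e f] LU[OF that] by (auto intro: less_imp_le)
    \<comment> \<open>If \<open>L\<close> and \<open>U\<close> stayed apart over \<open>x0\<close>,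
      a point between them that avoids all segments, also those ending there, would be free and
      belong to the cell, against \<open>strict\<close>.\<close>
    have "\<exists>e\<in>L. \<exists>f\<in>U. h e x0 = h f x0"
    proof (rule ccontr)
      assume no: "\<not> ?thesis"
      have "\<exists>y. (\<forall>l\<in>(\<lambda>e. h e x0) ` L. l < y) \<and> (\<forall>u\<in>(\<lambda>e. h e x0) ` U. y < u) \<and> y \<notin> (\<lambda>e. h e x0) ` M"
        using fin finite_M lim no by (intro gap_avoiding_finite) (auto simp: less_le)
      then obtain y where y': "\<forall>l\<in>(\<lambda>e. h e x0) ` L. l < y" "\<forall>u\<in>(\<lambda>e. h e x0) ` U. y < u" "y \<notin> (\<lambda>e. h e x0) ` M"
        by (elim exE conjE)
      have y: "\<And>e. e \<in> L \<Longrightarrow> h e x0 < y" "\<And>e. e \<in> U \<Longrightarrow> y < h e x0" "\<And>e. e \<in> M \<Longrightarrow> y \<noteq> h e x0"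
        using y' by auto
      have "(x0, y) \<in> free" using y(3) Rx b(1) bR by (auto simp: free_def seg_def)
      then obtain d where d: "d > 0" "ball (x0, y) d \<subseteq> free" using open_free open_contains_ball by blast
      have "\<forall>\<^sub>F x in at_right x0. \<forall>e\<in>L. h e x < y"
        using y(1) h_continuous(2)[of x0 "{x0<..}"] fin(1)
        by (intro eventually_ball_finite ballI order_tendstoD(2)) (auto simp: continuous_within)
      moreover have "\<forall>\<^sub>F x in at_right x0. \<forall>e\<in>U. y < h e x"
        using y(2) h_continuous(2)[of x0 "{x0<..}"] fin(2)
        by (intro eventually_ball_finite ballI order_tendstoD(1)) (auto simp: continuous_within)
      moreover have "\<forall>\<^sub>F x in at_right x0. x0 < x \<and> x < b" by (rule atT) simp
      moreover have "\<forall>\<^sub>F x in at_right x0. x < x0 + d"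
        unfolding eventually_at_right_field using d(1) by (intro exI[of _ "x0 + d"]) auto
      ultimately have "\<forall>\<^sub>F x in at_right x0. (x, y) \<in> T \<and> (x, y) \<in> ball (x0, y) d"
        by eventually_elim (auto simp: T_def dist_prod_def dist_real_def)
      then obtain x where x: "(x, y) \<in> T" "(x, y) \<in> ball (x0, y) d"
        using eventually_happens[of _ "at_right x0"] trivial_limit_at_right_real by blast
      have "ball (x0, y) d \<subseteq> C"
        unfolding C_def by (rule convex_subset_cell[OF convex_ball d(2) x(2)]) (use x(1) TC in \<open>auto simp: C_def\<close>)
      then have "(x0, y) \<in> C" using d(1) by auto
      then show False using strict[of "(x0, y)"] by simp
    qed
    then obtain e1 f1 where e1: "e1 \<in> L" "f1 \<in> U" "h e1 x0 = h f1 x0" by blast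
    obtain e where e: "e \<in> L" "\<And>e' x. e' \<in> L \<Longrightarrow> x0 < x \<Longrightarrow> x < b \<Longrightarrow> h e' x \<le> h e x"
      using topL e1(1) by blast
    obtain f where f: "f \<in> U" "\<And>f' x. f' \<in> U \<Longrightarrow> x0 < x \<Longrightarrow> x < b \<Longrightarrow> h f x \<le> h f' x"
      using botU e1(2) by blast
    have "h e1 x0 \<le> h e x0" by (rule h_le_limit[OF b(1)]) (rule e(2)[OF e1(1)])
    moreover have "h f x0 \<le> h f1 x0" by (rule h_le_limit[OF b(1)]) (rule f(2)[OF e1(2)])
    ultimately have ef: "h e x0 = h f x0" using lim[OF e(1) f(1)] e1(3) by linarith
    have eM: "e \<in> M" "lo e \<le> x0" "x0 < hi e" using LM[OF e(1)] AM by auto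
    have fM: "f \<in> M" "lo f \<le> x0" "x0 < hi f" using UM[OF f(1)] AM by auto
    have ne: "e \<noteq> f" using LU[OF e(1) f(1) x1] by auto
    \<comment> \<open>Two segments meeting over \<open>x0\<close> cannot both pass through. The one
      that begins there is blocked by some \<open>k\<close> with this point in its interior.\<close>
    have "lo e = x0 \<or> lo f = x0"
      using interiors_meet[OF eM(1) fM(1), of x0] eM(2,3) fM(2,3) ef ne by linarith
    then obtain k where k: "k \<in> M" "lo k < x0" "x0 < hi k" "h k x0 = h e x0"
      using left_end[OF eM(1)] left_end[OF fM(1)] False ef unfolding blocked_def by metis
    have "k \<in> active x0" using k by (auto simp: active_def)
    from cover[OF this] show ?thesis
    proof
      \<comment> \<open>If \<open>k\<close> passes below, then \<open>f\<close> begins on it and the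
        cell lies in the angle below \<open>f\<close>; if \<open>k\<close> passes above, the cell
        lies above \<open>e\<close>.\<close>
      assume kL: "k \<in> L"
      have kf: "k \<noteq> f" using LU[OF kL f(1) x1] by auto
      have lof: "lo f = x0"
        using interiors_meet[OF k(1) fM(1), of x0] k(2-4) fM(2,3) ef kf by (cases "lo f = x0") auto
      have th: "through f = k" using through_eq[of f k] fM k kf ef lof by simp
      have "labels_below f" unfolding labels_below_def th lof using False atT LU[OF kL f(1)] by simp
      then have "labelled C (Some f)" using atT below[OF f(1)] f(2) lof by simp
      then show ?thesis using fM(1) unfolding C_def by blast
    next
      assume kU: "k \<in> U"
      have ke: "k \<noteq> e" using LU[OF e(1) kU x1] by auto
      have loe: "lo e = x0"
        using interiors_meet[OF k(1) eM(1), of x0] k(2-4) eM(2,3) ke by (cases "lo e = x0") auto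
      have th: "through e = k" using through_eq[of e k] eM k ke loe by simp
      have ev: "\<forall>\<^sub>F x in at_right x0. h e x < h k x" using atT LU[OF e(1) kU] by simp
      have "\<not> labels_below e"
      proof
        assume "labels_below e"
        then have "\<forall>\<^sub>F x in at_right x0. h k x < h e x" unfolding labels_below_def th loe by simp
        with ev have "\<forall>\<^sub>F x in at_right x0. False" by eventually_elim simp
        then show False using eventually_happens[of _ "at_right x0"] trivial_limit_at_right_real by blast
      qed
      then have "labelled C (Some e)" using atT above[OF e(1)] e(2) loe by simp
      then show ?thesis using eM(1) unfolding C_def by blast
    qed
  qed
qed

theorem card_cells_le: "finite (cell ` free)" "card (cell ` free) \<le> card M + 1"
proof -
  let ?L = "insert None (Some ` M)"
  have "\<forall>c\<in>cell ` free. \<exists>l\<in>?L. labelled c l" using label_exists by blast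
  then obtain f where f: "\<And>c. c \<in> cell ` free \<Longrightarrow> f c \<in> ?L \<and> labelled c (f c)" by metis
  have inj: "inj_on f (cell ` free)"
  proof (rule inj_onI)
    fix c c' assume c: "c \<in> cell ` free" "c' \<in> cell ` free" "f c = f c'"
    then obtain u v where "c = cell u" "c' = cell v" by blast
    then show "c = c'" using labelled_unique[of u "f c" v] f[OF c(1)] f[OF c(2)] c(3) by simp
  qed
  have sub: "f ` (cell ` free) \<subseteq> ?L" using f by (intro image_subsetI) simp
  have finL: "finite ?L" using finite_M by simp
  show "finite (cell ` free)" using inj_on_finite[OF inj sub finL] .
  have "card (cell ` free) \<le> card ?L" by (rule card_inj_on_le[OF inj sub finL])
  also have "card ?L = card M + 1" using finite_M by (simp add: card_image)
  finally show "card (cell ` free) \<le> card M + 1" .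
qed

end

section \<open>Points on the boundary of a cell\<close>

locale arrangement_points = arrangement M h lo hi R
  for M :: "'e set" and h :: "'e \<Rightarrow> real \<Rightarrow> real" and lo hi :: "'e \<Rightarrow> real" and R :: real +
  fixes P :: "pt set" and own :: "pt \<Rightarrow> 'e"
  assumes finite_P: "finite P"
    and own: "\<And>p. p \<in> P \<Longrightarrow> own p \<in> M \<and> lo (own p) < fst p \<and> fst p < hi (own p) \<and> snd p = h (own p) (fst p)"
    and off: "\<And>p f. p \<in> P \<Longrightarrow> f \<in> M \<Longrightarrow> f \<noteq> own p \<Longrightarrow> snd p \<noteq> h f (fst p)"
begin

text \<open>Signed vertical offset from the line of \<open>own p\<close>; \<open>s = 1\<close> and
  \<open>s = - 1\<close> stand for the upper and the lower side.\<close>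

definition side :: "pt \<Rightarrow> real \<Rightarrow> pt \<Rightarrow> real" where
  "side p s z = s * (snd z - h (own p) (fst z))"

definition half_disc :: "pt \<Rightarrow> real \<Rightarrow> real \<Rightarrow> pt set" where
  "half_disc p s d = ball p d \<inter> {z. 0 < side p s z}"

text \<open>The cell that \<open>p\<close> touches on the side \<open>s\<close>. It is described by
  points near \<open>p\<close>, because \<open>p\<close> itself lies on a segment and sees
  nothing.\<close>

definition corner :: "pt \<Rightarrow> real \<Rightarrow> pt set" where
  "corner p s = {u. \<forall>\<^sub>F t in at_right 0. vis u (p + (0, s * t))}"

definition nudge :: "pt \<Rightarrow> real \<Rightarrow> real \<Rightarrow> pt" where
  "nudge p s t = (fst p, snd p + s * t)"

lemma own_slab: "p \<in> P \<Longrightarrow> - R < fst p \<and> fst p < R"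
  using own[of p] lo_hi[of "own p"] by auto

lemma side_combination: "side p s ((1 - t) *\<^sub>R z + t *\<^sub>R z') = (1 - t) * side p s z + t * side p s z'"
proof -
  obtain c d where "\<And>x. h (own p) x = c + d * x" using affine_h by metis
  then show ?thesis by (simp add: side_def algebra_simps)
qed

lemma side_self: "p \<in> P \<Longrightarrow> side p s p = 0"
  using own by (simp add: side_def)

lemma side_nudge: "p \<in> P \<Longrightarrow> s * s = 1 \<Longrightarrow> side p s (nudge p s t) = t"
  using own[of p] by (simp add: side_def nudge_def mult.assoc[symmetric])

lemma convex_half_disc: "convex (half_disc p s d)"
proof -
  have "convex {z. 0 < side p s z}"
  proof (rule convexI)
    fix z z' and a b :: real assume z: "z \<in> {z. 0 < side p s z}" "z' \<in> {z. 0 < side p s z}" and ab: "0 \<le> a" "0 \<le> b" "a + b = 1"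
    then have a: "a = 1 - b" by simp
    have "0 < (1 - b) * side p s z + b * side p s z'"
    proof (cases "b = 0")
      case False
      then have "0 < b * side p s z'" using z(2) ab by simp
      moreover have "0 \<le> (1 - b) * side p s z" using z(1) ab a by simp
      ultimately show ?thesis by simp
    qed (use z in simp)
    then show "a *\<^sub>R z + b *\<^sub>R z' \<in> {z. 0 < side p s z}" unfolding a by (simp add: side_combination)
  qed
  then show ?thesis unfolding half_disc_def by (intro convex_Int convex_ball)
qed

text \<open>Only \<open>own p\<close> contains \<open>p\<close>; the other segments and the border
  keep a positive distance.\<close>

lemma half_disc_free:
  assumes p: "p \<in> P"
  shows "\<exists>d>0. \<forall>s. half_disc p s d \<subseteq> free"
proof -
  let ?O = "{z. - R < fst z} \<inter> {z. fst z < R} \<inter> - (\<Union>e\<in>M - {own p}. seg e)"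
  have "open ?O"
  proof -
    have "closed (\<Union>e\<in>M - {own p}. seg e)" using finite_M closed_seg by auto
    then show ?thesis
      by (simp only: open_Int open_Collect_less continuous_on_fst continuous_on_id continuous_on_const open_Compl)
  qed
  moreover have pO: "p \<in> ?O" using own_slab[OF p] off[OF p] by (auto simp: seg_def)
  ultimately have "\<exists>d>0. ball p d \<subseteq> ?O" by (rule openE) blast
  then obtain d where d: "d > 0" "ball p d \<subseteq> ?O" by (elim exE conjE)
  have "half_disc p s d \<subseteq> free" for s
  proof
    fix z assume z: "z \<in> half_disc p s d"
    then have "z \<in> ball p d" by (simp add: half_disc_def)
    then have "z \<in> ?O" by (rule subsetD[OF d(2)])
    moreover have "z \<notin> seg (own p)" using z by (auto simp: half_disc_def side_def seg_def)
    ultimately show "z \<in> free" by (auto simp: free_def)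
  qed
  with d show ?thesis by blast
qed

lemma nudge_half_disc:
  assumes "p \<in> P" "s * s = 1" "0 < t" "t < d"
  shows "nudge p s t \<in> half_disc p s d"
proof -
  have "\<bar>s\<bar> = 1" using assms(2) by (metis abs_mult_self_eq abs_of_nonneg abs_ge_zero abs_mult abs_1 mult_cancel_right1 power2_eq_1_iff power2_eq_square abs_minus_cancel)
  then have "dist p (nudge p s t) = t" using assms(3) by (cases p) (simp add: nudge_def dist_prod_def dist_real_def abs_mult)
  then show ?thesis using assms side_nudge by (simp add: half_disc_def)
qed

lemma corner_cell:
  assumes p: "p \<in> P" and s: "s * s = 1"
  shows "\<exists>d>0. half_disc p s d \<subseteq> free \<and> (\<forall>z\<in>half_disc p s d. corner p s = cell z)"
proof -
  obtain d where d: "d > 0" "half_disc p s d \<subseteq> free" using half_disc_free[OF p] by blast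
  have vis: "vis z z'" if "z \<in> half_disc p s d" "z' \<in> half_disc p s d" for z z'
    using closed_segment_subset[OF that convex_half_disc] d(2) unfolding vis_def by blast
  have "corner p s = cell z" if z: "z \<in> half_disc p s d" for z
  proof (rule subset_antisym; rule subsetI)
    fix u assume "u \<in> corner p s"
    then have "\<forall>\<^sub>F t in at_right 0. vis u (nudge p s t)" by (cases p) (simp add: corner_def nudge_def)
    moreover have "\<forall>\<^sub>F t in at_right 0. t < d" using d(1) by (rule eventually_at_right_less_bound)
    moreover have "\<forall>\<^sub>F t in at_right (0::real). 0 < t" by (rule eventually_at_right_less)
    ultimately have "\<forall>\<^sub>F t in at_right 0. vis u (nudge p s t) \<and> t < d \<and> 0 < t"
      by (intro eventually_conj)
    then obtain t where "vis u (nudge p s t)" "t < d" "0 < t"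
      using eventually_happens[of _ "at_right (0::real)"] trivial_limit_at_right_real by blast
    then have "vis u z" using vis_trans vis[OF nudge_half_disc[OF p s] z] by blast
    then show "u \<in> cell z" by (simp add: cell_def vis_sym)
  next
    fix u assume "u \<in> cell z"
    then have "vis u z" by (simp add: cell_def vis_sym)
    then have *: "vis u (nudge p s t)" if "0 < t" "t < d" for t
      using vis_trans vis[OF z nudge_half_disc[OF p s that]] by blast
    have "\<forall>\<^sub>F t in at_right 0. vis u (nudge p s t)"
      unfolding eventually_at_right_field using * d(1) by blast
    then show "u \<in> corner p s" by (cases p) (simp add: corner_def nudge_def)
  qed
  with d show ?thesis by blast
qed

lemma corner_in_cells:
  assumes "p \<in> P" "s * s = 1"
  shows "corner p s \<in> cell ` free"
proof -
  obtain d where d: "d > 0" "half_disc p s d \<subseteq> free" "\<forall>z\<in>half_disc p s d. corner p s = cell z"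
    using corner_cell[OF assms] by blast
  have "nudge p s (d / 2) \<in> half_disc p s d" using nudge_half_disc[OF assms] d(1) by simp
  then show ?thesis using d by blast
qed

lemma nudge_in_corner:
  assumes "p \<in> P" "s * s = 1"
  shows "\<exists>d>0. \<forall>t. 0 < t \<and> t < d \<longrightarrow> nudge p s t \<in> corner p s"
proof -
  obtain d where d: "d > 0" "half_disc p s d \<subseteq> free" "\<forall>z\<in>half_disc p s d. corner p s = cell z"
    using corner_cell[OF assms] by blast
  have "nudge p s t \<in> corner p s" if "0 < t" "t < d" for t
    using nudge_half_disc[OF assms that] d cell_self by blast
  then show ?thesis using d(1) by blast
qed

lemma corner_vis:
  assumes "p \<in> P" "s * s = 1" "u \<in> corner p s" "v \<in> corner p s"
  shows "vis u v"
proof -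
  obtain w where "corner p s = cell w" using corner_in_cells[OF assms(1,2)] by blast
  then show ?thesis using assms(3,4) vis_trans vis_sym unfolding cell_def by blast
qed

text \<open>\<open>p\<close> is interior to its segment. From a point \<open>v\<close> of the cell
  beyond the line, the way to points of the cell close to \<open>p\<close> would cross the line near
  \<open>p\<close>, hence on \<open>own p\<close>.\<close>

lemma corner_side:
  assumes p: "p \<in> P" and s: "s * s = 1" and v: "v \<in> corner p s"
  shows "0 \<le> side p s v"
proof (rule ccontr)
  define k where "k = - side p s v"
  assume "\<not> ?thesis"
  then have k: "0 < k" by (simp add: k_def)
  obtain d where d: "d > 0" "\<And>t. 0 < t \<Longrightarrow> t < d \<Longrightarrow> nudge p s t \<in> corner p s"
    using nudge_in_corner[OF p s] by blast
  let ?e = "own p"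
  define r where "r = min (fst p - lo ?e) (hi ?e - fst p)"
  have r: "0 < r" using own[OF p] by (simp add: r_def)
  define B where "B = \<bar>fst v - fst p\<bar> + 1"
  \<comment> \<open>The crossing point \<open>w\<close> has horizontal distance at most
    \<open>t * B / (k + t)\<close> from \<open>p\<close>; this \<open>t\<close> makes that less than
    the distance \<open>r\<close> to the ends.\<close>
  define t where "t = min (d / 2) (r * k / (2 * B))"
  have B: "0 < B" by (simp add: B_def)
  have t: "0 < t" "t < d" using d(1) r k B by (auto simp: t_def)
  have tB: "t * B < r * k"
  proof -
    have "t \<le> r * k / (2 * B)" by (simp add: t_def)
    then have "t * (2 * B) \<le> r * k" using B by (simp add: pos_le_divide_eq)
    moreover have "0 < r * k" using r k by simp
    ultimately show ?thesis by linarith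
  qed
  define z where "z = nudge p s t"
  have z: "z \<in> corner p s" "side p s z = t" using d(2)[OF t] side_nudge[OF p s] by (auto simp: z_def)
  define l where "l = k / (k + t)"
  have l: "0 \<le> l" "l \<le> 1" "1 - l = t / (k + t)" using k t by (auto simp: l_def field_simps)
  define w where "w = (1 - l) *\<^sub>R v + l *\<^sub>R z"
  have "side p s w = (1 - l) * (- k) + l * t" unfolding w_def side_combination z(2) by (simp add: k_def)
  also have "\<dots> = 0" unfolding l(3) by (simp add: l_def)
  finally have sw: "side p s w = 0" .
  have "s \<noteq> 0" using s by auto
  then have hw: "snd w = h ?e (fst w)" using sw by (simp add: side_def)
  have fw: "fst w - fst p = (1 - l) * (fst v - fst p)" by (simp add: w_def z_def nudge_def algebra_simps)
  have "\<bar>fst w - fst p\<bar> = (1 - l) * \<bar>fst v - fst p\<bar>" unfolding fw abs_mult using l(2) by simp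
  also have "\<dots> \<le> (1 - l) * B" using l by (intro mult_left_mono) (auto simp: B_def)
  also have "\<dots> = t * B / (k + t)" unfolding l(3) by simp
  also have "\<dots> < r"
  proof -
    have "r * k < r * (k + t)" using r t by simp
    then have "t * B < r * (k + t)" using tB by linarith
    then show ?thesis using k t by (simp add: divide_less_eq)
  qed
  finally have "w \<in> seg ?e" using hw by (auto simp: seg_def r_def)
  moreover have "w \<in> closed_segment v z" using l by (auto simp: w_def in_segment)
  moreover have "closed_segment v z \<subseteq> free" using corner_vis[OF p s v z(1)] by (simp add: vis_def)
  ultimately show False using own[OF p] by (auto simp: free_def)
qed

lemma corners_distinct:
  assumes p: "p \<in> P" and s: "s * s = 1" "t * t = 1" and eq: "corner p s = corner p t"
  shows "s = t"
proof (rule ccontr)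
  assume ne: "s \<noteq> t"
  have st: "s = - t" using s ne by (metis power2_eq_iff power2_eq_square)
  obtain d where d: "d > 0" "\<And>u. 0 < u \<Longrightarrow> u < d \<Longrightarrow> nudge p t u \<in> corner p t"
    using nudge_in_corner[OF p s(2)] by blast
  have "nudge p t (d / 2) \<in> corner p s" using d(2)[of "d / 2"] d(1) eq by simp
  then have "0 \<le> side p s (nudge p t (d / 2))" by (rule corner_side[OF p s(1)])
  moreover have "side p s (nudge p t (d / 2)) = - side p t (nudge p t (d / 2))" by (simp add: side_def st)
  ultimately show False using side_nudge[OF p s(2)] d(1) by simp
qed

text \<open>\<open>q\<close> is a limit of points of the cell, which lies on one side of the line of
  \<open>p\<close>. By \<open>off\<close>, a point with another owner is not on that line.\<close>

lemma corner_side_point: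
  assumes p: "p \<in> P" "q \<in> P" and s: "s * s = 1" "t * t = 1" and eq: "corner p s = corner q t"
  shows "0 \<le> side p s q" "own p \<noteq> own q \<Longrightarrow> 0 < side p s q"
proof -
  obtain d where d: "d > 0" "\<And>u. 0 < u \<Longrightarrow> u < d \<Longrightarrow> nudge q t u \<in> corner p s"
    using nudge_in_corner[OF p(2) s(2)] eq by blast
  have "0 \<le> side p s q + s * t * u" if "0 < u" "u < d" for u
    using corner_side[OF p(1) s(1) d(2)[OF that]] by (simp add: side_def nudge_def algebra_simps)
  then have ev: "\<forall>\<^sub>F u in at_right 0. 0 \<le> side p s q + s * t * u"
    unfolding eventually_at_right_field using d(1) by blast
  have "((\<lambda>u. side p s q + s * t * u) \<longlongrightarrow> side p s q + s * t * 0) (at_right 0)" by (intro tendsto_intros)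
  from tendsto_lowerbound[OF this ev trivial_limit_at_right_real]
  show 1: "0 \<le> side p s q" by simp
  assume "own p \<noteq> own q"
  then have "snd q \<noteq> h (own p) (fst q)" using off[OF p(2)] own[OF p(1)] by auto
  moreover have "s \<noteq> 0" using s by auto
  ultimately have "side p s q \<noteq> 0" by (simp add: side_def)
  then show "0 < side p s q" using 1 by simp
qed

lemma chord_enters_corner:
  assumes p: "p \<in> P" and s: "s * s = 1" and q: "0 < side p s q"
  shows "\<exists>c>0. \<forall>x. 0 < x \<and> x < c \<longrightarrow> (1 - x) *\<^sub>R p + x *\<^sub>R q \<in> corner p s"
proof -
  obtain d where d: "d > 0" "half_disc p s d \<subseteq> free" "\<forall>z\<in>half_disc p s d. corner p s = cell z"
    using corner_cell[OF p s] by blast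
  define c where "c = d / (dist p q + 1)"
  have D: "0 < dist p q + 1" by (smt (verit) zero_le_dist)
  then have c: "0 < c" using d(1) by (simp add: c_def)
  have "(1 - x) *\<^sub>R p + x *\<^sub>R q \<in> corner p s" if x: "0 < x" "x < c" for x
  proof -
    let ?z = "(1 - x) *\<^sub>R p + x *\<^sub>R q"
    have "p - ?z = x *\<^sub>R (p - q)" by (simp add: algebra_simps)
    then have "dist p ?z = x * dist p q" using x by (simp add: dist_norm)
    also have "\<dots> \<le> x * (dist p q + 1)" using x by simp
    also have "\<dots> < d" using x(2) D by (simp add: c_def pos_less_divide_eq)
    finally have "?z \<in> ball p d" by simp
    moreover have "0 < side p s ?z" using x q by (simp add: side_combination side_self[OF p])
    ultimately have "?z \<in> half_disc p s d" by (simp add: half_disc_def)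
    then show ?thesis using d cell_self by blast
  qed
  then show ?thesis using c by blast
qed

text \<open>The chord enters the cell at both ends, and the cell is convex.\<close>

lemma open_chord_in_corner:
  assumes p: "p \<in> P" "q \<in> P" and s: "s * s = 1" "t * t = 1" and eq: "corner p s = corner q t" and ne: "own p \<noteq> own q"
  shows "open_segment p q \<subseteq> corner p s"
proof
  fix z assume "z \<in> open_segment p q"
  then obtain u where u: "0 < u" "u < 1" "z = (1 - u) *\<^sub>R p + u *\<^sub>R q" by (auto simp: in_segment)
  obtain c where c: "c > 0" "\<And>x. 0 < x \<Longrightarrow> x < c \<Longrightarrow> (1 - x) *\<^sub>R p + x *\<^sub>R q \<in> corner p s"
    using chord_enters_corner[OF p(1) s(1) corner_side_point(2)[OF p s eq ne]] by blast
  obtain c' where c': "c' > 0" "\<And>x. 0 < x \<Longrightarrow> x < c' \<Longrightarrow> (1 - x) *\<^sub>R q + x *\<^sub>R p \<in> corner p s"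
    using chord_enters_corner[OF p(2) s(2) corner_side_point(2)[OF p(2,1) s(2,1) eq[symmetric] ne[symmetric]]] eq by metis
  define x where "x = min (c / 2) (u / 2)"
  define y where "y = min (c' / 2) ((1 - u) / 2)"
  have x: "0 < x" "x < c" "x < u" using c(1) u by (auto simp: x_def)
  have y: "0 < y" "y < c'" "u < 1 - y" using c'(1) u by (auto simp: y_def min_def field_simps)
  let ?a = "(1 - x) *\<^sub>R p + x *\<^sub>R q" and ?b = "(1 - y) *\<^sub>R q + y *\<^sub>R p"
  define l where "l = (u - x) / (1 - y - x)"
  have l: "0 \<le> l" "l \<le> 1" "l * (1 - y - x) = u - x" using x y by (auto simp: l_def field_simps)
  have "(1 - l) *\<^sub>R ?a + l *\<^sub>R ?b = (1 - (x + l * (1 - y - x))) *\<^sub>R p + (x + l * (1 - y - x)) *\<^sub>R q"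
    by (simp add: algebra_simps)
  also have "\<dots> = z" unfolding l(3) u(3) by simp
  finally have zz: "(1 - l) *\<^sub>R ?a + l *\<^sub>R ?b = z" .
  obtain w where w: "corner p s = cell w" using corner_in_cells[OF p(1) s(1)] by blast
  have "(1 - l) *\<^sub>R ?a + l *\<^sub>R ?b \<in> cell w"
    using convexD[OF convex_cell[of w]] c(2)[OF x(1,2)] c'(2)[OF y(1,2)] l(1,2) unfolding w by auto
  then show "z \<in> corner p s" using zz w by simp
qed

definition corners :: "pt set set" where
  "corners = {corner p s | p s. p \<in> P \<and> s * s = 1}"

definition members :: "pt set \<Rightarrow> pt set" where
  "members C = {p \<in> P. \<exists>s. s * s = 1 \<and> corner p s = C}"

lemma corners_subset: "corners \<subseteq> cell ` free"
  unfolding corners_def using corner_in_cells by blast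

lemma finite_corners: "finite corners" "card corners \<le> card M + 1"
  using finite_subset[OF corners_subset card_cells_le(1)]
    card_mono[OF card_cells_le(1) corners_subset] card_cells_le(2) by auto

text \<open>Each point has one incidence for each sign, and its two cells differ by
  \<open>corners_distinct\<close>.\<close>

lemma sum_card_members: "(\<Sum>C\<in>corners. card (members C)) = 2 * card P"
proof -
  have unit: "s * s = 1 \<longleftrightarrow> s \<in> {1, - 1}" for s :: real
    using square_eq_1_iff[of s] by simp
  have "(\<Sum>C\<in>corners. card (members C)) = card (Sigma corners members)"
    using finite_corners finite_P by (simp add: card_SigmaI members_def)
  also have "\<dots> = card ((\<lambda>(p, s). (corner p s, p)) ` (P \<times> {1, - 1 :: real}))"
  proof (rule arg_cong[of _ _ card], rule subset_antisym; rule subsetI)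
    fix x assume "x \<in> Sigma corners members"
    then obtain p s where "x = (corner p s, p)" "p \<in> P" "s * s = 1" unfolding members_def by (cases x) auto
    then show "x \<in> (\<lambda>(p, s). (corner p s, p)) ` (P \<times> {1, - 1 :: real})" using unit by force
  next
    fix x assume "x \<in> (\<lambda>(p, s). (corner p s, p)) ` (P \<times> {1, - 1 :: real})"
    then obtain p s where "x = (corner p s, p)" "p \<in> P" "s * s = 1" using unit by auto
    then show "x \<in> Sigma corners members" unfolding corners_def members_def by blast
  qed
  also have "\<dots> = card (P \<times> {1, - 1 :: real})"
  proof (rule card_image, rule inj_onI)
    fix x y assume x: "x \<in> P \<times> {1, - 1 :: real}" and y: "y \<in> P \<times> {1, - 1 :: real}"
      and eq: "(case x of (p, s) \<Rightarrow> (corner p s, p)) = (case y of (p, s) \<Rightarrow> (corner p s, p))"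
    obtain p s where xp: "x = (p, s)" by (cases x)
    obtain q t where yq: "y = (q, t)" by (cases y)
    have "p = q" "corner p s = corner p t" using eq xp yq by auto
    moreover have "p \<in> P" "s * s = 1" "t * t = 1" using x y xp yq unit by auto
    ultimately show "x = y" using corners_distinct[of p s t] xp yq by simp
  qed
  also have "\<dots> = 2 * card P" by (simp add: card_cartesian_product)
  finally show ?thesis .
qed

end

section \<open>Diagonals of points in convex position\<close>

definition interleaved :: "nat \<times> nat \<Rightarrow> nat \<times> nat \<Rightarrow> bool" where
  "interleaved x y \<longleftrightarrow> fst x < fst y \<and> fst y < snd x \<and> snd x < snd y"

text \<open>
  Shrink an interval of indices repeatedly by one at either end and collect the intervals obtained.  At the first
  difference between two runs of this process, two intervals interleave.
\<close>

lemma chord_families: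
  "\<exists>F. finite F \<and> card F = 2 ^ m \<and>
     (\<forall>D\<in>F. (\<forall>x\<in>D. i \<le> fst x \<and> fst x < snd x \<and> snd x \<le> i + m + 2) \<and> (\<forall>x\<in>D. \<forall>y\<in>D. \<not> interleaved x y)) \<and>
     (\<forall>D\<in>F. \<forall>D'\<in>F. D \<noteq> D' \<longrightarrow> (\<exists>x\<in>D. \<exists>y\<in>D'. interleaved x y \<or> interleaved y x))"
proof (induction m arbitrary: i)
  case 0
  show ?case by (intro exI[of _ "{{}}"]) auto
next
  case (Suc m)
  define good where "good = (\<lambda>j D. (\<forall>x\<in>D. j \<le> fst x \<and> fst x < snd x \<and> snd x \<le> j + m + 2) \<and>
      (\<forall>x\<in>D. \<forall>y\<in>D. \<not> interleaved x y))"
  define clash where "clash = (\<lambda>D D'. \<exists>x\<in>D. \<exists>y\<in>D'. interleaved x y \<or> interleaved y x)"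
  have IH: "\<exists>F. finite F \<and> card F = 2 ^ m \<and> (\<forall>D\<in>F. good j D) \<and> (\<forall>D\<in>F. \<forall>D'\<in>F. D \<noteq> D' \<longrightarrow> clash D D')" for j
    using Suc.IH[of j] by (simp add: good_def clash_def)
  obtain F1 where F1': "finite F1" "card F1 = 2 ^ m" "\<forall>D\<in>F1. good (Suc i) D" "\<forall>D\<in>F1. \<forall>D'\<in>F1. D \<noteq> D' \<longrightarrow> clash D D'"
    using IH[of "Suc i"] by (elim exE conjE)
  obtain F2 where F2': "finite F2" "card F2 = 2 ^ m" "\<forall>D\<in>F2. good i D" "\<forall>D\<in>F2. \<forall>D'\<in>F2. D \<noteq> D' \<longrightarrow> clash D D'"
    using IH[of i] by (elim exE conjE)
  note F1 = F1'(1,2) bspec[OF F1'(3)] F1'(4)[rule_format]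
  note F2 = F2'(1,2) bspec[OF F2'(3)] F2'(4)[rule_format]
  \<comment> \<open>From the index interval \<open>i .. i + m + 3\<close>, \<open>a\<close> drops
    the left end and \<open>b\<close> the right end. They interleave, so every family with
    \<open>a\<close> clashes with every family with \<open>b\<close>.\<close>
  define a where "a = (Suc i, i + m + 3)"
  define b where "b = (i, i + m + 2)"
  define ok where "ok = (\<lambda>D. (\<forall>x\<in>D. i \<le> fst x \<and> fst x < snd x \<and> snd x \<le> i + Suc m + 2) \<and>
      (\<forall>x\<in>D. \<forall>y\<in>D. \<not> interleaved x y))"
  have ok1: "ok (insert a D)" if "D \<in> F1" for D
    using F1(3)[OF that] unfolding ok_def good_def a_def interleaved_def by fastforce
  have ok2: "ok (insert b D)" if "D \<in> F2" for D
    using F2(3)[OF that] unfolding ok_def good_def b_def interleaved_def by fastforce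
  have no_clash: "\<not> clash D D" if "ok D" for D
    using that unfolding ok_def clash_def by blast
  have clash_insert: "clash (insert x D) (insert y D')" if "clash D D'" for x y :: "nat \<times> nat" and D D'
    using that unfolding clash_def by blast
  have ab: "clash (insert a D) (insert b D')" "clash (insert b D') (insert a D)" for D D'
    unfolding clash_def a_def b_def interleaved_def by auto
  let ?F = "insert a ` F1 \<union> insert b ` F2"
  have okF: "ok D" if "D \<in> ?F" for D using that ok1 ok2 by blast
  have clashF: "clash D D'" if "D \<in> ?F" "D' \<in> ?F" "D \<noteq> D'" for D D'
    using that F1(4) F2(4) clash_insert ab by (elim UnE imageE) (metis, simp, simp, metis)
  have inj1: "inj_on (insert a) F1"
    by (rule inj_onI) (metis F1(4) clash_insert no_clash ok1)
  have inj2: "inj_on (insert b) F2"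
    by (rule inj_onI) (metis F2(4) clash_insert no_clash ok2)
  have disj: "insert a ` F1 \<inter> insert b ` F2 = {}"
  proof (rule ccontr)
    assume "insert a ` F1 \<inter> insert b ` F2 \<noteq> {}"
    then obtain D D' where "D \<in> F1" "insert a D = insert b D'" by blast
    then show False using ab(1)[of D D'] no_clash ok1 by metis
  qed
  have "card ?F = 2 ^ Suc m"
    using F1(1,2) F2(1,2) disj by (simp add: card_Un_disjoint card_image inj1 inj2)
  moreover have "finite ?F" using F1(1) F2(1) by simp
  ultimately show ?case
  proof (intro exI[of _ ?F] conjI ballI impI)
    fix D assume "D \<in> ?F"
    then have "ok D" by (rule okF)
    then show "\<And>x. x \<in> D \<Longrightarrow> i \<le> fst x" "\<And>x. x \<in> D \<Longrightarrow> fst x < snd x" "\<And>x. x \<in> D \<Longrightarrow> snd x \<le> i + Suc m + 2"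
      "\<And>x y. x \<in> D \<Longrightarrow> y \<in> D \<Longrightarrow> \<not> interleaved x y" unfolding ok_def by blast+
  next
    fix D D' assume "D \<in> ?F" "D' \<in> ?F" "D \<noteq> D'"
    then show "\<exists>x\<in>D. \<exists>y\<in>D'. interleaved x y \<or> interleaved y x" using clashF unfolding clash_def by simp
  qed
qed

text \<open>Vertices of a convex polygon in counterclockwise order, for which crossing of chords
  becomes interleaving of indices.\<close>

locale ccw_chain =
  fixes c :: "nat \<Rightarrow> pt" and k :: nat
  assumes ccw: "\<And>i j l. i < j \<Longrightarrow> j < l \<Longrightarrow> l < k \<Longrightarrow> 0 < cross (c i) (c j) (c l)"
begin

lemma cross_inside: "i < m \<Longrightarrow> m < j \<Longrightarrow> j < k \<Longrightarrow> cross (c i) (c j) (c m) < 0"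
  using ccw[of i m j] by (simp add: cross_def algebra_simps)

lemma cross_outside: "i < j \<Longrightarrow> j < k \<Longrightarrow> m < k \<Longrightarrow> m < i \<or> j < m \<Longrightarrow> 0 < cross (c i) (c j) (c m)"
  using ccw[of m i j] ccw[of i j m] by (auto simp: cross_rotate)

text \<open>Without interleaving, the line through \<open>c i\<close> and \<open>c j\<close> does
  not separate \<open>c a\<close> from \<open>c b\<close>. A common point is on this line, so it is
  an end of the second chord lying on it, and only \<open>c i\<close> and \<open>c j\<close>
  qualify.\<close>

lemma chords_meet_only_at_ends:
  assumes ij: "i < j" "j < k" and ab: "a < b" "b < k" and ne: "(i, j) \<noteq> (a, b)"
    and ni: "\<not> interleaved (i, j) (a, b)" "\<not> interleaved (a, b) (i, j)"
  shows "convex hull {c i, c j} \<inter> convex hull {c a, c b} = {c i, c j} \<inter> {c a, c b}"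
proof
  show "{c i, c j} \<inter> {c a, c b} \<subseteq> convex hull {c i, c j} \<inter> convex hull {c a, c b}"
    using hull_subset[of "{c i, c j}"] hull_subset[of "{c a, c b}"] by blast
  show "convex hull {c i, c j} \<inter> convex hull {c a, c b} \<subseteq> {c i, c j} \<inter> {c a, c b}"
  proof
    fix z assume z: "z \<in> convex hull {c i, c j} \<inter> convex hull {c a, c b}"
    let ?f = "cross (c i) (c j)"
    obtain s where s: "0 \<le> s" "s \<le> 1" "z = (1 - s) *\<^sub>R c i + s *\<^sub>R c j"
      using z by (auto simp: segment_convex_hull[symmetric] in_segment)
    obtain t where t: "0 \<le> t" "t \<le> 1" "z = (1 - t) *\<^sub>R c a + t *\<^sub>R c b"
      using z by (auto simp: segment_convex_hull[symmetric] in_segment)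
    have ends: "?f (c i) = 0" "?f (c j) = 0" by (simp_all add: cross_def)
    have "?f z = 0" unfolding s(3) cross_combination by (simp add: ends)
    then have sum: "(1 - t) * ?f (c a) + t * ?f (c b) = 0" unfolding t(3) cross_combination .
    have sgn: "m \<in> {i, j} \<or> (i < m \<and> m < j \<and> ?f (c m) < 0) \<or> ((m < i \<or> j < m) \<and> 0 < ?f (c m))" if "m < k" for m
      using cross_inside[of i m j] cross_outside[of i j m] ij that by (metis insertCI linorder_neqE_nat)
    have A: "a < k" using ab by simp
    have notboth: "\<not> (a \<in> {i, j} \<and> b \<in> {i, j})" using ij ab ne by auto
    have same: "0 \<le> ?f (c a) * ?f (c b)"
    proof (cases "a \<in> {i, j} \<or> b \<in> {i, j}")
      case True
      then have "?f (c a) = 0 \<or> ?f (c b) = 0" using ends by blast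
      then show ?thesis by auto
    next
      case False
      have "\<not> (i < a \<and> a < j \<and> j < b)" "\<not> (a < i \<and> i < b \<and> b < j)"
        using ni by (auto simp: interleaved_def)
      then have "(i < a \<and> a < j) = (i < b \<and> b < j)" using False ab(1) by (metis insert_iff linorder_neqE_nat order_less_trans)
      then have "?f (c a) < 0 \<and> ?f (c b) < 0 \<or> 0 < ?f (c a) \<and> 0 < ?f (c b)"
        using sgn[OF A] sgn[OF ab(2)] False by (metis not_less_iff_gr_or_eq)
      then show ?thesis by (auto intro: mult_nonneg_nonneg mult_nonpos_nonpos)
    qed
    have za: "z = c a \<or> z = c b"
    proof -
      have "(1 - t) * ?f (c a) = 0 \<and> t * ?f (c b) = 0"
      proof -
        have "(1 - t) * ?f (c a) * (t * ?f (c b)) = ((1 - t) * t) * (?f (c a) * ?f (c b))" by simp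
        also have "\<dots> \<ge> 0" using same t by simp
        finally have "0 \<le> (1 - t) * ?f (c a) * (t * ?f (c b))" .
        then show ?thesis using sum by (smt (verit) mult_neg_pos mult_pos_neg)
      qed
      moreover have "?f (c a) \<noteq> 0 \<or> ?f (c b) \<noteq> 0" using sgn[OF A] sgn[OF ab(2)] notboth by fastforce
      ultimately have "t = 1 \<or> t = 0" by auto
      then show ?thesis using t(3) by auto
    qed
    have "?f z = 0" by fact
    then have "z = c a \<and> a \<in> {i, j} \<or> z = c b \<and> b \<in> {i, j}"
      using za sgn[OF A] sgn[OF ab(2)] by fastforce
    then show "z \<in> {c i, c j} \<inter> {c a, c b}" by auto
  qed
qed

text \<open>The diagonals of a convex quadrilateral meet in a point whose weights are areas of the
  triangles formed by its vertices.\<close>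

lemma chords_cross:
  assumes "i < a" "a < j" "j < b" "b < k"
  shows "convex hull {c i, c j} \<inter> convex hull {c a, c b} \<noteq> {c i, c j} \<inter> {c a, c b}" "{c i, c j} \<noteq> {c a, c b}"
proof -
  define X Y U V where "X = cross (c i) (c a) (c b)" and "Y = cross (c a) (c j) (c b)"
    and "U = cross (c i) (c a) (c j)" and "V = cross (c i) (c j) (c b)"
  have pos: "0 < X" "0 < Y" "0 < U" "0 < V" using ccw assms by (auto simp: X_def Y_def U_def V_def)
  have sum: "X + Y = U + V" by (simp add: X_def Y_def U_def V_def cross_def algebra_simps)
  define z where "z = (Y / (X + Y)) *\<^sub>R c i + (X / (X + Y)) *\<^sub>R c j"
  have eq: "Y *\<^sub>R c i + X *\<^sub>R c j = V *\<^sub>R c a + U *\<^sub>R c b"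
    by (simp add: prod_eq_iff X_def Y_def U_def V_def cross_def algebra_simps)
  have "z = inverse (X + Y) *\<^sub>R (Y *\<^sub>R c i + X *\<^sub>R c j)"
    by (simp add: z_def scaleR_right_distrib divide_inverse mult.commute)
  also have "\<dots> = (V / (X + Y)) *\<^sub>R c a + (U / (X + Y)) *\<^sub>R c b"
    unfolding eq by (simp add: scaleR_right_distrib divide_inverse mult.commute)
  finally have z2: "z = (V / (X + Y)) *\<^sub>R c a + (U / (X + Y)) *\<^sub>R c b" .
  have "z \<in> closed_segment (c i) (c j)"
    unfolding in_segment z_def using pos by (intro exI[of _ "X / (X + Y)"]) (auto simp: field_simps add_divide_distrib[symmetric])
  moreover have "z \<in> closed_segment (c a) (c b)"
    unfolding in_segment z2 sum using pos by (intro exI[of _ "U / (U + V)"]) (auto simp: field_simps add_divide_distrib[symmetric])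
  ultimately have "z \<in> convex hull {c i, c j} \<inter> convex hull {c a, c b}"
    by (simp add: segment_convex_hull)
  moreover have d: "c i \<noteq> c a" "c i \<noteq> c b" "c j \<noteq> c a" "c j \<noteq> c b"
    using pos by (auto simp: X_def Y_def U_def V_def cross_def)
  ultimately show "convex hull {c i, c j} \<inter> convex hull {c a, c b} \<noteq> {c i, c j} \<inter> {c a, c b}" by auto
  show "{c i, c j} \<noteq> {c a, c b}" using d by (auto simp: doubleton_eq_iff)
qed

end

text \<open>Ordering by the slope \<open>key\<close> around the leftmost point \<open>p0\<close>
  makes all triangles with \<open>p0\<close> counterclockwise. A wrongly oriented triple of other
  points would put its middle point into the triangle of \<open>p0\<close> and the other two,
  against convex position.\<close>

lemma convex_position_chain:
  assumes fin: "finite Q" and inj: "inj_on fst Q"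
    and gen: "\<And>p q r. p \<in> Q \<Longrightarrow> q \<in> Q \<Longrightarrow> r \<in> Q \<Longrightarrow> p \<noteq> q \<Longrightarrow> q \<noteq> r \<Longrightarrow> p \<noteq> r \<Longrightarrow> cross p q r \<noteq> 0"
    and conv: "\<And>p. p \<in> Q \<Longrightarrow> p \<notin> convex hull (Q - {p})"
  shows "\<exists>c. bij_betw c {..<card Q} Q \<and> ccw_chain c (card Q)"
proof (cases "Q = {}")
  case True
  then show ?thesis by (auto simp: ccw_chain_def bij_betw_def)
next
  case False
  obtain p0 where p0: "p0 \<in> Q" "\<And>q. q \<in> Q \<Longrightarrow> fst p0 \<le> fst q"
    by (metis False arg_min_if_finite(1) arg_min_least fin)
  let ?A = "Q - {p0}"
  define key where "key = (\<lambda>q. (snd q - snd p0) / (fst q - fst p0))"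
  have lt: "fst p0 < fst q" if "q \<in> ?A" for q
    using p0 that inj by (metis DiffD1 DiffD2 inj_onD insertI1 less_le)
  have cross_key: "0 < cross p0 q r \<longleftrightarrow> key q < key r" if "q \<in> ?A" "r \<in> ?A" for q r
  proof -
    have "key q < key r \<longleftrightarrow> (snd q - snd p0) * (fst r - fst p0) < (snd r - snd p0) * (fst q - fst p0)"
      unfolding key_def using lt[OF that(1)] lt[OF that(2)] by (subst frac_less_eq) (auto simp: divide_less_0_iff mult_less_0_iff zero_less_mult_iff)
    then show ?thesis by (simp add: cross_def algebra_simps)
  qed
  have "inj_on key ?A"
  proof (rule inj_onI)
    fix q r assume q: "q \<in> ?A" and r: "r \<in> ?A" and eq: "key q = key r"
    have "\<not> 0 < cross p0 q r" "\<not> 0 < cross p0 r q" using cross_key[OF q r] cross_key[OF r q] eq by auto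
    moreover have "cross p0 r q = - cross p0 q r" by (simp add: cross_def)
    ultimately have "cross p0 q r = 0" by simp
    then show "q = r" using gen[of p0 q r] p0(1) q r by auto
  qed
  then obtain v where v: "bij_betw v {..<card ?A} ?A" and key: "\<And>i j. i < j \<Longrightarrow> j < card ?A \<Longrightarrow> key (v i) < key (v j)"
    using ordered_enumeration[of ?A key] fin by auto
  have card: "card Q = Suc (card ?A)" using p0(1) fin by (metis card_Suc_Diff1)
  define c where "c = (\<lambda>i. case i of 0 \<Rightarrow> p0 | Suc j \<Rightarrow> v j)"
  have vA: "v j \<in> ?A" if "j < card ?A" for j using v that by (auto simp: bij_betw_def)
  have bij: "bij_betw c {..<card Q} Q"
  proof -
    have "c ` {..<card Q} = insert p0 (v ` {..<card ?A})"
      unfolding card lessThan_Suc_eq_insert_0 by (simp add: c_def image_image)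
    also have "\<dots> = Q" using v p0(1) by (auto simp: bij_betw_def)
    finally have im: "c ` {..<card Q} = Q" .
    moreover have "inj_on c {..<card Q}" by (rule eq_card_imp_inj_on) (simp_all add: im)
    ultimately show ?thesis by (simp add: bij_betw_def)
  qed
  have "0 < cross (c i) (c j) (c l)" if ijl: "i < j" "j < l" "l < card Q" for i j l
  proof -
    have jl: "j = Suc (j - 1)" "l = Suc (l - 1)" using ijl by simp_all
    define j' l' where "j' = j - 1" and "l' = l - 1"
    note jl = jl[folded j'_def l'_def]
    have std_form: "v j' \<in> ?A" "v l' \<in> ?A" using vA ijl jl card by auto
    have c0: "0 < cross p0 (v j') (v l')" using key[of j' l'] ijl jl card cross_key[OF std_form] by simp
    show ?thesis
    proof (cases i)
      case 0
      then show ?thesis using c0 jl by (simp add: c_def)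
    next
      case (Suc i')
      have I: "v i' \<in> ?A" using vA ijl Suc card by auto
      have ij: "0 < cross p0 (v i') (v j')" using key[of i' j'] ijl jl Suc card cross_key[OF I std_form(1)] by simp
      have il: "0 < cross p0 (v i') (v l')" using key[of i' l'] ijl jl Suc card cross_key[OF I std_form(2)] by simp
      have vinj: "v a = v b \<longleftrightarrow> a = b" if "a < card ?A" "b < card ?A" for a b
        using v that by (auto simp: bij_betw_def dest: inj_onD)
      have ne: "v i' \<noteq> v j'" "v j' \<noteq> v l'" "v i' \<noteq> v l'" using vinj ijl jl Suc card by auto
      have "0 < cross (v i') (v j') (v l')"
      proof (rule ccontr)
        assume neg: "\<not> ?thesis"
        let ?D = "cross p0 (v i') (v l')"
        let ?a = "cross (v i') (v l') (v j') / ?D" and ?b = "cross (v l') p0 (v j') / ?D" and ?g = "cross p0 (v i') (v j') / ?D"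
        have comb: "v j' = ?a *\<^sub>R p0 + ?b *\<^sub>R v i' + ?g *\<^sub>R v l'"
          by (rule barycentric_combination) (use il in simp)
        have "cross (v i') (v l') (v j') = - cross (v i') (v j') (v l')" by (simp add: cross_def)
        then have nn: "0 \<le> ?a" using neg il by (intro divide_nonneg_nonneg) auto
        have "cross (v l') p0 (v j') = cross p0 (v j') (v l')" by (simp add: cross_def algebra_simps)
        then have nn2: "0 \<le> ?b" "0 \<le> ?g" using c0 ij il by simp_all
        have one: "?a + ?b + ?g = 1"
          using cross_sum[of "v i'" "v l'" "v j'" p0] il by (simp add: add_divide_distrib[symmetric])
        have "v j' \<in> convex hull {p0, v i', v l'}"
          unfolding convex_hull_3 using comb nn nn2 one by blast
        moreover have "{p0, v i', v l'} \<subseteq> Q - {v j'}" using p0(1) I std_form ne by auto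
        ultimately have "v j' \<in> convex hull (Q - {v j'})" using hull_mono by blast
        then show False using conv[of "v j'"] std_form by auto
      qed
      then show ?thesis using Suc jl by (simp add: c_def)
    qed
  qed
  then have "ccw_chain c (card Q)" unfolding ccw_chain_def by blast
  with bij show ?thesis by blast
qed

text \<open>Different members contain a crossing pair of edges, so no crossing-free graph contains
  both. For fewer than three points the exponent is truncated to 0 and the empty edge set alone
  serves.\<close>

theorem convex_position_families:
  assumes fin: "finite Q" and inj: "inj_on fst Q"
    and gen: "\<And>p q r. p \<in> Q \<Longrightarrow> q \<in> Q \<Longrightarrow> r \<in> Q \<Longrightarrow> p \<noteq> q \<Longrightarrow> q \<noteq> r \<Longrightarrow> p \<noteq> r \<Longrightarrow> cross p q r \<noteq> 0"
    and conv: "\<And>p. p \<in> Q \<Longrightarrow> p \<notin> convex hull (Q - {p})"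
  shows "\<exists>F. finite F \<and> card F = 2 ^ (card Q - 3) \<and> (\<forall>D\<in>F. crossing_free Q D) \<and>
    (\<forall>D\<in>F. \<forall>D'\<in>F. D \<noteq> D' \<longrightarrow> (\<exists>d\<in>D. \<exists>d'\<in>D'. d \<noteq> d' \<and> convex hull d \<inter> convex hull d' \<noteq> d \<inter> d'))"
proof (cases "card Q < 3")
  case True
  then show ?thesis by (intro exI[of _ "{{}}"]) (auto simp: crossing_free_def)
next
  case False
  define m where "m = card Q - 3"
  have k: "card Q = m + 3" using False by (simp add: m_def)
  obtain c where c: "bij_betw c {..<card Q} Q" "ccw_chain c (card Q)"
    using convex_position_chain[OF fin inj gen conv] by blast
  interpret ccw_chain c "card Q" by (rule c(2))
  obtain F where F': "finite F" "card F = 2 ^ m"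
    "\<forall>D\<in>F. (\<forall>x\<in>D. 0 \<le> fst x \<and> fst x < snd x \<and> snd x \<le> 0 + m + 2) \<and> (\<forall>x\<in>D. \<forall>y\<in>D. \<not> interleaved x y)"
    "\<forall>D\<in>F. \<forall>D'\<in>F. D \<noteq> D' \<longrightarrow> (\<exists>x\<in>D. \<exists>y\<in>D'. interleaved x y \<or> interleaved y x)"
    using chord_families[of m 0] by (elim exE conjE)
  have F: "finite F" "card F = 2 ^ m"
    "\<And>D x. D \<in> F \<Longrightarrow> x \<in> D \<Longrightarrow> fst x < snd x \<and> snd x < card Q"
    "\<And>D x y. D \<in> F \<Longrightarrow> x \<in> D \<Longrightarrow> y \<in> D \<Longrightarrow> \<not> interleaved x y"
    "\<And>D D'. D \<in> F \<Longrightarrow> D' \<in> F \<Longrightarrow> D \<noteq> D' \<Longrightarrow> \<exists>x\<in>D. \<exists>y\<in>D'. interleaved x y \<or> interleaved y x"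
    subgoal by (rule F'(1))
    subgoal by (rule F'(2))
    subgoal for D x using bspec[OF F'(3), of D] k by fastforce
    subgoal for D x y using bspec[OF F'(3), of D] by blast
    subgoal for D D' using F'(4) by blast
    done
  define ch where "ch = (\<lambda>x. {c (fst x), c (snd x)})"
  have cinj: "c a = c b \<longleftrightarrow> a = b" if "a < card Q" "b < card Q" for a b
    using c(1) that by (auto simp: bij_betw_def dest: inj_onD)
  have cQ: "c a \<in> Q" if "a < card Q" for a using c(1) that by (auto simp: bij_betw_def)
  have cf: "crossing_free Q (ch ` D)" if D: "D \<in> F" for D
    unfolding crossing_free_def
  proof (intro conjI ballI impI)
    fix e assume "e \<in> ch ` D"
    then obtain x where x: "x \<in> D" "e = ch x" by blast
    then show "e \<subseteq> Q" "card e = 2" using F(3)[OF D x(1)] by (auto simp: ch_def cQ cinj card_2_iff doubleton_eq_iff)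
  next
    fix e f assume "e \<in> ch ` D" "f \<in> ch ` D" and ne: "e \<noteq> f"
    then obtain x y where x: "x \<in> D" "e = ch x" and y: "y \<in> D" "f = ch y" by blast
    show "convex hull e \<inter> convex hull f = e \<inter> f"
      unfolding x(2) y(2) ch_def
      by (rule chords_meet_only_at_ends) (use F(3)[OF D x(1)] F(3)[OF D y(1)] F(4)[OF D x(1) y(1)] F(4)[OF D y(1) x(1)] x y ne in \<open>auto simp: ch_def\<close>)
  qed
  have clash: "\<exists>d\<in>ch ` D. \<exists>d'\<in>ch ` D'. d \<noteq> d' \<and> convex hull d \<inter> convex hull d' \<noteq> d \<inter> d'"
    if D: "D \<in> F" "D' \<in> F" "D \<noteq> D'" for D D'
  proof -
    obtain x y where xy: "x \<in> D" "y \<in> D'" "interleaved x y \<or> interleaved y x" using F(5)[OF D] by blast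
    have "ch x \<noteq> ch y \<and> convex hull (ch x) \<inter> convex hull (ch y) \<noteq> ch x \<inter> ch y"
      using xy(3)
    proof
      assume "interleaved x y"
      then show ?thesis
        using chords_cross[of "fst x" "fst y" "snd x" "snd y"] F(3)[OF D(2) xy(2)] by (simp add: interleaved_def ch_def)
    next
      assume "interleaved y x"
      then show ?thesis
        using chords_cross[of "fst y" "fst x" "snd y" "snd x"] F(3)[OF D(1) xy(1)] by (simp add: interleaved_def ch_def Int_commute eq_commute)
    qed
    then show ?thesis using xy by blast
  qed
  have "inj_on (image ch) F"
  proof (rule inj_onI, rule ccontr)
    fix D D' assume D: "D \<in> F" "D' \<in> F" "ch ` D = ch ` D'" "D \<noteq> D'"
    then show False using clash[OF D(1,2,4)] cf[OF D(1)] unfolding crossing_free_def by metis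
  qed
  then have "card (image ch ` F) = 2 ^ (card Q - 3)" using F(2) by (simp add: card_image m_def)
  moreover have "\<forall>D\<in>image ch ` F. \<forall>D'\<in>image ch ` F. D \<noteq> D' \<longrightarrow>
      (\<exists>d\<in>D. \<exists>d'\<in>D'. d \<noteq> d' \<and> convex hull d \<inter> convex hull d' \<noteq> d \<inter> d')"
  proof (intro ballI impI)
    fix E E' assume "E \<in> image ch ` F" "E' \<in> image ch ` F" and ne: "E \<noteq> E'"
    then obtain D D' where D: "D \<in> F" "D' \<in> F" "E = ch ` D" "E' = ch ` D'" by (elim imageE)
    then have "D \<noteq> D'" using ne by auto
    then show "\<exists>d\<in>E. \<exists>d'\<in>E'. d \<noteq> d' \<and> convex hull d \<inter> convex hull d' \<noteq> d \<inter> d'"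
      unfolding D(3,4) by (rule clash[OF D(1,2)])
  qed
  ultimately show ?thesis using F(1) cf by (intro exI[of _ "image ch ` F"]) auto
qed

section \<open>Triangulations containing a matching\<close>

definition maximal_graph :: "pt set \<Rightarrow> pt set set \<Rightarrow> bool" where
  "maximal_graph S T \<longleftrightarrow> crossing_free S T \<and> (\<forall>E. crossing_free S E \<and> T \<subseteq> E \<longrightarrow> E = T)"

lemma crossing_free_subset_Pow: "crossing_free S E \<Longrightarrow> E \<subseteq> Pow S"
  by (auto simp: crossing_free_def)

lemma maximal_graph_extends:
  assumes "finite S" "crossing_free S E"
  shows "\<exists>T. maximal_graph S T \<and> E \<subseteq> T"
proof -
  let ?A = "{T. crossing_free S T}"
  have "finite ?A" by (rule finite_subset[of _ "Pow (Pow S)"]) (use assms crossing_free_subset_Pow in auto)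
  then obtain T where "T \<in> ?A" "E \<subseteq> T" "\<forall>F\<in>?A. T \<subseteq> F \<longrightarrow> T = F"
    using finite_has_maximal2[of ?A E] assms by auto
  then show ?thesis unfolding maximal_graph_def by blast
qed

locale matched_points = point_set +
  fixes M :: "pt set set"
  assumes general: "\<And>p q r. p \<in> S \<Longrightarrow> q \<in> S \<Longrightarrow> r \<in> S \<Longrightarrow> p \<noteq> q \<Longrightarrow> q \<noteq> r \<Longrightarrow> p \<noteq> r \<Longrightarrow> cross p q r \<noteq> 0"
    and cf: "crossing_free S M" and pm: "perfect_matching S M"
begin

sublocale plane_graph S M by unfold_locales (rule cf)

definition radius :: real where "radius = Max (insert 0 ((\<lambda>p. \<bar>fst p\<bar>) ` S)) + 1"

lemma radius: "p \<in> S \<Longrightarrow> - radius < fst p \<and> fst p < radius"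
proof -
  assume "p \<in> S"
  then have "\<bar>fst p\<bar> \<le> Max (insert 0 ((\<lambda>p. \<bar>fst p\<bar>) ` S))" using finite_S by (intro Max_ge) auto
  then show ?thesis unfolding radius_def by linarith
qed

lemma cross_height:
  assumes "e \<subseteq> S" "card e = 2"
  shows "cross (lft e) (rgt e) p = (fst (rgt e) - fst (lft e)) * (snd p - height e (fst p))"
  using edge_ends(2)[OF assms] by (simp add: cross_def height_eq slope_def field_simps)

lemma off_line:
  assumes e: "e \<in> M" and p: "p \<in> S" "p \<notin> e"
  shows "snd p \<noteq> height e (fst p)"
proof
  assume h: "snd p = height e (fst p)"
  note E = E_ends[OF e e]
  have "lft e \<in> e" "rgt e \<in> e" using E(1) by auto
  then have "p \<noteq> lft e" "p \<noteq> rgt e" using p(2) by auto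
  moreover have "lft e \<noteq> rgt e" using E(2) by auto
  ultimately have "cross (lft e) (rgt e) p \<noteq> 0" using general E(3,4) p(1) by metis
  then show False using h cross_height[OF edge[OF e]] by simp
qed

lemma edges_disjoint: "e \<in> M \<Longrightarrow> f \<in> M \<Longrightarrow> e \<noteq> f \<Longrightarrow> e \<inter> f = {}"
  using perfect_matching_disjoint[OF pm] by blast

text \<open>General position enters here: no end of an edge lies on the line of another
  edge.\<close>

lemma family: "segment_family M height (\<lambda>e. fst (lft e)) (\<lambda>e. fst (rgt e)) radius"
proof
  show "finite M" by (rule finite_E)
  show "\<exists>c d. \<forall>x. height e x = c + d * x" for e
    by (rule exI[of _ "snd (lft e) - slope e * fst (lft e)"], rule exI[of _ "slope e"]) (simp add: height_eq algebra_simps)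
  show "- radius < fst (lft e) \<and> fst (lft e) < fst (rgt e) \<and> fst (rgt e) < radius" if "e \<in> M" for e
    using E_ends[OF that that] radius by blast
  show "height e x \<noteq> height f x" if "e \<in> M" "f \<in> M" "e \<noteq> f" "x \<in> {fst (lft e)..fst (rgt e)}" "x \<in> {fst (lft f)..fst (rgt f)}" for e f x
    using height_neq[OF that(1,2) edges_disjoint[OF that(1-3)]] that(4,5) by (simp add: xspan_def)
  show "height e (fst (lft f)) \<noteq> height f (fst (lft f)) \<and> height e (fst (rgt f)) \<noteq> height f (fst (rgt f))"
    if "e \<in> M" "f \<in> M" "e \<noteq> f" for e f
  proof -
    note F = E_ends[OF that(2,2)] E_height_ends[OF that(2,2)]
    have "lft f \<in> f" "rgt f \<in> f" using F(1) by auto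
    then have "lft f \<notin> e" "rgt f \<notin> e" using edges_disjoint[OF that] by auto
    then show ?thesis using off_line[OF that(1)] F by metis
  qed
qed

definition own :: "pt \<Rightarrow> pt set" where "own p = (THE e. e \<in> M \<and> p \<in> e)"

lemma own_edge: "p \<in> S \<Longrightarrow> own p \<in> M" "p \<in> S \<Longrightarrow> p \<in> own p"
proof -
  assume "p \<in> S"
  then have "\<exists>!e. e \<in> M \<and> p \<in> e" using pm by (simp add: perfect_matching_def)
  from theI'[OF this] show "own p \<in> M" "p \<in> own p" by (simp_all add: own_def)
qed

lemma own_eq: "e \<in> M \<Longrightarrow> p \<in> e \<Longrightarrow> own p = e"
proof -
  assume e: "e \<in> M" "p \<in> e"
  then have "p \<in> S" using edge(1) by blast
  from perfect_matching_disjoint[OF pm own_edge(1)[OF this] e(1) own_edge(2)[OF this] e(2)]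
  show "own p = e" .
qed

lemma arrangement_exists: "\<exists>lo hi. arrangement_points M height lo hi radius S own \<and>
   (\<forall>e\<in>M. lo e < fst (lft e) \<and> fst (rgt e) < hi e)"
proof -
  interpret fam: segment_family M height "\<lambda>e. fst (lft e)" "\<lambda>e. fst (rgt e)" radius by (rule family)
  obtain lo hi where ext: "fam.extension lo hi M M" using fam.full_extension by blast
  have dis: "disjoint_interiors M height lo hi"
    and bnd: "\<And>e. e \<in> M \<Longrightarrow> - radius \<le> lo e \<and> hi e \<le> radius \<and> lo e < fst (lft e) \<and> fst (rgt e) < hi e"
    and l: "\<And>e. e \<in> M \<Longrightarrow> lo e = - radius \<or> blocked M height lo hi e (lo e)"
    and r: "\<And>e. e \<in> M \<Longrightarrow> hi e = radius \<or> blocked M height lo hi e (hi e)"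
    using ext unfolding fam.extension_def by auto
  have "arrangement_points M height lo hi radius S own"
  proof
    show "finite M" by (rule finite_E)
    show "\<exists>c d. \<forall>x. height e x = c + d * x" for e by (rule fam.affine_h)
    show "- radius \<le> lo e \<and> lo e < hi e \<and> hi e \<le> radius" if "e \<in> M" for e
      using bnd[OF that] E_ends(2)[OF that that] by linarith
    show "disjoint_interiors M height lo hi" by (rule dis)
    show "lo e = - radius \<or> blocked M height lo hi e (lo e)" if "e \<in> M" for e by (rule l[OF that])
    show "hi e = radius \<or> blocked M height lo hi e (hi e)" if "e \<in> M" for e by (rule r[OF that])
    show "\<exists>x. height e x \<noteq> height f x" if "e \<in> M" "f \<in> M" "e \<noteq> f" for e f using fam.generic[OF that] by blast
    show "finite S" by (rule finite_S)
    show "own p \<in> M \<and> lo (own p) < fst p \<and> fst p < hi (own p) \<and> snd p = height (own p) (fst p)" if p: "p \<in> S" for p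
    proof -
      note o = own_edge[OF p]
      have "p = lft (own p) \<or> p = rgt (own p)" using E_ends(1)[OF o(1,1)] o(2) by blast
      then show ?thesis
        using bnd[OF o(1)] E_height_ends[OF o(1,1)] E_ends(2)[OF o(1,1)] o(1) by (elim disjE) force+
    qed
    show "snd p \<noteq> height f (fst p)" if "p \<in> S" "f \<in> M" "f \<noteq> own p" for p f
      using off_line[OF that(2,1)] own_eq[OF that(2), of p] that(3) by blast
  qed
  then show ?thesis using bnd by blast
qed

lemma partner:
  assumes "p \<in> S"
  shows "\<exists>w. own p = {p, w} \<and> p \<noteq> w"
proof -
  have "card (own p) = 2" using edge(2) own_edge(1) assms by blast
  then obtain a b where "own p = {a, b}" "a \<noteq> b" by (auto simp: card_2_iff)
  then show ?thesis using own_edge(2)[OF assms] by (metis insertE insert_commute singletonD)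
qed

context
  fixes lo hi
  assumes arr: "arrangement_points M height lo hi radius S own"
    and bounds: "\<And>e. e \<in> M \<Longrightarrow> lo e < fst (lft e) \<and> fst (rgt e) < hi e"
begin

interpretation arrangement_points M height lo hi radius S own by (rule arr)

text \<open>The line of \<open>own p\<close> supports the cell. All other members are strictly on
  its positive side, except possibly the partner \<open>w\<close> of \<open>p\<close>. The open
  half-plane together with the single point \<open>w\<close> is still convex and does not contain
  \<open>p\<close>.\<close>

lemma members_convex_position:
  assumes p: "p \<in> members C"
  shows "p \<notin> convex hull (members C - {p})"
proof -
  have pS: "p \<in> S" using p by (simp add: members_def)
  obtain s where s: "s * s = 1" "corner p s = C" using p by (auto simp: members_def)
  obtain w where w: "own p = {p, w}" "p \<noteq> w" using partner[OF pS] by blast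
  have wM: "w \<in> own p" using w by simp
  have w0: "side p s w = 0"
  proof -
    have "w \<in> S" using wM edge(1)[OF own_edge(1)[OF pS]] by blast
    then have "snd w = height (own w) (fst w)" using own by blast
    then show ?thesis using own_eq[OF own_edge(1)[OF pS] wM] by (simp add: side_def)
  qed
  let ?H = "insert w {z. 0 < side p s z}"
  have "convex ?H"
    unfolding convex_alt
  proof (intro ballI allI impI)
    fix x y and u :: real assume x: "x \<in> ?H" and y: "y \<in> ?H" and u: "0 \<le> u \<and> u \<le> 1"
    show "(1 - u) *\<^sub>R x + u *\<^sub>R y \<in> ?H"
    proof (cases "(x = w \<or> u = 1) \<and> (y = w \<or> u = 0)")
      case True
      then have "(1 - u) *\<^sub>R x + u *\<^sub>R y = w \<or> (1 - u) *\<^sub>R x + u *\<^sub>R y = x \<or> (1 - u) *\<^sub>R x + u *\<^sub>R y = y"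
        by (auto simp: algebra_simps)
      then show ?thesis using x y by auto
    next
      case False
      have nn: "0 \<le> (1 - u) * side p s x" "0 \<le> u * side p s y" using x y u w0 by auto
      have "0 < (1 - u) * side p s x \<or> 0 < u * side p s y" using False x y u by auto
      then have "0 < side p s ((1 - u) *\<^sub>R x + u *\<^sub>R y)" unfolding side_combination using nn by linarith
      then show ?thesis by simp
    qed
  qed
  moreover have "members C - {p} \<subseteq> ?H"
  proof
    fix q assume q: "q \<in> members C - {p}"
    then obtain t where t: "q \<in> S" "t * t = 1" "corner q t = C" by (auto simp: members_def)
    show "q \<in> ?H"
    proof (cases "own p = own q")
      case True
      then have "q \<in> {p, w}" using own_edge(2)[OF t(1)] w by simp
      then show ?thesis using q by auto
    next
      case False
      then show ?thesis using corner_side_point(2)[OF pS t(1) s(1) t(2)] s(2) t(3) by simp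
    qed
  qed
  ultimately have "convex hull (members C - {p}) \<subseteq> ?H" by (intro hull_minimal)
  moreover have "p \<notin> ?H" using w side_self[OF pS] by simp
  ultimately show ?thesis by blast
qed

definition family_ok :: "pt set \<Rightarrow> pt set set set \<Rightarrow> bool" where
  "family_ok C F \<longleftrightarrow> finite F \<and> card F = 2 ^ (card (members C) - 3) \<and> (\<forall>D\<in>F. crossing_free (members C) D) \<and>
    (\<forall>D\<in>F. \<forall>D'\<in>F. D \<noteq> D' \<longrightarrow> (\<exists>d\<in>D. \<exists>d'\<in>D'. d \<noteq> d' \<and> convex hull d \<inter> convex hull d' \<noteq> d \<inter> d'))"

lemma members_subset: "members C \<subseteq> S"
  by (auto simp: members_def)

lemma family_exists: "\<exists>F. family_ok C F"
  unfolding family_ok_def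
proof (rule convex_position_families)
  show "finite (members C)" using finite_subset[OF members_subset finite_S] .
  show "inj_on fst (members C)" using inj_on_subset[OF inj_fst members_subset] .
  show "\<And>p q r. p \<in> members C \<Longrightarrow> q \<in> members C \<Longrightarrow> r \<in> members C \<Longrightarrow> p \<noteq> q \<Longrightarrow> q \<noteq> r \<Longrightarrow> p \<noteq> r \<Longrightarrow> cross p q r \<noteq> 0"
    using general members_subset by blast
  show "\<And>p. p \<in> members C \<Longrightarrow> p \<notin> convex hull (members C - {p})" by (rule members_convex_position)
qed

lemma edge_not_free:
  assumes "d \<in> M" "z \<in> convex hull d"
  shows "z \<notin> free"
proof -
  have "z \<in> seg d"
    using assms(2) bounds[OF assms(1)] unfolding convex_hull_edge[OF edge[OF assms(1)]]
    by (auto simp: seg_def xspan_def)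
  then show ?thesis using assms(1) by (auto simp: free_def)
qed

lemma point_not_free:
  assumes "p \<in> S"
  shows "p \<notin> free"
  using edge_not_free[OF own_edge(1)[OF assms]] own_edge(2)[OF assms] hull_inc[of p "own p" convex] by blast

text \<open>
  A chord that is not an edge of the matching joins points on different segments, so its interior lies in the cell.
\<close>

lemma chord_body:
  assumes d: "d \<subseteq> members C" "card d = 2" "d \<notin> M"
  shows "convex hull d \<subseteq> d \<union> C"
proof -
  obtain p q where pq: "d = {p, q}" "p \<noteq> q" using d(2) by (auto simp: card_2_iff)
  obtain s where s: "p \<in> S" "s * s = 1" "corner p s = C" using d(1) pq by (auto simp: members_def)
  obtain t where t: "q \<in> S" "t * t = 1" "corner q t = C" using d(1) pq by (auto simp: members_def)
  have "own p \<noteq> own q"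
  proof
    assume eq: "own p = own q"
    have "card (own p) = 2" "finite (own p)" using edge(2)[OF own_edge(1)[OF s(1)]] by (auto intro: card_ge_0_finite)
    moreover have "d \<subseteq> own p" using own_edge(2) s(1) t(1) eq pq(1) by blast
    ultimately have "d = own p" using d(2) card_subset_eq by metis
    then show False using d(3) own_edge(1)[OF s(1)] by simp
  qed
  then have "open_segment p q \<subseteq> C"
    using open_chord_in_corner[OF s(1) t(1) s(2) t(2)] s(3) t(3) by simp
  moreover have "convex hull d = closed_segment p q" by (simp add: pq(1) segment_convex_hull)
  ultimately show ?thesis unfolding closed_segment_eq_open pq(1) by blast
qed

lemma corner_free: "C \<in> corners \<Longrightarrow> C \<subseteq> free"
  using corners_subset cell_free by blast

lemma corners_disjoint: "C \<in> corners \<Longrightarrow> C' \<in> corners \<Longrightarrow> C \<noteq> C' \<Longrightarrow> C \<inter> C' = {}"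
  using corners_subset cell_eq by blast

definition assemble :: "(pt set \<Rightarrow> pt set set) \<Rightarrow> pt set set" where
  "assemble g = M \<union> (\<Union>C\<in>corners. g C)"

text \<open>Chords outside \<open>M\<close> have their interiors in cells, which are disjoint from
  each other and from all matching edges and points. Meetings of edges from different sources thus
  occur only at points of \<open>S\<close>. Chords that happen to be edges of \<open>M\<close> are
  treated as such.\<close>

lemma crossing_free_assemble:
  assumes g: "\<And>C. C \<in> corners \<Longrightarrow> crossing_free (members C) (g C)"
  shows "crossing_free S (assemble g)"
proof -
  have gd: "d \<subseteq> members C" "card d = 2" if "C \<in> corners" "d \<in> g C" for C d
    using g[OF that(1)] that(2) by (auto simp: crossing_free_def)
  have mixed: "z \<in> d" if d: "d \<in> M" and C: "C \<in> corners" "d' \<in> g C" "d' \<notin> M" and z: "z \<in> convex hull d" "z \<in> convex hull d'" for d d' C z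
  proof -
    have "z \<in> d'" using chord_body[OF gd[OF C(1,2)] C(3)] z corner_free[OF C(1)] edge_not_free[OF d z(1)] by blast
    then have zS: "z \<in> S" using gd[OF C(1,2)] members_subset by blast
    \<comment> \<open>A point of \<open>S\<close> on the segment \<open>d\<close> is an end of it,
      by \<open>off_line\<close>.\<close>
    show "z \<in> d"
    proof (rule ccontr)
      assume "z \<notin> d"
      then have "snd z \<noteq> height d (fst z)" by (rule off_line[OF d zS])
      then show False using z(1) unfolding convex_hull_edge[OF edge[OF d]] by auto
    qed
  qed
  have mixed': "z \<in> d'" if d: "d \<in> M" and C: "C \<in> corners" "d' \<in> g C" "d' \<notin> M" and z: "z \<in> convex hull d" "z \<in> convex hull d'" for d d' C z
    using chord_body[OF gd[OF C(1,2)] C(3)] z corner_free[OF C(1)] edge_not_free[OF d z(1)] by blast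
  have meet: "convex hull d \<inter> convex hull d' \<subseteq> d \<inter> d'" if d: "d \<in> assemble g" and d': "d' \<in> assemble g" and ne: "d \<noteq> d'" for d d'
  proof
    fix z assume z: "z \<in> convex hull d \<inter> convex hull d'"
    consider "d \<in> M" "d' \<in> M" | C where "d \<in> M" "d' \<notin> M" "C \<in> corners" "d' \<in> g C"
      | C where "d' \<in> M" "d \<notin> M" "C \<in> corners" "d \<in> g C"
      | C C' where "d \<notin> M" "d' \<notin> M" "C \<in> corners" "d \<in> g C" "C' \<in> corners" "d' \<in> g C'"
      using d d' unfolding assemble_def by blast
    then show "z \<in> d \<inter> d'"
    proof cases
      case 1
      then show ?thesis using cf ne z unfolding crossing_free_def by blast
    next
      case 2
      then show ?thesis using mixed[OF 2(1,3,4,2)] mixed'[OF 2(1,3,4,2)] z by blast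
    next
      case 3
      then show ?thesis using mixed[OF 3(1,3,4,2)] mixed'[OF 3(1,3,4,2)] z by blast
    next
      case 4
      show ?thesis
      proof (cases "C = C'")
        case True
        then show ?thesis using g[OF 4(3)] 4 ne z unfolding crossing_free_def by blast
      next
        case False
        have b: "z \<in> d \<or> z \<in> C" "z \<in> d' \<or> z \<in> C'"
          using chord_body[OF gd[OF 4(3,4)] 4(1)] chord_body[OF gd[OF 4(5,6)] 4(2)] z by blast+
        have "z \<notin> S" if "z \<in> C \<or> z \<in> C'"
          using that corner_free[OF 4(3)] corner_free[OF 4(5)] point_not_free by blast
        moreover have "z \<in> S" if "z \<in> d \<or> z \<in> d'"
          using that gd[OF 4(3,4)] gd[OF 4(5,6)] members_subset by blast
        moreover have "\<not> (z \<in> C \<and> z \<in> C')" using corners_disjoint[OF 4(3,5) False] by blast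
        ultimately show ?thesis using b by blast
      qed
    qed
  qed
  show ?thesis
    unfolding crossing_free_def
  proof (intro conjI ballI impI)
    fix d assume "d \<in> assemble g"
    then consider "d \<in> M" | C where "C \<in> corners" "d \<in> g C" unfolding assemble_def by blast
    then have "d \<subseteq> S \<and> card d = 2"
    proof cases
      case 1
      then show ?thesis using edge by simp
    next
      case 2
      from gd[OF this] show ?thesis using members_subset by (meson order_trans)
    qed
    then show "d \<subseteq> S" "card d = 2" by simp_all
  next
    fix d d' assume "d \<in> assemble g" "d' \<in> assemble g" "d \<noteq> d'"
    from meet[OF this] show "convex hull d \<inter> convex hull d' = d \<inter> d'"
      using hull_subset[of d convex] hull_subset[of d' convex] by blast
  qed
qed

text \<open>One family is chosen independently in each cell. Different choices contain crossing
  edges, so their maximal extensions differ and the numbers of choices multiply.\<close>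

lemma many_maximal_graphs:
  "2 ^ (card M - 3) \<le> card {T. maximal_graph S T \<and> M \<subseteq> T}"
proof -
  have "\<forall>C. \<exists>F. family_ok C F" using family_exists by blast
  then obtain F where F: "\<And>C. family_ok C (F C)" by metis
  let ?P = "PiE corners F"
  have gC: "crossing_free (members C) (g C)" if "g \<in> ?P" "C \<in> corners" for g C
    using F[of C] PiE_mem[OF that] by (simp add: family_ok_def)
  have "\<forall>g\<in>?P. \<exists>T. maximal_graph S T \<and> assemble g \<subseteq> T"
    using maximal_graph_extends[OF finite_S crossing_free_assemble] gC by blast
  then obtain T where T: "\<And>g. g \<in> ?P \<Longrightarrow> maximal_graph S (T g) \<and> assemble g \<subseteq> T g" by metis
  have "inj_on T ?P"
  proof (rule inj_onI, rule ccontr)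
    fix g g' assume g: "g \<in> ?P" "g' \<in> ?P" and eq: "T g = T g'" and ne: "g \<noteq> g'"
    obtain C where C: "C \<in> corners" "g C \<noteq> g' C" using PiE_ext[OF g] ne by blast
    have "g C \<in> F C" "g' C \<in> F C" using PiE_mem[OF g(1) C(1)] PiE_mem[OF g(2) C(1)] .
    then obtain d d' where d: "d \<in> g C" "d' \<in> g' C" "d \<noteq> d'" "convex hull d \<inter> convex hull d' \<noteq> d \<inter> d'"
      using F[of C] C(2) unfolding family_ok_def by blast
    have "d \<in> T g" "d' \<in> T g" using T[OF g(1)] T[OF g(2)] d C(1) eq unfolding assemble_def by blast+
    then show False using T[OF g(1)] d unfolding maximal_graph_def crossing_free_def by blast
  qed
  moreover have "T ` ?P \<subseteq> {T. maximal_graph S T \<and> M \<subseteq> T}" using T unfolding assemble_def by blast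
  moreover have "finite {T. maximal_graph S T \<and> M \<subseteq> T}"
    by (rule finite_subset[of _ "Pow (Pow S)"]) (use finite_S crossing_free_subset_Pow in \<open>auto simp: maximal_graph_def\<close>)
  ultimately have "card ?P \<le> card {T. maximal_graph S T \<and> M \<subseteq> T}" by (rule card_inj_on_le)
  moreover have "card ?P = 2 ^ (\<Sum>C\<in>corners. card (members C) - 3)"
    using F finite_corners(1) by (simp add: card_PiE family_ok_def power_sum)
  \<comment> \<open>Since \<open>k <= (k - 3) + 3\<close> also for truncated differences, the
    incidences and the number of cells give
    \<open>4 * card M <= sum + 3 * (card M + 1)\<close>.\<close>
  moreover have "card M - 3 \<le> (\<Sum>C\<in>corners. card (members C) - 3)"
  proof -
    have "4 * card M = (\<Sum>C\<in>corners. card (members C))"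
      using sum_card_members card_perfect_matching[OF pm finite_S] by simp
    also have "\<dots> \<le> (\<Sum>C\<in>corners. (card (members C) - 3) + 3)" by (intro sum_mono) simp
    also have "\<dots> = (\<Sum>C\<in>corners. card (members C) - 3) + 3 * card corners" by (simp add: sum.distrib)
    finally show ?thesis using finite_corners(2) by simp
  qed
  moreover from this have "(2::nat) ^ (card M - 3) \<le> 2 ^ (\<Sum>C\<in>corners. card (members C) - 3)"
    by (rule power_increasing) simp
  ultimately show ?thesis by linarith
qed

end

theorem card_maximal_graphs_containing: "2 ^ (card M - 3) \<le> card {T. maximal_graph S T \<and> M \<subseteq> T}"
  using arrangement_exists many_maximal_graphs by blast

end

section \<open>Matchings versus triangulations\<close>

lemma double_counting:
  assumes "finite A" "finite B"
  shows "(\<Sum>a\<in>A. card {b \<in> B. R a b}) = (\<Sum>b\<in>B. card {a \<in> A. R a b})"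
proof -
  have "(\<Sum>a\<in>A. card {b \<in> B. R a b}) = (\<Sum>a\<in>A. \<Sum>b\<in>B. if R a b then 1 else 0)"
    using assms(2) by (intro sum.cong refl) (simp add: sum.If_cases Int_def)
  also have "\<dots> = (\<Sum>b\<in>B. \<Sum>a\<in>A. if R a b then 1 else 0)" by (rule sum.swap)
  also have "\<dots> = (\<Sum>b\<in>B. card {a \<in> A. R a b})"
    using assms(1) by (intro sum.cong refl) (simp add: sum.If_cases Int_def)
  finally show ?thesis .
qed

lemma matchings_le_maximal_graphs:
  fixes S :: "pt set"
  assumes fin: "finite S" and inj: "inj_on fst S"
    and gen: "\<And>p q r. p \<in> S \<Longrightarrow> q \<in> S \<Longrightarrow> r \<in> S \<Longrightarrow> p \<noteq> q \<Longrightarrow> q \<noteq> r \<Longrightarrow> p \<noteq> r \<Longrightarrow> cross p q r \<noteq> 0"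
  shows "real (card {M. crossing_free S M \<and> perfect_matching S M})
    \<le> 8 * (3 / 2) powr (real (card S) / 4) * real (card {T. maximal_graph S T})"
proof -
  interpret point_set S by unfold_locales (rule fin, rule inj)
  let ?A = "{M. crossing_free S M \<and> perfect_matching S M}" and ?B = "{T. maximal_graph S T}"
  have finA: "finite ?A" and finB: "finite ?B"
    by (rule finite_subset[of _ "Pow (Pow S)"]; use fin crossing_free_subset_Pow in \<open>auto simp: maximal_graph_def\<close>)+
  show ?thesis
  proof (cases "?A = {}")
    \<comment> \<open>No matching at all, as for odd \<open>card S\<close>.\<close>
    case True
    show ?thesis unfolding True by simp
  next
    case False
    define n where "n = card S div 2"
    have cM: "card S = 2 * card M" if "M \<in> ?A" for M using card_perfect_matching[OF _ fin] that by blast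
    then have n: "card S = 2 * n" and cn: "\<And>M. M \<in> ?A \<Longrightarrow> card M = n" using False by (auto simp: n_def)
    have lower: "2 ^ (n - 3) \<le> card {T \<in> ?B. M \<subseteq> T}" if "M \<in> ?A" for M
    proof -
      interpret matched_points S M
        by unfold_locales (use gen that in auto)
      show ?thesis using card_maximal_graphs_containing cn[OF that] by simp
    qed
    have upper: "real (card {M \<in> ?A. M \<subseteq> T}) \<le> 6 powr (real n / 2)" if "T \<in> ?B" for T
    proof -
      interpret plane_graph S T by unfold_locales (use that in \<open>simp add: maximal_graph_def\<close>)
      have "card {M \<in> ?A. M \<subseteq> T} \<le> card matchings"
        by (rule card_mono[OF finite_matchings]) (auto simp: matchings_def)
      then have "real (card {M \<in> ?A. M \<subseteq> T}) \<le> real (card matchings)" by simp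
      also have "\<dots> \<le> sqrt (6 ^ n)" by (rule real_le_rsqrt) (rule card_matchings_square_le[OF n])
      also have "\<dots> = 6 powr (real n / 2)"
        by (simp add: powr_half_sqrt[symmetric] powr_realpow[symmetric] powr_powr)
      finally show ?thesis .
    qed
    \<comment> \<open>The 8 absorbs the 3 in the exponent as well as its truncation for
      \<open>n < 3\<close>.\<close>
    have "real (card ?A) * 2 ^ n \<le> real (card ?A) * (8 * 2 ^ (n - 3))"
    proof (intro mult_left_mono)
      have "(2::real) ^ n \<le> 2 ^ (3 + (n - 3))" by (rule power_increasing) auto
      then show "(2::real) ^ n \<le> 8 * 2 ^ (n - 3)" by (simp add: power_add)
    qed simp
    also have "\<dots> = 8 * real (\<Sum>M\<in>?A. 2 ^ (n - 3))" by simp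
    also have "\<dots> \<le> 8 * real (\<Sum>M\<in>?A. card {T \<in> ?B. M \<subseteq> T})"
      using lower by (intro mult_left_mono, subst of_nat_le_iff, intro sum_mono) auto
    also have "\<dots> = 8 * real (\<Sum>T\<in>?B. card {M \<in> ?A. M \<subseteq> T})"
      by (simp only: double_counting[OF finA finB])
    also have "\<dots> = 8 * (\<Sum>T\<in>?B. real (card {M \<in> ?A. M \<subseteq> T}))" by simp
    also have "\<dots> \<le> 8 * (\<Sum>T\<in>?B. 6 powr (real n / 2))"
      using upper by (intro mult_left_mono sum_mono) auto
    also have "\<dots> = 8 * 6 powr (real n / 2) * real (card ?B)" by simp
    finally have main: "real (card ?A) * 2 ^ n \<le> 8 * 6 powr (real n / 2) * real (card ?B)" .
    \<comment> \<open>\<open>6 = (3 / 2) * 4\<close>, and the power of 4 cancels against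
      \<open>2 ^ n\<close>.\<close>
    have "(6::real) powr (real n / 2) = (3 / 2) powr (real n / 2) * 4 powr (real n / 2)"
      by (subst powr_mult[symmetric]) auto
    also have "(4::real) powr (real n / 2) = (2 powr 2) powr (real n / 2)" by simp
    also have "\<dots> = 2 ^ n" unfolding powr_powr by (simp add: powr_realpow)
    finally have "real (card ?A) * 2 ^ n \<le> 8 * (3 / 2) powr (real n / 2) * real (card ?B) * 2 ^ n"
      using main by (simp add: mult_ac)
    then have "real (card ?A) \<le> 8 * (3 / 2) powr (real n / 2) * real (card ?B)"
      by (rule mult_right_le_imp_le) simp
    then show ?thesis by (simp add: n)
  qed
qed

section \<open>Reduction to distinct first coordinates by a shear\<close>

definition shear :: "real \<Rightarrow> real ^ 2 \<Rightarrow> pt" where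
  "shear t p = (vec_nth p 1 + t * vec_nth p 2, vec_nth p 2)"

lemma linear_shear: "linear (shear t)"
  by (rule linearI) (simp_all add: shear_def algebra_simps)

lemma inj_shear: "inj (shear t)"
  by (rule injI) (auto simp: shear_def vec_eq_iff forall_2)

lemma surj_shear: "surj (shear t)"
proof (rule surjI)
  fix z show "shear t (vector [fst z - t * snd z, snd z]) = z"
    by (simp add: shear_def)
qed

text \<open>Each pair of points is bad for at most one \<open>t\<close>, so only finitely many
  values are excluded.\<close>

lemma shear_separates:
  assumes "finite S"
  shows "\<exists>t. inj_on (\<lambda>p. fst (shear t p)) S"
proof -
  let ?bad = "\<lambda>p q :: real ^ 2. {t. p \<noteq> q \<and> fst (shear t p) = fst (shear t q)}"
  have "finite (?bad p q)" for p q
  proof (cases "vec_nth p 2 = vec_nth q 2")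
    case True
    then have "?bad p q = {}" by (auto simp: shear_def vec_eq_iff forall_2)
    then show ?thesis by (simp only: finite.emptyI)
  next
    case False
    have "?bad p q \<subseteq> {(vec_nth q 1 - vec_nth p 1) / (vec_nth p 2 - vec_nth q 2)}"
      using False by (auto simp: shear_def field_simps)
    then show ?thesis by (rule finite_subset) simp
  qed
  then have "finite (\<Union>p\<in>S. \<Union>q\<in>S. ?bad p q)" using assms by auto
  then obtain t where "t \<notin> (\<Union>p\<in>S. \<Union>q\<in>S. ?bad p q)"
    using ex_new_if_finite[OF infinite_UNIV_char_0] by blast
  then show ?thesis by (intro exI[of _ t] inj_onI) blast
qed

text \<open>An injective linear map commutes with convex hulls and with intersections.\<close>

lemma crossing_free_shear:
  "crossing_free (shear t ` S) (image (shear t) ` E) \<longleftrightarrow> crossing_free_graph S E"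
proof -
  have hull: "convex hull (shear t ` e) \<inter> convex hull (shear t ` f) = shear t ` e \<inter> shear t ` f \<longleftrightarrow>
      convex hull e \<inter> convex hull f = e \<inter> f" for e f
    by (simp add: convex_hull_linear_image[OF linear_shear, symmetric] image_Int[OF inj_shear, symmetric]
        inj_image_eq_iff[OF inj_shear])
  show ?thesis
    unfolding crossing_free_def crossing_free_graph_def
    by (simp add: hull inj_image_subset_iff[OF inj_shear] inj_image_eq_iff[OF inj_shear]
        card_image[OF inj_on_subset[OF inj_shear subset_UNIV]])
qed

definition shear_graph :: "real \<Rightarrow> (real ^ 2) set set \<Rightarrow> pt set set" where
  "shear_graph t = image (image (shear t))"

lemma bij_shear_graph: "bij (shear_graph t)"
proof -
  have "bij (shear t)" using inj_shear surj_shear by (simp add: bij_def)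
  then have "bij (image (shear t))" using bij_betw_Pow[of "shear t" UNIV UNIV] by simp
  then show ?thesis unfolding shear_graph_def using bij_betw_Pow[of "image (shear t)" UNIV UNIV] by simp
qed

lemma shear_graph_subset_iff: "shear_graph t E \<subseteq> shear_graph t F \<longleftrightarrow> E \<subseteq> F"
  unfolding shear_graph_def
  by (rule inj_image_subset_iff) (use bij_betw_Pow[of "shear t" UNIV UNIV] inj_shear surj_shear in \<open>simp add: bij_def\<close>)

lemma crossing_free_shear_graph: "crossing_free (shear t ` S) (shear_graph t E) \<longleftrightarrow> crossing_free_graph S E"
  unfolding shear_graph_def by (rule crossing_free_shear)

text \<open>The map on edge sets is bijective and respects inclusion, so competing larger graphs
  correspond to each other.\<close>

lemma maximal_graph_shear: "maximal_graph (shear t ` S) (shear_graph t T) \<longleftrightarrow> triangulation_on S T"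
proof -
  have "(\<forall>E'. crossing_free (shear t ` S) E' \<and> shear_graph t T \<subseteq> E' \<longrightarrow> E' = shear_graph t T) \<longleftrightarrow>
    (\<forall>E. crossing_free (shear t ` S) (shear_graph t E) \<and> shear_graph t T \<subseteq> shear_graph t E \<longrightarrow> shear_graph t E = shear_graph t T)"
    using bij_is_surj[OF bij_shear_graph[of t]] by (metis surjD)
  also have "\<dots> \<longleftrightarrow> (\<forall>E. crossing_free_graph S E \<and> T \<subseteq> E \<longrightarrow> E = T)"
    by (simp add: crossing_free_shear_graph shear_graph_subset_iff inj_eq[OF bij_is_inj[OF bij_shear_graph]])
  finally show ?thesis
    unfolding maximal_graph_def triangulation_on_def crossing_free_shear_graph by blast
qed

lemma perfect_matching_shear:
  "crossing_free (shear t ` S) (shear_graph t M) \<and> perfect_matching (shear t ` S) (shear_graph t M) \<longleftrightarrow>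
    crossing_free_perfect_matching S M"
proof -
  have mem: "shear t p \<in> shear t ` e \<longleftrightarrow> p \<in> e" for p e by (rule inj_image_mem_iff[OF inj_shear])
  have "(\<exists>!e'. e' \<in> shear_graph t M \<and> shear t p \<in> e') \<longleftrightarrow> (\<exists>!e. e \<in> M \<and> p \<in> e)" for p
  proof
    assume "\<exists>!e. e \<in> M \<and> p \<in> e"
    then obtain e where e: "e \<in> M" "p \<in> e" "\<And>f. f \<in> M \<Longrightarrow> p \<in> f \<Longrightarrow> f = e" by blast
    show "\<exists>!e'. e' \<in> shear_graph t M \<and> shear t p \<in> e'"
    proof (rule ex1I[of _ "shear t ` e"])
      show "shear t ` e \<in> shear_graph t M \<and> shear t p \<in> shear t ` e" using e(1,2) by (simp add: shear_graph_def)
      fix e' assume "e' \<in> shear_graph t M \<and> shear t p \<in> e'"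
      then obtain f where "f \<in> M" "e' = shear t ` f" "p \<in> f" unfolding shear_graph_def using mem by blast
      then show "e' = shear t ` e" using e(3) by simp
    qed
  next
    assume "\<exists>!e'. e' \<in> shear_graph t M \<and> shear t p \<in> e'"
    then obtain e' where e': "e' \<in> shear_graph t M" "shear t p \<in> e'"
      "\<And>f'. f' \<in> shear_graph t M \<Longrightarrow> shear t p \<in> f' \<Longrightarrow> f' = e'" by blast
    then obtain e where e: "e \<in> M" "e' = shear t ` e" unfolding shear_graph_def by blast
    show "\<exists>!e. e \<in> M \<and> p \<in> e"
    proof (rule ex1I[of _ e])
      show "e \<in> M \<and> p \<in> e" using e e'(2) mem by simp
      fix f assume f: "f \<in> M \<and> p \<in> f"
      then have "shear t ` f = e'" by (intro e'(3)) (simp_all add: shear_graph_def mem)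
      then show "f = e" using e(2) by (simp add: inj_image_eq_iff[OF inj_shear])
    qed
  qed
  then have "(\<forall>p\<in>shear t ` S. \<exists>!e'. e' \<in> shear_graph t M \<and> p \<in> e') \<longleftrightarrow> (\<forall>p\<in>S. \<exists>!e. e \<in> M \<and> p \<in> e)"
    by simp
  moreover have "\<forall>e\<in>shear_graph t M. e \<subseteq> shear t ` S \<and> card e = 2" if "crossing_free (shear t ` S) (shear_graph t M)"
    using that by (simp add: crossing_free_def)
  ultimately show ?thesis
    unfolding crossing_free_perfect_matching_def perfect_matching_def crossing_free_shear_graph[symmetric, of S M t] by argo
qed

lemma card_Collect_bij:
  assumes "bij f" "\<And>x. Q (f x) \<longleftrightarrow> P x"
  shows "card {x. P x} = card {y. Q y}"
proof (rule bij_betw_same_card[of f], unfold bij_betw_def, intro conjI)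
  show "inj_on f {x. P x}" using bij_is_inj[OF assms(1)] by (rule inj_on_subset) simp
  show "f ` {x. P x} = {y. Q y}"
  proof (rule subset_antisym; rule subsetI)
    fix y assume y: "y \<in> {y. Q y}"
    obtain x where "y = f x" using bij_is_surj[OF assms(1)] by (metis surjD)
    then show "y \<in> f ` {x. P x}" using y assms(2) by simp
  qed (use assms(2) in auto)
qed

lemma collinear_shear:
  assumes "collinear (shear t ` A)"
  shows "collinear A"
proof -
  obtain u' where u': "\<And>x y. x \<in> A \<Longrightarrow> y \<in> A \<Longrightarrow> \<exists>c. shear t x - shear t y = c *\<^sub>R u'"
    using assms unfolding collinear_def by blast
  obtain u where u: "u' = shear t u" using surj_shear by (metis surjD)
  have "\<exists>c. x - y = c *\<^sub>R u" if xy: "x \<in> A" "y \<in> A" for x y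
  proof -
    obtain c where "shear t x - shear t y = c *\<^sub>R u'" using u'[OF xy] by blast
    then have "shear t (x - y) = shear t (c *\<^sub>R u)"
      by (simp add: u linear_diff[OF linear_shear] linear_scale[OF linear_shear])
    then show ?thesis using injD[OF inj_shear] by blast
  qed
  then show ?thesis unfolding collinear_def by blast
qed

lemma general_position_shear:
  assumes "general_position S" "p \<in> S" "q \<in> S" "r \<in> S" "p \<noteq> q" "q \<noteq> r" "p \<noteq> r"
  shows "cross (shear t p) (shear t q) (shear t r) \<noteq> 0"
proof
  assume "cross (shear t p) (shear t q) (shear t r) = 0"
  then have "collinear (shear t ` {p, q, r})" using collinear_of_cross_zero by simp
  then have "collinear {p, q, r}" by (rule collinear_shear)
  then show False using assms unfolding general_position_def by blast
qed

lemma pm_le_tr: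
  assumes fin: "finite S" and gp: "general_position S"
  shows "real (pm S) \<le> 8 * (3 / 2) powr (real (card S) / 4) * real (tr S)"
proof -
  obtain t where t: "inj_on (\<lambda>p. fst (shear t p)) S" using shear_separates[OF fin] by blast
  let ?S = "shear t ` S"
  have "real (card {M. crossing_free ?S M \<and> perfect_matching ?S M})
    \<le> 8 * (3 / 2) powr (real (card ?S) / 4) * real (card {T. maximal_graph ?S T})"
  proof (rule matchings_le_maximal_graphs)
    show "finite ?S" using fin by simp
    show "inj_on fst ?S" using t by (auto simp: inj_on_def)
    show "cross p q r \<noteq> 0" if "p \<in> ?S" "q \<in> ?S" "r \<in> ?S" "p \<noteq> q" "q \<noteq> r" "p \<noteq> r" for p q r
      using that general_position_shear[OF gp] by blast
  qed
  moreover have "pm S = card {M. crossing_free ?S M \<and> perfect_matching ?S M}"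
    unfolding pm_def by (rule card_Collect_bij[OF bij_shear_graph[of t]]) (rule perfect_matching_shear)
  moreover have "tr S = card {T. maximal_graph ?S T}"
    unfolding tr_def by (rule card_Collect_bij[OF bij_shear_graph[of t]]) (rule maximal_graph_shear)
  moreover have "card ?S = card S" by (rule card_image[OF inj_on_subset[OF inj_shear subset_UNIV]])
  ultimately show ?thesis by simp
qed

lemma three_halves_root_bound: "(3 / 2) powr (real N / 4) \<le> 1.1067 ^ N"
proof -
  \<comment> \<open>The decimal is the fourth root of \<open>3 / 2\<close>, rounded up.\<close>
  have "(3 / 2 :: real) \<le> 1.1067 ^ 4" by (simp add: power_divide)
  then have "(3 / 2 :: real) powr (real N / 4) \<le> (1.1067 ^ 4) powr (real N / 4)" by (intro powr_mono2) auto
  also have "\<dots> = (1.1067 powr 4) powr (real N / 4)" by simp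
  also have "\<dots> = 1.1067 ^ N" unfolding powr_powr by (simp add: powr_realpow)
  finally show ?thesis .
qed

theorem theorem2:
  "(\<forall>(N::nat) (S::point set). finite S \<and> card S = N \<and> general_position S \<longrightarrow>
      real (pm S) \<le> 8 * (3 / 2) powr (real N / 4) * real (tr S)) \<and>
   (\<exists>f :: nat \<Rightarrow> real. f \<in> O(\<lambda>N. 1.1067 ^ N) \<and>
      (\<forall>(N::nat) (S::point set). finite S \<and> card S = N \<and> general_position S \<longrightarrow>
         real (pm S) \<le> f N * real (tr S)))"
proof (intro conjI exI[of _ "\<lambda>N. 8 * (3 / 2) powr (real N / 4)"])
  show "(\<lambda>N. 8 * (3 / 2) powr (real N / 4)) \<in> O(\<lambda>N. 1.1067 ^ N :: real)"
  proof (rule bigoI[of _ 8], rule always_eventually, rule allI)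
    fix N show "norm (8 * (3 / 2) powr (real N / 4)) \<le> 8 * norm (1.1067 ^ N :: real)"
      using three_halves_root_bound[of N] by (simp only: norm_mult real_norm_def abs_of_nonneg powr_ge_zero zero_le_power) simp
  qed
qed (use pm_le_tr in blast)+

end
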